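(* Let $q=2^{2n+1}$ with $n\geqslant1$ an integer, let $r=2^{n+1}$, $\alpha_q=q-r+1$ and $\beta_q=q+r+1$. Then the number of spanning trees of the commuting graph of the Suzuki group $\mathrm{Sz}(q)$ is $$\kappa_{\mathcal C}(\mathrm{Sz}(q))=\left(2^{(q-1)^2}q^{\,q^2+q-3}\right)^{q^2+1}(q-1)^{(q-3)a}\,\alpha_q^{(\alpha_q-2)b}\,\beta_q^{(\beta_q-2)c},$$ where $a=q^2(q^2+1)/2$, $b=q^2(q-1)\beta_q/4$ and $c=q^2(q-1)\alpha_q/4$.
   Context: For a finite group $G$, the commuting graph $\mathcal{C}(G)$ has vertex set $G$, two distinct elements being adjacent when they commute. $\kappa_{\mathcal C}(G)$ denotes the number of spanning trees of $\mathcal{C}(G)$. $\mathrm{Sz}(q)$ is the Suzuki simple group of Lie type over the field of $q$ elements. *)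

theory Defs
  imports "HOL-Analysis.Analysis"
begin

section \<open>Simple graphs and spanning trees\<close>

text \<open>A simple undirected graph is given by a vertex set V and a set E of edges,
  each edge being a 2-element subset of V.  A set T of edges is a spanning tree
  of (V,E) if T is a subset of E, the graph (V,T) is connected and (V,T) has no cycle.\<close>

definition edge_rel :: "'v set set \<Rightarrow> ('v \<times> 'v) set" where
  "edge_rel T = {(x, y). {x, y} \<in> T \<and> x \<noteq> y}"

definition graph_connected :: "'v set \<Rightarrow> 'v set set \<Rightarrow> bool" where
  "graph_connected V T \<longleftrightarrow> (\<forall>u\<in>V. \<forall>w\<in>V. (u, w) \<in> (edge_rel T)\<^sup>*)"

text \<open>A cycle: a list of at least 3 distinct vertices, consecutive ones
  (cyclically) joined by an edge.\<close>
definition has_cycle :: "'v set set \<Rightarrow> bool" where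
  "has_cycle T \<longleftrightarrow> (\<exists>vs. length vs \<ge> 3 \<and> distinct vs \<and>
      (\<forall>i < length vs. {vs ! i, vs ! ((i + 1) mod length vs)} \<in> T))"

definition is_spanning_tree :: "'v set \<Rightarrow> 'v set set \<Rightarrow> 'v set set \<Rightarrow> bool" where
  "is_spanning_tree V E T \<longleftrightarrow> T \<subseteq> E \<and> graph_connected V T \<and> \<not> has_cycle T"

definition num_spanning_trees :: "'v set \<Rightarrow> 'v set set \<Rightarrow> nat" where
  "num_spanning_trees V E = card {T. is_spanning_tree V E T}"

section \<open>Commuting graph\<close>

text \<open>Commuting graph of a group of matrices G (vertex set G, distinct commuting
  elements adjacent).\<close>
definition commuting_edges :: "('a::semiring_1 ^ 'n ^ 'n) set \<Rightarrow> ('a ^ 'n ^ 'n) set set" where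
  "commuting_edges G = {{g, h} | g h. g \<in> G \<and> h \<in> G \<and> g \<noteq> h \<and> g ** h = h ** g}"

definition kappa_C :: "('a::semiring_1 ^ 'n ^ 'n) set \<Rightarrow> nat" where
  "kappa_C G = num_spanning_trees G (commuting_edges G)"

section \<open>Suzuki group (Wilson, The Finite Simple Groups, 4.2.2)\<close>

text \<open>Over a field F of order q = 2^(2n+1), with theta(x) = x^(2^(n+1)).\<close>

definition sz_theta :: "nat \<Rightarrow> 'a::field \<Rightarrow> 'a" where
  "sz_theta n x = x ^ (2 ^ (n + 1))"

definition mat4 :: "'a::zero list list \<Rightarrow> 'a ^ 4 ^ 4" where
  "mat4 xss = vector (map vector xss)"

definition sz_S :: "nat \<Rightarrow> 'a::field \<Rightarrow> 'a \<Rightarrow> 'a ^ 4 ^ 4" where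
  "sz_S n a b = mat4
     [[1, 0, 0, 0],
      [a, 1, 0, 0],
      [b, sz_theta n a, 1, 0],
      [a ^ 2 * sz_theta n a + a * b + sz_theta n b, a * sz_theta n a + b, a, 1]]"

definition sz_M :: "nat \<Rightarrow> 'a::field \<Rightarrow> 'a ^ 4 ^ 4" where
  "sz_M n l = mat4
     [[l ^ (1 + 2 ^ n), 0, 0, 0],
      [0, l ^ (2 ^ n), 0, 0],
      [0, 0, inverse (l ^ (2 ^ n)), 0],
      [0, 0, 0, inverse (l ^ (1 + 2 ^ n))]]"

definition sz_T :: "'a::field ^ 4 ^ 4" where
  "sz_T = mat4 [[0, 0, 0, 1], [0, 0, 1, 0], [0, 1, 0, 0], [1, 0, 0, 0]]"

definition sz_gens :: "nat \<Rightarrow> ('a::field ^ 4 ^ 4) set" where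
  "sz_gens n = {sz_S n a b | a b. True} \<union> {sz_M n l | l. l \<noteq> 0} \<union> {sz_T}"

text \<open>Subgroup of GL_4 generated by a set of invertible matrices.\<close>
inductive_set gen_mat_group :: "('a::field ^ 'n ^ 'n) set \<Rightarrow> ('a ^ 'n ^ 'n) set"
  for X where
  one: "mat 1 \<in> gen_mat_group X"
| gen: "g \<in> X \<Longrightarrow> g \<in> gen_mat_group X"
| mult: "g \<in> gen_mat_group X \<Longrightarrow> h \<in> gen_mat_group X \<Longrightarrow> g ** h \<in> gen_mat_group X"
| inv: "g \<in> gen_mat_group X \<Longrightarrow> h ** g = mat 1 \<Longrightarrow> h \<in> gen_mat_group X"

definition Suzuki :: "nat \<Rightarrow> ('a::field ^ 4 ^ 4) set" where
  "Suzuki n = gen_mat_group (sz_gens n)"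

end

theory Submission
  imports Defs "HOL-Number_Theory.Cong" "HOL-Algebra.Sylow" "HOL-Algebra.Multiplicative_Group"
begin

text \<open>The identity is adjacent to every element, so a spanning tree of the commuting graph is an
  acyclic parent function on the other elements, and the number of these is multiplicative over the
  connected components left after removing the identity. Cliques, and the graphs obtained by joining
  a few universal vertices to a union of cliques, are counted by repeatedly adding a vertex joined to
  everything.

  In the action on the ovoid of \<open>q\<^sup>2 + 1\<close> points, commuting non-trivial elements have the same fixed
  points. One fixed point gives the non-trivial elements of a Sylow 2-subgroup, two give those of a
  cyclic group of order \<open>q - 1\<close>. An element \<open>g\<close> without fixed points has an abelian centralizer \<open>T\<close>:
  a power of \<open>g\<close> has prime order dividing \<open>q\<^sup>2 + 1\<close>, hence acts irreducibly on the natural module, and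
  its centralizing matrices form a field of order \<open>q\<^sup>4\<close>. Conjugates of \<open>g\<close> in that field are
  roots of one polynomial of degree at most 4, so \<open>m = |N(T) : T| \<le> 4\<close>. Counting cosets of \<open>T\<close> fixed by an
  element of prime order \<open>p\<close> of \<open>T\<close> gives \<open>|G : T| \<equiv> m \<noteq> 0\<close> modulo \<open>p\<close>; hence the orders of non-conjugate \<open>T\<close> are
  coprime and multiply to \<open>q\<^sup>2 + 1\<close>. Comparing with the number of fixed-point-free elements leaves exactly
  two classes, of orders \<open>q - r + 1\<close> and \<open>q + r + 1\<close>, both with \<open>m = 4\<close>.\<close>


section \<open>Counting forests by parent functions\<close>

text \<open>Determinants are avoided: vertices are turned into roots instead, which is why forests
  carry a set \<open>R\<close> of roots rather than a single one. The obstacle is the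
  fixed-point-free part of the group. The centralizers there are never constructed; their orders and
  numbers are forced by counting, so that divisibilities, congruences and the bound on
  \<open>m\<close> are all that has to be known about them. The bound 4 is the dimension of the
  natural module, and 2 and 3 do not divide \<open>q\<^sup>2 + 1\<close>, so every prime involved
  exceeds \<open>m\<close>; this is why the residue \<open>m\<close> is nonzero. The two orders are
  the roots of X^2 - (2q + 2)X + q^2 + 1, which differ from q + 1 by a square root of 2q, that is by
  r. In the final formula a is the number of unordered pairs of points, and the denominator 4 in b
  and c is the index \<open>m\<close>.\<close>

definition acyclic_fun :: "'v set \<Rightarrow> ('v \<Rightarrow> 'v) \<Rightarrow> bool" where
  "acyclic_fun V f \<longleftrightarrow> (\<forall>S\<subseteq>V. f ` S \<subseteq> S \<longrightarrow> S = {})"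

text \<open>Spanning forests rooted in \<open>R\<close> of the graph in which every root is joined
  to all of \<open>V\<close>; thus \<open>A\<close> matters only inside \<open>V\<close>.
  Extensionality pins the values off \<open>V\<close>, so that each forest is one function.\<close>

definition forests :: "'v set \<Rightarrow> ('v \<Rightarrow> 'v \<Rightarrow> bool) \<Rightarrow> 'v set \<Rightarrow> ('v \<Rightarrow> 'v) set" where
  "forests V A R = {f \<in> Pi\<^sub>E V (\<lambda>v. {u \<in> V. A v u} \<union> R). acyclic_fun V f}"

lemma acyclic_funI:
  "(\<And>S. S \<subseteq> V \<Longrightarrow> f ` S \<subseteq> S \<Longrightarrow> S = {}) \<Longrightarrow> acyclic_fun V f"
  by (simp add: acyclic_fun_def)

lemma acyclic_funD: "acyclic_fun V f \<Longrightarrow> S \<subseteq> V \<Longrightarrow> f ` S \<subseteq> S \<Longrightarrow> S = {}"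
  by (simp add: acyclic_fun_def)

text \<open>Forbidding nonempty closed subsets means that every orbit leaves \<open>V\<close>, so
  the parent relation is well-founded. Induction runs from the roots outwards, with no hypothesis
  when the parent is already outside \<open>V\<close>.\<close>

lemma acyclic_fun_induct [consumes 2, case_names step]:
  assumes "acyclic_fun V f" "v \<in> V"
    and "\<And>v. v \<in> V \<Longrightarrow> (f v \<in> V \<Longrightarrow> P (f v)) \<Longrightarrow> P v"
  shows "P v"
proof -
  let ?S = "{v \<in> V. \<not> P v}"
  have "f ` ?S \<subseteq> ?S" using assms(3) by blast
  then have "?S = {}" by (intro acyclic_funD[OF assms(1)]) auto
  then show ?thesis using assms(2) by blast
qed

lemma acyclic_fun_subset:
  "acyclic_fun V f \<Longrightarrow> W \<subseteq> V \<Longrightarrow> acyclic_fun W f"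
  by (meson acyclic_funD acyclic_funI subset_trans)

lemma acyclic_fun_cong:
  assumes "\<And>v. v \<in> V \<Longrightarrow> f v = g v"
  shows "acyclic_fun V f = acyclic_fun V g"
proof -
  have "f ` S = g ` S" if "S \<subseteq> V" for S
    using assms that by (intro image_cong) auto
  then show ?thesis unfolding acyclic_fun_def by simp
qed

lemma finite_forests:
  "finite V \<Longrightarrow> finite R \<Longrightarrow> finite (forests V A R)"
  unfolding forests_def
  by (rule finite_subset[of _ "Pi\<^sub>E V (\<lambda>v. V \<union> R)"]) (auto intro!: finite_PiE)

lemma forests_empty: "forests {} A R = {\<lambda>x. undefined}"
  unfolding forests_def acyclic_fun_def by auto

text \<open>No parent edge crosses between the parts, so a forest is a pair of forests with shared
  roots. Acyclicity can be tested on each part because a closed set meets each part in a closed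
  set.\<close>

lemma card_forests_Un:
  assumes disj: "V \<inter> W = {}" "V \<inter> R = {}" "W \<inter> R = {}"
    and sep: "\<And>v w. v \<in> V \<Longrightarrow> w \<in> W \<Longrightarrow> \<not> A v w \<and> \<not> A w v"
  shows "card (forests (V \<union> W) A R) = card (forests V A R) * card (forests W A R)"
proof -
  let ?\<phi> = "\<lambda>f. (restrict f V, restrict f W)"
  let ?\<psi> = "\<lambda>(g, h) x. if x \<in> V then g x else h x"
  have "bij_betw ?\<phi> (forests (V \<union> W) A R) (forests V A R \<times> forests W A R)"
  proof (rule bij_betw_byWitness[where f' = ?\<psi>])
    show "\<forall>f\<in>forests (V \<union> W) A R. ?\<psi> (?\<phi> f) = f"
    proof
      fix f assume "f \<in> forests (V \<union> W) A R"
      then have "f x = undefined" if "x \<notin> V \<union> W" for x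
        using that unfolding forests_def by (auto simp: PiE_def extensional_def)
      then show "?\<psi> (?\<phi> f) = f" by (auto simp: fun_eq_iff)
    qed
    show "\<forall>p\<in>forests V A R \<times> forests W A R. ?\<phi> (?\<psi> p) = p"
    proof
      fix p assume "p \<in> forests V A R \<times> forests W A R"
      then have "fst p \<in> extensional V" "snd p \<in> extensional W"
        unfolding forests_def by (auto simp: PiE_def)
      moreover have "x \<notin> V" if "x \<in> W" for x using disj that by blast
      ultimately have "restrict (?\<psi> p) V = fst p" "restrict (?\<psi> p) W = snd p"
        by (auto simp: fun_eq_iff extensional_def split: prod.splits)
      then show "?\<phi> (?\<psi> p) = p" by (simp del: split_conv)
    qed
    have "restrict f V \<in> forests V A R \<and> restrict f W \<in> forests W A R"
      if f: "f \<in> forests (V \<union> W) A R" for f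
    proof -
      have ac: "acyclic_fun (V \<union> W) f"
        and fin: "\<And>x. x \<in> V \<union> W \<Longrightarrow> f x \<in> {u \<in> V \<union> W. A x u} \<union> R"
        using f unfolding forests_def by auto
      have "acyclic_fun V f" "acyclic_fun W f" using acyclic_fun_subset[OF ac] by auto
      then have "acyclic_fun V (restrict f V)" "acyclic_fun W (restrict f W)"
        using acyclic_fun_cong[of V f "restrict f V"] acyclic_fun_cong[of W f "restrict f W"] by auto
      moreover have "restrict f V \<in> Pi\<^sub>E V (\<lambda>v. {u \<in> V. A v u} \<union> R)"
      proof (rule PiE_I)
        fix x assume x: "x \<in> V"
        then show "restrict f V x \<in> {u \<in> V. A x u} \<union> R"
          using fin[of x] sep[of x "f x"] sep[of "f x" x] by auto
      qed auto
      moreover have "restrict f W \<in> Pi\<^sub>E W (\<lambda>v. {u \<in> W. A v u} \<union> R)"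
      proof (rule PiE_I)
        fix x assume x: "x \<in> W"
        then show "restrict f W x \<in> {u \<in> W. A x u} \<union> R"
          using fin[of x] sep[of x "f x"] sep[of "f x" x] by auto
      qed auto
      ultimately show ?thesis unfolding forests_def by auto
    qed
    then show "?\<phi> ` forests (V \<union> W) A R \<subseteq> forests V A R \<times> forests W A R" by auto
    have ext: "?\<psi> (g, h) \<in> forests (V \<union> W) A R"
      if g: "g \<in> forests V A R" and h: "h \<in> forests W A R" for g h
    proof -
      define f where "f = (\<lambda>x. if x \<in> V then g x else h x)"
      have gP: "\<And>x. x \<in> V \<Longrightarrow> g x \<in> {u \<in> V. A x u} \<union> R" "acyclic_fun V g"
        and hP: "\<And>x. x \<in> W \<Longrightarrow> h x \<in> {u \<in> W. A x u} \<union> R" "acyclic_fun W h"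
          "h \<in> extensional W"
        using g h unfolding forests_def PiE_def by blast+
      have fV: "f v = g v" if "v \<in> V" for v using that by (simp add: f_def)
      have fW: "f v = h v" if "v \<in> W" for v using that disj(1) by (auto simp: f_def)
      have acV: "acyclic_fun V f" using gP(2) acyclic_fun_cong[OF fV] by simp
      have acW: "acyclic_fun W f" using hP(2) acyclic_fun_cong[OF fW] by simp
      have iV: "f v \<in> V \<union> R" if "v \<in> V" for v using gP(1)[OF that] fV[OF that] by auto
      have iW: "f v \<in> W \<union> R" if "v \<in> W" for v using hP(1)[OF that] fW[OF that] by auto
      have "acyclic_fun (V \<union> W) f"
      proof (rule acyclic_funI)
        fix S assume S: "S \<subseteq> V \<union> W" "f ` S \<subseteq> S"
        have "f ` (S \<inter> V) \<subseteq> S \<inter> V"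
        proof
          fix y assume "y \<in> f ` (S \<inter> V)"
          then obtain v where v: "v \<in> S" "v \<in> V" "y = f v" by blast
          then have "y \<in> S" "y \<in> V \<union> R" using S(2) iV by blast+
          then show "y \<in> S \<inter> V" using S disj by blast
        qed
        then have 1: "S \<inter> V = {}" by (intro acyclic_funD[OF acV]) auto
        have "f ` (S \<inter> W) \<subseteq> S \<inter> W"
        proof
          fix y assume "y \<in> f ` (S \<inter> W)"
          then obtain v where v: "v \<in> S" "v \<in> W" "y = f v" by blast
          then have "y \<in> S" "y \<in> W \<union> R" using S(2) iW by blast+
          then show "y \<in> S \<inter> W" using S disj by blast
        qed
        then have "S \<inter> W = {}" by (intro acyclic_funD[OF acW]) auto
        then show "S = {}" using 1 S by blast
      qed
      moreover have "f \<in> Pi\<^sub>E (V \<union> W) (\<lambda>v. {u \<in> V \<union> W. A v u} \<union> R)"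
      proof (rule PiE_I)
        fix x assume x: "x \<in> V \<union> W"
        show "f x \<in> {u \<in> V \<union> W. A x u} \<union> R"
        proof (cases "x \<in> V")
          case True
          then show ?thesis using gP(1)[OF True] fV[OF True] by auto
        next
          case False
          then have "x \<in> W" using x by blast
          then show ?thesis using hP(1)[of x] fW[of x] by auto
        qed
      next
        fix x assume "x \<notin> V \<union> W"
        then show "f x = undefined" using hP(3) by (simp add: f_def extensional_def)
      qed
      ultimately show ?thesis unfolding forests_def f_def by simp
    qed
    show "?\<psi> ` (forests V A R \<times> forests W A R) \<subseteq> forests (V \<union> W) A R"
    proof (rule image_subsetI)
      fix p assume "p \<in> forests V A R \<times> forests W A R"
      then show "?\<psi> p \<in> forests (V \<union> W) A R" using ext[of "fst p" "snd p"]
        by (cases p) (simp only: mem_Times_iff fst_conv snd_conv)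
    qed
  qed
  then show ?thesis by (simp add: bij_betw_same_card card_cartesian_product)
qed

lemma card_forests_UN:
  assumes "finite I" "\<And>i j. i \<in> I \<Longrightarrow> j \<in> I \<Longrightarrow> i \<noteq> j \<Longrightarrow> B i \<inter> B j = {}"
    and "\<And>i. i \<in> I \<Longrightarrow> B i \<inter> R = {}"
    and "\<And>i j v w. i \<in> I \<Longrightarrow> j \<in> I \<Longrightarrow> i \<noteq> j \<Longrightarrow> v \<in> B i \<Longrightarrow> w \<in> B j \<Longrightarrow> \<not> A v w"
  shows "card (forests (\<Union>i\<in>I. B i) A R) = (\<Prod>i\<in>I. card (forests (B i) A R))"
  using assms
proof (induction I rule: finite_induct)
  case empty
  then show ?case by (simp add: forests_empty)
next
  case (insert i I)
  have "card (forests (B i \<union> (\<Union>i\<in>I. B i)) A R)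
     = card (forests (B i) A R) * card (forests (\<Union>i\<in>I. B i) A R)"
  proof (rule card_forests_Un)
    have "B i \<inter> B j = {}" if "j \<in> I" for j using insert.prems(1)[of i j] insert.hyps that by auto
    then show "B i \<inter> (\<Union>i\<in>I. B i) = {}" by blast
    show "B i \<inter> R = {}" using insert.prems(2) by simp
    have "B j \<inter> R = {}" if "j \<in> I" for j using insert.prems(2)[of j] that by simp
    then show "(\<Union>i\<in>I. B i) \<inter> R = {}" by blast
    fix v w assume v: "v \<in> B i" and "w \<in> (\<Union>i\<in>I. B i)"
    then obtain j where j: "j \<in> I" "w \<in> B j" by blast
    then have "i \<noteq> j" using insert.hyps by blast
    then show "\<not> A v w \<and> \<not> A w v"
      using insert.prems(3)[of i j v w] insert.prems(3)[of j i w v] v j by blast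
  qed
  also have "card (forests (\<Union>i\<in>I. B i) A R) = (\<Prod>i\<in>I. card (forests (B i) A R))"
    by (rule insert.IH) (use insert.prems in blast)+
  finally show ?case using insert.hyps by simp
qed

section \<open>Sizes of the trees hanging from the roots\<close>

text \<open>Steps start only inside \<open>V\<close>, so the walk halts at the first root and
  \<open>f\<close> is never evaluated there.\<close>

definition flows :: "'v set \<Rightarrow> ('v \<Rightarrow> 'v) \<Rightarrow> 'v \<Rightarrow> 'v \<Rightarrow> bool" where
  "flows V f u w \<longleftrightarrow> (u, w) \<in> {(x, f x) |x. x \<in> V}\<^sup>*"

lemma flows_step: "u \<in> V \<Longrightarrow> flows V f u w \<longleftrightarrow> u = w \<or> flows V f (f u) w"
proof
  assume "u \<in> V" "flows V f u w"
  then show "u = w \<or> flows V f (f u) w"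
    unfolding flows_def by (auto elim: converse_rtranclE)
next
  assume "u \<in> V" "u = w \<or> flows V f (f u) w"
  then show "flows V f u w"
    unfolding flows_def by (auto intro: converse_rtrancl_into_rtrancl)
qed

lemma flows_stop: "u \<notin> V \<Longrightarrow> flows V f u w \<longleftrightarrow> u = w"
  unfolding flows_def by (auto elim: converse_rtranclE)

lemma flows_root_unique:
  assumes ac: "acyclic_fun V f" and fR: "f ` V \<subseteq> V \<union> R" and dj: "V \<inter> R = {}" and u: "u \<in> V"
  shows "\<exists>!w. w \<in> R \<and> flows V f u w"
  using ac u
proof (induction rule: acyclic_fun_induct)
  case (step v)
  have st: "flows V f v w \<longleftrightarrow> flows V f (f v) w" if "w \<in> R" for w
    using flows_step[OF step.hyps] that step.hyps dj by auto
  have "\<exists>!w. w \<in> R \<and> flows V f (f v) w"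
  proof (cases "f v \<in> V")
    case True
    then show ?thesis using step by blast
  next
    case False
    then have "f v \<in> R" using fR step.hyps by blast
    then show ?thesis using flows_stop[OF False] by metis
  qed
  then show ?case using st by metis
qed

text \<open>Every vertex may take any root as parent, so exchanging the names \<open>a\<close> and
  \<open>b\<close> among the values of a forest gives a forest again. This involution turns the tree
  of \<open>a\<close> into the tree of \<open>b\<close>.\<close>

lemma card_forests_root_sym:
  assumes fin: "finite V" and dj: "V \<inter> R = {}" and a: "a \<in> R" and b: "b \<in> R" and finR: "finite R"
  shows "(\<Sum>f\<in>forests V A R. card {u \<in> V. flows V f u a})
       = (\<Sum>f\<in>forests V A R. card {u \<in> V. flows V f u b})"
proof -
  let ?t = "Transposition.transpose a b"
  define \<tau> where "\<tau> f = restrict (\<lambda>x. ?t (f x)) V" for f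
  have abV: "a \<notin> V" "b \<notin> V" using a b dj by auto
  have tV: "?t x = x" if "x \<in> V" for x using that abV by (auto simp: Transposition.transpose_def)
  have tR: "?t x \<in> R" if "x \<in> R" for x using that a b by (auto simp: Transposition.transpose_def)
  have step: "\<tau> f \<in> forests V A R \<and> \<tau> (\<tau> f) = f \<and> (\<forall>u\<in>V. flows V (\<tau> f) u b = flows V f u a)"
    if f: "f \<in> forests V A R" for f
  proof -
    have ac: "acyclic_fun V f" and P: "\<And>x. x \<in> V \<Longrightarrow> f x \<in> {u \<in> V. A x u} \<union> R"
      and ext: "f \<in> extensional V"
      using f unfolding forests_def PiE_def by blast+
    have "acyclic_fun V (\<tau> f)"
    proof (rule acyclic_funI)
      fix S assume S: "S \<subseteq> V" "\<tau> f ` S \<subseteq> S"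
      have "f x \<in> S" if "x \<in> S" for x
      proof -
        have "\<tau> f x \<in> S" "x \<in> V" using S that by blast+
        then have "?t (f x) \<in> S" by (simp add: \<tau>_def)
        then have "?t (f x) \<in> V" using S by blast
        then have "?t (?t (f x)) = ?t (f x)" by (rule tV)
        then show ?thesis using \<open>?t (f x) \<in> S\<close> by simp
      qed
      then show "S = {}" using acyclic_funD[OF ac S(1)] by blast
    qed
    moreover have "\<tau> f \<in> Pi\<^sub>E V (\<lambda>v. {u \<in> V. A v u} \<union> R)"
    proof (rule PiE_I)
      fix x assume x: "x \<in> V"
      then show "\<tau> f x \<in> {u \<in> V. A x u} \<union> R"
        using P[OF x] tR[of "f x"] tV[of "f x"] by (auto simp: \<tau>_def)
    qed (simp add: \<tau>_def)
    ultimately have 1: "\<tau> f \<in> forests V A R" unfolding forests_def by blast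
    have 2: "\<tau> (\<tau> f) = f"
      using ext by (auto simp: \<tau>_def fun_eq_iff extensional_def restrict_def)
    have "flows V (\<tau> f) u b = flows V f u a" if "u \<in> V" for u
      using ac that
    proof (induction rule: acyclic_fun_induct)
      case (step v)
      have "v \<noteq> a" "v \<noteq> b" using step abV by auto
      then have *: "flows V (\<tau> f) v b = flows V (\<tau> f) (?t (f v)) b" "flows V f v a = flows V f (f v) a"
        using flows_step[OF step.hyps, of f a] flows_step[OF step.hyps, of "\<tau> f" b] step.hyps
        by (auto simp: \<tau>_def)
      show ?case
      proof (cases "f v \<in> V")
        case True
        then show ?thesis using * step.IH tV by simp
      next
        case False
        then have "f v \<in> R" using P[OF step.hyps] by auto
        then have "?t (f v) \<notin> V" using tR dj by blast
        then show ?thesis using * flows_stop[OF False] flows_stop[of "?t (f v)"]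
          by (auto simp: Transposition.transpose_def)
      qed
    qed
    then show ?thesis using 1 2 by blast
  qed
  have "bij_betw \<tau> (forests V A R) (forests V A R)"
    by (rule bij_betw_byWitness[where f' = \<tau>]) (use step in auto)
  then have "(\<Sum>f\<in>forests V A R. card {u \<in> V. flows V f u b})
       = (\<Sum>f\<in>forests V A R. card {u \<in> V. flows V (\<tau> f) u b})"
    by (rule sum.reindex_bij_betw[symmetric])
  also have "\<dots> = (\<Sum>f\<in>forests V A R. card {u \<in> V. flows V f u a})"
  proof (rule sum.cong[OF refl])
    fix f assume "f \<in> forests V A R"
    then have "{u \<in> V. flows V (\<tau> f) u b} = {u \<in> V. flows V f u a}" using step by blast
    then show "card {u \<in> V. flows V (\<tau> f) u b} = card {u \<in> V. flows V f u a}" by simp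
  qed
  finally show ?thesis by simp
qed

text \<open>For each forest the trees of the roots partition \<open>V\<close>, and by symmetry all
  roots receive the same total. This is the average size of a tree, multiplied out to stay in the
  natural numbers.\<close>

lemma card_forests_root_share:
  assumes fin: "finite V" and dj: "V \<inter> R = {}" and a: "a \<in> R" and finR: "finite R"
  shows "card R * (\<Sum>f\<in>forests V A R. card {u \<in> V. flows V f u a}) = card V * card (forests V A R)"
proof -
  have "card R * (\<Sum>f\<in>forests V A R. card {u \<in> V. flows V f u a})
     = (\<Sum>w\<in>R. \<Sum>f\<in>forests V A R. card {u \<in> V. flows V f u a})" by simp
  also have "\<dots> = (\<Sum>w\<in>R. \<Sum>f\<in>forests V A R. card {u \<in> V. flows V f u w})"
    by (rule sum.cong[OF refl]) (rule card_forests_root_sym[OF fin dj a _ finR])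
  also have "\<dots> = (\<Sum>f\<in>forests V A R. \<Sum>w\<in>R. card {u \<in> V. flows V f u w})"
    by (rule sum.swap)
  also have "\<dots> = (\<Sum>f\<in>forests V A R. card V)"
  proof (rule sum.cong[OF refl])
    fix f assume f: "f \<in> forests V A R"
    have ac: "acyclic_fun V f" and im: "f ` V \<subseteq> V \<union> R"
      using f unfolding forests_def by (auto simp: PiE_def Pi_def)
    note uq = flows_root_unique[OF ac im dj]
    have "card V = card (\<Union>w\<in>R. {u \<in> V. flows V f u w})"
      by (rule arg_cong[where f = card]) (use uq in blast)
    also have "\<dots> = (\<Sum>w\<in>R. card {u \<in> V. flows V f u w})"
    proof (rule card_UN_disjoint[OF finR])
      show "\<forall>w\<in>R. finite {u \<in> V. flows V f u w}" using fin by simp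
      show "\<forall>w\<in>R. \<forall>w'\<in>R. w \<noteq> w' \<longrightarrow>
          {u \<in> V. flows V f u w} \<inter> {u \<in> V. flows V f u w'} = {}"
        using uq by blast
    qed
    finally show "(\<Sum>w\<in>R. card {u \<in> V. flows V f u w}) = card V" by simp
  qed
  finally show ?thesis by (simp add: mult.commute)
qed

text \<open>In a forest on \<open>V\<close> where \<open>v\<close> counts as a root, the parent of \<open>v\<close> must avoid the tree
  hanging from \<open>v\<close>, whose average size is known because all roots play the same role.\<close>
lemma card_forests_cone:
  assumes fin: "finite V" "finite R" and v: "v \<notin> V" "v \<notin> R" and dj: "V \<inter> R = {}"
    and A: "\<And>u. u \<in> V \<Longrightarrow> A u v" "\<And>u. u \<in> V \<Longrightarrow> A v u"
  shows "(card R + 1) * card (forests (insert v V) A R)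
       = card R * (card R + card V + 1) * card (forests V A (insert v R))"
proof -
  let ?F = "forests V A (insert v R)" and ?C = "\<lambda>f. {u \<in> V. flows V f u v}"
  let ?\<phi> = "\<lambda>g. (restrict g V, g v)" and ?\<psi> = "\<lambda>p. (fst p)(v := snd p)"
  \<comment> \<open>With \<open>v\<close> seen as a root of \<open>f\<close>, its own parent may be
    an old root or a vertex outside its tree \<open>?C f\<close>; a parent inside that tree would
    close a cycle through \<open>v\<close>.\<close>
  let ?D = "Sigma ?F (\<lambda>f. R \<union> (V - ?C f))"
  have dj': "V \<inter> insert v R = {}" using v dj by blast
  have "bij_betw ?\<phi> (forests (insert v V) A R) ?D"
  proof (rule bij_betw_byWitness[where f' = ?\<psi>])
    show "\<forall>g\<in>forests (insert v V) A R. ?\<psi> (?\<phi> g) = g"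
    proof
      fix g assume "g \<in> forests (insert v V) A R"
      then have "g x = undefined" if "x \<notin> insert v V" for x
        using that unfolding forests_def by (auto simp: PiE_def extensional_def)
      then show "?\<psi> (?\<phi> g) = g" by (auto simp: fun_eq_iff)
    qed
    show "\<forall>p\<in>?D. ?\<phi> (?\<psi> p) = p"
    proof
      fix p assume p: "p \<in> ?D"
      then have "fst p \<in> extensional V" unfolding forests_def by (auto simp: PiE_def)
      then show "?\<phi> (?\<psi> p) = p" using v by (cases p) (auto simp: fun_eq_iff extensional_def restrict_def)
    qed
    show "?\<phi> ` forests (insert v V) A R \<subseteq> ?D"
    proof (rule image_subsetI)
      fix g assume g: "g \<in> forests (insert v V) A R"
      have ac: "acyclic_fun (insert v V) g"
        and P: "\<And>x. x \<in> insert v V \<Longrightarrow> g x \<in> {u \<in> insert v V. A x u} \<union> R"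
        using g unfolding forests_def PiE_def by blast+
      have gv: "g v \<noteq> v" using acyclic_funD[OF ac, of "{v}"] by auto
      have "acyclic_fun V (restrict g V)"
        using acyclic_fun_subset[OF ac, of V] acyclic_fun_cong[of V g "restrict g V"] by auto
      moreover have "restrict g V \<in> Pi\<^sub>E V (\<lambda>x. {u \<in> V. A x u} \<union> insert v R)"
      proof (rule PiE_I)
        fix x assume x: "x \<in> V"
        then show "restrict g V x \<in> {u \<in> V. A x u} \<union> insert v R" using P[of x] by auto
      qed auto
      ultimately have 1: "restrict g V \<in> ?F" unfolding forests_def by blast
      have "g v \<notin> ?C (restrict g V)"
      proof
        assume "g v \<in> ?C (restrict g V)"
        then have "g ` insert v {u\<in>V. flows V (restrict g V) u v} \<subseteq> insert v {u\<in>V. flows V (restrict g V) u v}"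
        proof (intro image_subsetI)
          fix x assume gvC: "g v \<in> ?C (restrict g V)" and x: "x \<in> insert v (?C (restrict g V))"
          show "g x \<in> insert v (?C (restrict g V))"
          proof (cases "x = v")
            case True
            then show ?thesis using gvC by blast
          next
            case False
            then have xV: "x \<in> V" and fl: "flows V (restrict g V) x v" using x by auto
            then have fl': "flows V (restrict g V) (g x) v" using flows_step[OF xV, of "restrict g V" v] False by simp
            then show ?thesis using flows_stop[of "g x" V "restrict g V" v] by auto
          qed
        qed
        then show False using acyclic_funD[OF ac, of "insert v (?C (restrict g V))"] by auto
      qed
      then have "g v \<in> R \<union> (V - ?C (restrict g V))" using P[of v] gv by auto
      then show "?\<phi> g \<in> ?D" using 1 by blast
    qed
    show "?\<psi> ` ?D \<subseteq> forests (insert v V) A R"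
    proof (rule image_subsetI)
      fix p assume "p \<in> ?D"
      then obtain f y where p: "p = (f, y)" and f: "f \<in> ?F" and y: "y \<in> R \<union> (V - ?C f)" by blast
      have ac: "acyclic_fun V f"
        and P: "\<And>x. x \<in> V \<Longrightarrow> f x \<in> {u \<in> V. A x u} \<union> insert v R" and ext: "f \<in> extensional V"
        using f unfolding forests_def PiE_def by blast+
      have eqV: "(f(v := y)) x = f x" if "x \<in> V" for x using that v by auto
      have "acyclic_fun (insert v V) (f(v := y))"
      proof (rule acyclic_funI)
        fix S assume S: "S \<subseteq> insert v V" "(f(v := y)) ` S \<subseteq> S"
        \<comment> \<open>A closed set containing \<open>v\<close> contains its parent
          \<open>y\<close> and everything \<open>y\<close> flows to, including a root other than
          \<open>v\<close>; but \<open>S\<close> has no old root in it.\<close>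
        have "v \<notin> S"
        proof
          assume vS: "v \<in> S"
          then have yS: "y \<in> S" using S(2) by force
          have "y \<noteq> v" using y v by auto
          then have yV: "y \<in> V" using yS S by blast
          then have nfl: "\<not> flows V f y v" using y dj by blast
          have im: "f ` V \<subseteq> V \<union> insert v R" using P by blast
          obtain w where w: "w \<in> insert v R" "flows V f y w" using flows_root_unique[OF ac im dj' yV] by blast
          have clos: "w' \<in> S" if "flows V f y w'" for w'
            using that unfolding flows_def
          proof (induction rule: rtrancl_induct)
            case base
            then show ?case by (rule yS)
          next
            case (step a b)
            then have "a \<in> V" "b = f a" by auto
            then have "b = (f(v := y)) a" using eqV by simp
            then show ?case using S(2) step.IH by blast
          qed
          then have "w \<in> S" using w by blast
          then have "w = v" using w S dj by blast
          then show False using w nfl by simp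
        qed
        then have SV: "S \<subseteq> V" using S by blast
        have "f ` S = (f(v := y)) ` S" using SV eqV by (intro image_cong[OF refl]) (auto simp del: fun_upd_apply)
        then show "S = {}" using acyclic_funD[OF ac SV] S(2) by simp
      qed
      moreover have "f(v := y) \<in> Pi\<^sub>E (insert v V) (\<lambda>x. {u \<in> insert v V. A x u} \<union> R)"
      proof (rule PiE_I)
        fix x assume x: "x \<in> insert v V"
        show "(f(v := y)) x \<in> {u \<in> insert v V. A x u} \<union> R"
        proof (cases "x = v")
          case True
          then show ?thesis using y A by auto
        next
          case False
          then show ?thesis using P[of x] x A by auto
        qed
      next
        fix x assume "x \<notin> insert v V"
        then show "(f(v := y)) x = undefined" using ext by (auto simp: extensional_def)
      qed
      ultimately show "?\<psi> p \<in> forests (insert v V) A R" unfolding forests_def p by simp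
    qed
  qed
  then have "card (forests (insert v V) A R) = card ?D" by (rule bij_betw_same_card)
  also have "\<dots> = (\<Sum>f\<in>?F. card (R \<union> (V - ?C f)))"
    using fin by (intro card_SigmaI) (auto intro: finite_forests)
  finally have c1: "card (forests (insert v V) A R) = (\<Sum>f\<in>?F. card (R \<union> (V - ?C f)))" .
  have "card (R \<union> (V - ?C f)) + card (?C f) = card R + card V" for f
  proof -
    have "card (R \<union> (V - ?C f)) = card R + card (V - ?C f)"
      using fin dj by (intro card_Un_disjoint) auto
    moreover have "card (V - ?C f) + card (?C f) = card V"
    proof -
      have "?C f \<subseteq> V" by blast
      then show ?thesis using fin card_Diff_subset[of "?C f" V] card_mono[of V "?C f"] finite_subset[of "?C f" V]
        by simp
    qed
    ultimately show ?thesis by simp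
  qed
  then have "(\<Sum>f\<in>?F. card (R \<union> (V - ?C f))) + (\<Sum>f\<in>?F. card (?C f)) = (\<Sum>f\<in>?F. card R + card V)"
    by (simp only: sum.distrib[symmetric])
  then have c2: "card (forests (insert v V) A R) + (\<Sum>f\<in>?F. card (?C f)) = (card R + card V) * card ?F"
    using c1 by (simp add: mult.commute)
  have c3: "(card R + 1) * (\<Sum>f\<in>?F. card (?C f)) = card V * card ?F"
    using card_forests_root_share[OF fin(1) dj', of v A] fin v by simp
  \<comment> \<open>The tree sizes are added on the left, which avoids a truncated
    subtraction.\<close>
  have "(card R + 1) * card (forests (insert v V) A R) + card V * card ?F
      = (card R + 1) * ((card R + card V) * card ?F)"
    unfolding c3[symmetric] c2[symmetric] by (simp add: algebra_simps)
  then show ?thesis by (simp add: algebra_simps)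
qed

text \<open>The vertices of \<open>W\<close> become roots one after another. With x roots present, a
  step contributes x/(x+1) times the total \<open>card R + card V + card W\<close>, which never
  changes; the fractions telescope to \<open>card R / (card R + card W)\<close>.\<close>

lemma card_forests_multicone:
  assumes "finite W" "finite V" "finite R" "W \<inter> V = {}" "W \<inter> R = {}" "V \<inter> R = {}"
    and "R \<noteq> {}" and "\<And>w u. w \<in> W \<Longrightarrow> u \<in> W \<union> V \<Longrightarrow> A u w \<and> A w u"
  shows "(card R + card W) * card (forests (W \<union> V) A R)
       = card R * (card R + card V + card W) ^ card W * card (forests V A (W \<union> R))"
  using assms
proof (induction W arbitrary: R rule: finite_induct)
  case empty
  then show ?case by simp
next
  case (insert w W)
  let ?x = "card R"
  have cR: "card (insert w R) = ?x + 1" using insert.prems by auto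
  have cU: "card (W \<union> V) = card W + card V" using insert by (intro card_Un_disjoint) auto
  have "(card (insert w R) + card W) * card (forests (W \<union> V) A (insert w R))
      = card (insert w R) * (card (insert w R) + card V + card W) ^ card W * card (forests V A (W \<union> insert w R))"
    using insert.prems insert.hyps by (intro insert.IH) auto
  then have IH: "(?x + 1 + card W) * card (forests (W \<union> V) A (insert w R))
      = (?x + 1) * (?x + 1 + card V + card W) ^ card W * card (forests V A (insert w W \<union> R))"
    by (simp add: cR)
  have C: "(?x + 1) * card (forests (insert w (W \<union> V)) A R)
       = ?x * (?x + card (W \<union> V) + 1) * card (forests (W \<union> V) A (insert w R))"
    using insert.prems insert.hyps by (intro card_forests_cone) auto
  have "(?x + 1) * ((?x + card (insert w W)) * card (forests (insert w W \<union> V) A R))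
      = (?x + 1 + card W) * ((?x + 1) * card (forests (insert w (W \<union> V)) A R))"
    using insert.hyps by (simp add: algebra_simps)
  also have "\<dots> = ?x * (?x + card V + card W + 1) * ((?x + 1 + card W) * card (forests (W \<union> V) A (insert w R)))"
    unfolding C cU by (simp add: algebra_simps)
  also have "\<dots> = (?x + 1) * (?x * (?x + card V + card (insert w W)) ^ card (insert w W) * card (forests V A (insert w W \<union> R)))"
    unfolding IH using insert.hyps by (simp add: algebra_simps)
  finally show ?case by (simp only: mult_cancel1) simp
qed

text \<open>All of \<open>V\<close> is universal, so the cone formula leaves the empty graph. With
  one root this is Cayley's n^(n-2) for n = \<open>card V + 1\<close>; with q roots it serves the
  cliques in the Sylow 2-subgroup.\<close>

lemma card_forests_complete:
  assumes "finite V" "finite R" "V \<inter> R = {}" "R \<noteq> {}" "V \<noteq> {}" "\<And>u v. u \<in> V \<Longrightarrow> v \<in> V \<Longrightarrow> A u v"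
  shows "card (forests V A R) = card R * (card R + card V) ^ (card V - 1)"
proof -
  have "(card R + card V) * card (forests (V \<union> {}) A R)
       = card R * (card R + card V) ^ card V * card (forests {} A (V \<union> R))"
    using card_forests_multicone[of V "{}" R A] assms by simp
  moreover have "card V = Suc (card V - 1)" using assms by (simp add: card_gt_0_iff)
  then have "(card R + card V) ^ card V = (card R + card V) * (card R + card V) ^ (card V - 1)"
    by (metis power_Suc)
  then have "card R * (card R + card V) ^ card V
      = (card R + card V) * (card R * (card R + card V) ^ (card V - 1))"
    by (simp only: mult.left_commute)
  moreover have "card (forests {} A (V \<union> R)) = 1" by (simp add: forests_empty)
  ultimately have "(card R + card V) * card (forests V A R)
      = (card R + card V) * (card R * (card R + card V) ^ (card V - 1))"
    by (simp only: mult_1_right Un_empty_right)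
  moreover have "card R + card V \<noteq> 0" using assms by auto
  ultimately show ?thesis by (metis mult_left_cancel)
qed

section \<open>Spanning trees as parent functions\<close>

definition parent_edges :: "'v set \<Rightarrow> ('v \<Rightarrow> 'v) \<Rightarrow> 'v set set" where
  "parent_edges V f = (\<lambda>v. {v, f v}) ` V"

lemma acyclic_fun_neq: "acyclic_fun V f \<Longrightarrow> v \<in> V \<Longrightarrow> f v \<noteq> v"
  using acyclic_funD[of V f "{v}"] by auto

lemma acyclic_fun_depth:
  assumes "acyclic_fun V f"
  shows "\<exists>d :: 'v \<Rightarrow> nat. \<forall>v\<in>V. d v = Suc (d (f v))"
proof -
  define d where "d v = (LEAST k. (f ^^ k) v \<notin> V)" for v
  have "d v = Suc (d (f v))" if v: "v \<in> V" for v
  proof -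
    have "\<exists>k. (f ^^ k) v \<notin> V"
      using assms v
    proof (induction rule: acyclic_fun_induct)
      case (step v)
      show ?case
      proof (cases "f v \<in> V")
        case True
        then obtain k where "(f ^^ k) (f v) \<notin> V" using step by blast
        then have "(f ^^ Suc k) v \<notin> V" by (simp add: funpow_swap1)
        then show ?thesis by blast
      next
        case False
        then have "(f ^^ 1) v \<notin> V" by simp
        then show ?thesis by blast
      qed
    qed
    then obtain k where "(f ^^ k) v \<notin> V" by blast
    then have "(LEAST k. (f ^^ k) v \<notin> V) = Suc (LEAST k. (f ^^ Suc k) v \<notin> V)"
      by (rule Least_Suc) (use v in simp)
    then show ?thesis by (simp add: d_def funpow_swap1)
  qed
  then show ?thesis by blast
qed

text \<open>At a vertex of maximal depth on a cycle both cycle edges must lead to its parent, since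
  a child would be deeper. The two neighbours then coincide, which a length of at least 3
  forbids.\<close>

lemma parent_edges_no_cycle:
  assumes ac: "acyclic_fun V f"
  shows "\<not> has_cycle (parent_edges V f)"
proof
  assume "has_cycle (parent_edges V f)"
  then obtain vs where len: "length vs \<ge> 3" and dist: "distinct vs"
    and e: "\<And>i. i < length vs \<Longrightarrow> {vs ! i, vs ! ((i + 1) mod length vs)} \<in> parent_edges V f"
    unfolding has_cycle_def by blast
  obtain d :: "'a \<Rightarrow> nat" where d: "\<And>v. v \<in> V \<Longrightarrow> d v = Suc (d (f v))"
    using acyclic_fun_depth[OF ac] by blast
  let ?n = "length vs"
  have "finite ((\<lambda>i. d (vs ! i)) ` {..<?n})" "(\<lambda>i. d (vs ! i)) ` {..<?n} \<noteq> {}"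
    using len by (auto simp: lessThan_empty_iff)
  from Max_in[OF this] Max_ge[OF this(1)] obtain i where i: "i < ?n"
    and mx: "\<And>j. j < ?n \<Longrightarrow> d (vs ! j) \<le> d (vs ! i)" by (smt (verit) image_iff lessThan_iff)
  have par: "f (vs ! i) = vs ! j" if j: "j < ?n" and ed: "{vs ! i, vs ! j} \<in> parent_edges V f" for j
  proof -
    obtain v where v: "v \<in> V" "{vs ! i, vs ! j} = {v, f v}" using ed unfolding parent_edges_def by blast
    have "\<not> (vs ! j = v \<and> vs ! i = f v)"
    proof
      assume "vs ! j = v \<and> vs ! i = f v"
      then have "d (vs ! j) = Suc (d (vs ! i))" using d v by simp
      then show False using mx[OF j] by simp
    qed
    then show ?thesis using v(2) by (auto simp: doubleton_eq_iff)
  qed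
  \<comment> \<open>Cyclic successor \<open>j\<close> and predecessor \<open>k\<close> of the
    position of the deepest vertex.\<close>
  define j where "j = (i + 1) mod ?n"
  define k where "k = (if i = 0 then ?n - 1 else i - 1)"
  have jk: "j < ?n" "k < ?n" using i len by (auto simp: j_def k_def intro!: mod_less_divisor)
  have k1: "(k + 1) mod ?n = i" using i len by (auto simp: k_def)
  have "f (vs ! i) = vs ! j" using par[OF jk(1)] e[OF i] by (simp add: j_def)
  moreover have "f (vs ! i) = vs ! k" using par[OF jk(2)] e[OF jk(2)] unfolding k1 by (simp add: insert_commute)
  ultimately have eq: "j = k" using dist jk nth_eq_iff_index_eq by metis
  have "j \<noteq> k"
  proof (cases "i + 1 = ?n")
    case True
    then show ?thesis using len by (auto simp: j_def k_def)
  next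
    case False
    then have "j = i + 1" using i by (simp add: j_def)
    then show ?thesis using i len False by (auto simp: k_def)
  qed
  then show False using eq by blast
qed

lemma parent_edges_connected:
  assumes ac: "acyclic_fun (V - {r}) f" and im: "\<And>v. v \<in> V - {r} \<Longrightarrow> f v \<in> V"
  shows "graph_connected V (parent_edges (V - {r}) f)"
proof -
  let ?E = "edge_rel (parent_edges (V - {r}) f)"
  have sym: "sym (?E\<^sup>*)"
    by (intro sym_rtrancl) (auto simp: sym_def edge_rel_def insert_commute)
  have *: "(v, r) \<in> ?E\<^sup>*" if "v \<in> V - {r}" for v
    using ac that
  proof (induction rule: acyclic_fun_induct)
    case (step v)
    have "(v, f v) \<in> ?E"
      using acyclic_fun_neq[OF ac step.hyps] step.hyps by (auto simp: edge_rel_def parent_edges_def)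
    moreover have "(f v, r) \<in> ?E\<^sup>*"
      using im[OF step.hyps] step.IH by (cases "f v = r") auto
    ultimately show ?case by (rule converse_rtrancl_into_rtrancl)
  qed
  then have "(v, r) \<in> ?E\<^sup>*" if "v \<in> V" for v using that by (cases "v = r") auto
  then show ?thesis unfolding graph_connected_def
    by (meson sym symE rtrancl_trans)
qed

text \<open>If \<open>f\<close> and \<open>g\<close> differ at \<open>v\<close>, the edge from
  \<open>v\<close> to \<open>g v\<close> can only be the parent edge of \<open>g v\<close> under
  \<open>f\<close>. So \<open>f\<close> sends \<open>g v\<close> back to \<open>v\<close>, while
  \<open>g\<close>, having no 2-cycle, does not. The set of disagreement is closed under
  \<open>g\<close>, hence empty.\<close>

lemma inj_on_parent_edges:
  assumes dj: "V \<inter> R = {}"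
  shows "inj_on (parent_edges V) (forests V A R)"
proof (rule inj_onI)
  fix f g assume f: "f \<in> forests V A R" and g: "g \<in> forests V A R"
    and eq: "parent_edges V f = parent_edges V g"
  have acf: "acyclic_fun V f" and acg: "acyclic_fun V g"
    and ext: "f \<in> extensional V" "g \<in> extensional V"
    using f g unfolding forests_def PiE_def by blast+
  let ?S = "{v \<in> V. f v \<noteq> g v}"
  have "g ` ?S \<subseteq> ?S"
  proof (rule image_subsetI)
    fix v assume v: "v \<in> ?S"
    then have "{v, g v} \<in> parent_edges V f" unfolding eq by (auto simp: parent_edges_def)
    then obtain u where u: "u \<in> V" "{v, g v} = {u, f u}" unfolding parent_edges_def by blast
    then have u': "g v = u" "f u = v" using v by (auto simp: doubleton_eq_iff)
    have "g u \<noteq> v"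
    proof
      assume "g u = v"
      then have "g ` {u, v} \<subseteq> {u, v}" using u' by auto
      then show False using acyclic_funD[OF acg, of "{u, v}"] u v by auto
    qed
    then show "g v \<in> ?S" using u u' by auto
  qed
  then have "?S = {}" by (intro acyclic_funD[OF acg]) auto
  then have "f v = g v" if "v \<in> V" for v using that by blast
  then show "f = g" using ext extensionalityI by blast
qed

lemma rtrancl_imp_distinct_path:
  assumes "(x, y) \<in> R\<^sup>*"
  shows "\<exists>vs. distinct (x # vs) \<and> successively (\<lambda>a b. (a, b) \<in> R) (x # vs) \<and> last (x # vs) = y"
  using assms
proof (induction rule: converse_rtrancl_induct)
  case base
  show ?case by (intro exI[of _ "[]"]) auto
next
  case (step x z)
  then obtain vs where vs: "distinct (z # vs)" "successively (\<lambda>a b. (a, b) \<in> R) (z # vs)" "last (z # vs) = y"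
    by blast
  show ?case
  proof (cases "x \<in> set (z # vs)")
    case False
    then have "distinct (x # z # vs) \<and> successively (\<lambda>a b. (a, b) \<in> R) (x # z # vs) \<and> last (x # z # vs) = y"
      using vs step.hyps by auto
    then show ?thesis by blast
  next
    case True
    then obtain as bs where ab: "z # vs = as @ x # bs" by (meson split_list)
    have "distinct (x # bs)" "successively (\<lambda>a b. (a, b) \<in> R) (x # bs)" "last (x # bs) = y"
      using vs unfolding ab by (auto simp: successively_append_iff)
    then show ?thesis by blast
  qed
qed

lemma length_path_ge_3: "last (x # vs) = y \<Longrightarrow> vs \<noteq> [] \<Longrightarrow> vs \<noteq> [y] \<Longrightarrow> length (x # vs) \<ge> 3"
  by (cases vs; cases "tl vs") auto

text \<open>The parent of a vertex is a neighbour in \<open>T\<close> at smaller distance from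
  \<open>r\<close>. Any further edge of \<open>T\<close> would close a cycle with the path of parent
  edges joining its ends.\<close>

lemma spanning_tree_parent:
  assumes fin: "finite V" and r: "r \<in> V"
    and E: "E = {{u, w} | u w. u \<in> V \<and> w \<in> V \<and> u \<noteq> w \<and> A u w}"
    and sym: "\<And>u w. u \<in> V \<Longrightarrow> w \<in> V \<Longrightarrow> A u w \<Longrightarrow> A w u"
    and T: "is_spanning_tree V E T"
  shows "\<exists>f\<in>forests (V - {r}) A {r}. parent_edges (V - {r}) f = T"
proof -
  let ?R = "edge_rel T"
  have TE: "T \<subseteq> E" and conn: "graph_connected V T" and nc: "\<not> has_cycle T"
    using T unfolding is_spanning_tree_def by blast+
  define d where "d v = (LEAST k. (v, r) \<in> ?R ^^ k)" for v
  have "\<exists>u. (v, u) \<in> ?R \<and> d u < d v" if v: "v \<in> V - {r}" for v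
  proof -
    have "(v, r) \<in> ?R\<^sup>*" using conn v r unfolding graph_connected_def by blast
    then obtain k where "(v, r) \<in> ?R ^^ k" by (meson rtrancl_imp_relpow)
    then have dv: "(v, r) \<in> ?R ^^ d v" unfolding d_def by (rule LeastI)
    have "d v \<noteq> 0" using dv v by (metis DiffD2 insertI1 pair_in_Id_conv relpow.simps(1))
    then obtain m where m: "d v = Suc m" using not0_implies_Suc by blast
    then obtain u where u: "(v, u) \<in> ?R" "(u, r) \<in> ?R ^^ m" using dv relpow_Suc_D2 by metis
    then have "d u \<le> m" unfolding d_def by (intro Least_le)
    then show ?thesis using u m by auto
  qed
  then obtain f0 where f0: "\<And>v. v \<in> V - {r} \<Longrightarrow> (v, f0 v) \<in> ?R \<and> d (f0 v) < d v" by metis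
  define f where "f = restrict f0 (V - {r})"
  have f: "(v, f v) \<in> ?R" "d (f v) < d v" if "v \<in> V - {r}" for v
    using f0[OF that] that by (auto simp: f_def)
  have fA: "f v \<in> V \<and> A v (f v)" if v: "v \<in> V - {r}" for v
  proof -
    have "{v, f v} \<in> E" using f(1)[OF v] TE unfolding edge_rel_def by blast
    then show ?thesis using sym unfolding E by (auto simp: doubleton_eq_iff)
  qed
  have ac: "acyclic_fun (V - {r}) f"
  proof (rule acyclic_funI)
    fix S assume S: "S \<subseteq> V - {r}" "f ` S \<subseteq> S"
    show "S = {}"
    proof (rule ccontr)
      assume "S \<noteq> {}"
      then obtain v where v: "v \<in> S" "\<And>u. u \<in> S \<Longrightarrow> d v \<le> d u"
        using ex_min_if_finite arg_min_nat_lemma[of "\<lambda>v. v \<in> S" _ d] by (metis ex_in_conv)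
      then have "d (f v) < d v" "f v \<in> S" using f(2)[of v] S by auto
      then show False using v(2) by fastforce
    qed
  qed
  have ff: "f \<in> forests (V - {r}) A {r}"
  proof -
    have "f \<in> Pi\<^sub>E (V - {r}) (\<lambda>v. {u \<in> V - {r}. A v u} \<union> {r})"
    proof (rule PiE_I)
      fix v assume "v \<in> V - {r}"
      then show "f v \<in> {u \<in> V - {r}. A v u} \<union> {r}" using fA by auto
    next
      fix v assume "v \<notin> V - {r}"
      then show "f v = undefined" by (simp only: f_def restrict_apply if_False)
    qed
    then show ?thesis using ac unfolding forests_def by blast
  qed
  let ?P = "parent_edges (V - {r}) f"
  have PT: "?P \<subseteq> T" using f(1) unfolding parent_edges_def edge_rel_def by blast
  have "T \<subseteq> ?P"
  proof
    fix e assume e: "e \<in> T"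
    then obtain x y where xy: "e = {x, y}" "x \<in> V" "y \<in> V" "x \<noteq> y" using TE E by blast
    show "e \<in> ?P"
    proof (rule ccontr)
      assume nP: "e \<notin> ?P"
      have "graph_connected V ?P" using parent_edges_connected[OF ac] fA by blast
      then have "(x, y) \<in> (edge_rel ?P)\<^sup>*" using xy unfolding graph_connected_def by blast
      then obtain vs where vs: "distinct (x # vs)" "successively (\<lambda>a b. (a, b) \<in> edge_rel ?P) (x # vs)"
        "last (x # vs) = y" using rtrancl_imp_distinct_path by metis
      let ?l = "x # vs"
      have "vs \<noteq> []" using vs xy by auto
      moreover have "vs \<noteq> [y]"
      proof
        assume "vs = [y]"
        then have "(x, y) \<in> edge_rel ?P" using vs(2) by simp
        then have "{x, y} \<in> ?P" by (simp add: edge_rel_def)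
        then show False using nP xy(1) by simp
      qed
      ultimately have len: "length ?l \<ge> 3"
        using length_path_ge_3[OF vs(3)] by blast
      \<comment> \<open>The wrap-around index is the additional edge \<open>e\<close>, which joins
        the last vertex \<open>y\<close> back to \<open>x\<close>.\<close>
      have "{?l ! i, ?l ! ((i + 1) mod length ?l)} \<in> T" if i: "i < length ?l" for i
      proof (cases "Suc i = length ?l")
        case True
        then have "?l ! i = y" using vs(3) last_conv_nth[of ?l] by (metis diff_Suc_1 list.distinct(1))
        then show ?thesis using True e xy by (simp add: insert_commute)
      next
        case False
        then have "Suc i < length ?l" using i by simp
        with vs(2) have "(?l ! i, ?l ! Suc i) \<in> edge_rel ?P"
          by (simp only: successively_conv_nth)
        then have "{?l ! i, ?l ! Suc i} \<in> ?P" unfolding edge_rel_def by simp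
        moreover have "(i + 1) mod length ?l = Suc i" using \<open>Suc i < length ?l\<close> by simp
        ultimately show ?thesis using PT by (simp only: subset_iff)
      qed
      then have "has_cycle T" unfolding has_cycle_def using len vs(1) by blast
      then show False using nc by blast
    qed
  qed
  then show ?thesis using PT ff by blast
qed

text \<open>In \<open>forests\<close> the root is a legal parent of every vertex, so it has to be
  universal in the graph; orienting all edges towards it is then a bijection.\<close>

theorem num_spanning_trees_eq_card_forests:
  assumes fin: "finite V" and r: "r \<in> V"
    and E: "E = {{u, w} | u w. u \<in> V \<and> w \<in> V \<and> u \<noteq> w \<and> A u w}"
    and sym: "\<And>u w. u \<in> V \<Longrightarrow> w \<in> V \<Longrightarrow> A u w \<Longrightarrow> A w u"
    and univ: "\<And>v. v \<in> V \<Longrightarrow> A v r"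
  shows "num_spanning_trees V E = card (forests (V - {r}) A {r})"
proof -
  have "{T. is_spanning_tree V E T} = parent_edges (V - {r}) ` forests (V - {r}) A {r}"
  proof
    show "{T. is_spanning_tree V E T} \<subseteq> parent_edges (V - {r}) ` forests (V - {r}) A {r}"
      using spanning_tree_parent[OF fin r E sym] by blast
    show "parent_edges (V - {r}) ` forests (V - {r}) A {r} \<subseteq> {T. is_spanning_tree V E T}"
    proof (rule image_subsetI)
      fix f assume "f \<in> forests (V - {r}) A {r}"
      then have ac: "acyclic_fun (V - {r}) f"
        and P: "\<And>x. x \<in> V - {r} \<Longrightarrow> f x \<in> {u \<in> V - {r}. A x u} \<union> {r}"
        unfolding forests_def PiE_def by blast+
      have im: "f x \<in> V \<and> A x (f x)" if "x \<in> V - {r}" for x using P[OF that] r univ that by auto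
      have "parent_edges (V - {r}) f \<subseteq> E"
      proof
        fix e assume "e \<in> parent_edges (V - {r}) f"
        then obtain v where v: "v \<in> V - {r}" "e = {v, f v}" unfolding parent_edges_def by blast
        then have "v \<in> V \<and> f v \<in> V \<and> v \<noteq> f v \<and> A v (f v)"
          using im[OF v(1)] acyclic_fun_neq[OF ac v(1)] by auto
        then show "e \<in> E" unfolding E v(2) by blast
      qed
      then show "parent_edges (V - {r}) f \<in> {T. is_spanning_tree V E T}"
        using parent_edges_no_cycle[OF ac] parent_edges_connected[OF ac] im
        unfolding is_spanning_tree_def by blast
    qed
  qed
  then show ?thesis
    unfolding num_spanning_trees_def by (simp add: card_image inj_on_parent_edges)
qed

section \<open>Invariance of the count under graph isomorphism\<close>

lemma card_forests_image:
  assumes inj: "inj_on \<phi> (V \<union> R)" and dj: "V \<inter> R = {}"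
    and A: "\<And>u v. u \<in> V \<Longrightarrow> v \<in> V \<Longrightarrow> B (\<phi> u) (\<phi> v) = A u v"
    and fin: "finite V" "finite R"
  shows "card (forests (\<phi> ` V) B (\<phi> ` R)) = card (forests V A R)"
proof -
  \<comment> \<open>Stated over fresh types \<open>'x\<close> and \<open>'y\<close>, since it is
    applied both to the isomorphism and to its inverse.\<close>
  have le: "card (forests V A R) \<le> card (forests (\<phi> ` V) B (\<phi> ` R))"
    if inj: "inj_on \<phi> (V \<union> R)" and A: "\<And>u v. u \<in> V \<Longrightarrow> v \<in> V \<Longrightarrow> A u v \<Longrightarrow> B (\<phi> u) (\<phi> v)"
      and fin: "finite V" "finite R" and dj: "V \<inter> R = {}"
    for \<phi> :: "'x \<Rightarrow> 'y" and V R A B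
  proof -
    let ?\<psi> = "the_inv_into V \<phi>"
    let ?t = "\<lambda>f. restrict (\<lambda>y. \<phi> (f (?\<psi> y))) (\<phi> ` V)"
    have injV: "inj_on \<phi> V" using inj inj_on_subset by blast
    have \<psi>: "?\<psi> (\<phi> v) = v" if "v \<in> V" for v using the_inv_into_f_f[OF injV that] .
    have t: "?t f (\<phi> v) = \<phi> (f v)" if "v \<in> V" for f v using that \<psi>[OF that] by simp
    have "?t f \<in> forests (\<phi> ` V) B (\<phi> ` R)" if f: "f \<in> forests V A R" for f
    proof -
      have ac: "acyclic_fun V f" and P: "\<And>x. x \<in> V \<Longrightarrow> f x \<in> {u \<in> V. A x u} \<union> R"
        using f unfolding forests_def PiE_def by blast+
      have "acyclic_fun (\<phi> ` V) (?t f)"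
      proof (rule acyclic_funI)
        fix S assume S: "S \<subseteq> \<phi> ` V" "?t f ` S \<subseteq> S"
        let ?S = "{v \<in> V. \<phi> v \<in> S}"
        have "f ` ?S \<subseteq> ?S"
        proof (rule image_subsetI)
          fix v assume v: "v \<in> ?S"
          then have "?t f (\<phi> v) \<in> S" using S(2) by (metis (no_types, lifting) image_subset_iff mem_Collect_eq)
          then have "\<phi> (f v) \<in> S" using t[of v f] v by (metis (no_types, lifting) mem_Collect_eq)
          moreover have "f v \<in> V"
          proof -
            have "\<phi> (f v) \<in> \<phi> ` V" using \<open>\<phi> (f v) \<in> S\<close> S(1) by (rule rev_subsetD)
            then obtain w where w: "w \<in> V" "\<phi> (f v) = \<phi> w" by (rule imageE) simp
            have "f v \<in> V \<union> R" using P[of v] v by blast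
            then have "f v = w" using inj_onD[OF inj w(2)] w(1) by simp
            then show ?thesis using w(1) by simp
          qed
          ultimately show "f v \<in> ?S" by blast
        qed
        then have "?S = {}" by (intro acyclic_funD[OF ac]) auto
        then show "S = {}" using S(1) by blast
      qed
      moreover have "?t f \<in> Pi\<^sub>E (\<phi> ` V) (\<lambda>v. {u \<in> \<phi> ` V. B v u} \<union> \<phi> ` R)"
      proof (rule PiE_I)
        fix y assume "y \<in> \<phi> ` V"
        then obtain v where v: "v \<in> V" "y = \<phi> v" by blast
        have "\<phi> (f v) \<in> {u \<in> \<phi> ` V. B (\<phi> v) u} \<union> \<phi> ` R"
          using P[OF v(1)] A[of v "f v"] v(1) by blast
        then show "?t f y \<in> {u \<in> \<phi> ` V. B y u} \<union> \<phi> ` R"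
          unfolding v(2) t[OF v(1), of f] .
      qed simp
      ultimately show ?thesis unfolding forests_def by blast
    qed
    moreover have "inj_on ?t (forests V A R)"
    proof (rule inj_onI)
      fix f g assume f: "f \<in> forests V A R" and g: "g \<in> forests V A R" and eq: "?t f = ?t g"
      have "f v = g v" if v: "v \<in> V" for v
      proof -
        have "\<phi> (f v) = \<phi> (g v)" using t[OF v, of f] t[OF v, of g] eq by simp
        moreover have "f v \<in> V \<union> R" "g v \<in> V \<union> R"
          using f g v unfolding forests_def PiE_def by blast+
        ultimately show ?thesis by (rule inj_onD[OF inj])
      qed
      moreover have "f \<in> extensional V" "g \<in> extensional V"
        using f g unfolding forests_def PiE_def by blast+
      ultimately show "f = g" using extensionalityI by blast
    qed
    ultimately show ?thesis
      using fin by (intro card_inj_on_le[of ?t]) (auto intro: finite_forests)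
  qed
  let ?\<psi> = "the_inv_into (V \<union> R) \<phi>"
  have \<psi>: "?\<psi> (\<phi> v) = v" if "v \<in> V \<union> R" for v using the_inv_into_f_f[OF inj that] .
  have "(\<lambda>x. ?\<psi> (\<phi> x)) ` V = V" "(\<lambda>x. ?\<psi> (\<phi> x)) ` R = R"
    using \<psi> by (simp_all cong: image_cong_simp)
  then have im: "?\<psi> ` \<phi> ` V = V" "?\<psi> ` \<phi> ` R = R" by (simp_all add: image_image)
  have "card (forests (\<phi> ` V) B (\<phi> ` R)) \<le> card (forests (?\<psi> ` \<phi> ` V) A (?\<psi> ` \<phi> ` R))"
  proof (rule le)
    show "inj_on ?\<psi> (\<phi> ` V \<union> \<phi> ` R)"
      unfolding image_Un[symmetric] by (rule inj_on_the_inv_into[OF inj])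
    show "\<phi> ` V \<inter> \<phi> ` R = {}" 
      using inj_on_image_Int[OF inj, of V R] dj by simp
    fix u v assume u: "u \<in> \<phi> ` V" and v: "v \<in> \<phi> ` V" and B: "B u v"
    then obtain u' v' where "u' \<in> V" "u = \<phi> u'" "v' \<in> V" "v = \<phi> v'" by blast
    then show "A (?\<psi> u) (?\<psi> v)" using \<psi> A B by simp
  qed (use fin in auto)
  moreover have "card (forests V A R) \<le> card (forests (\<phi> ` V) B (\<phi> ` R))"
    using A fin inj dj by (intro le) auto
  ultimately show ?thesis unfolding im by simp
qed

section \<open>Finite groups and fixed points\<close>

lemma card_image_fibres:
  assumes "finite S" and "\<And>x. x \<in> S \<Longrightarrow> card {y \<in> S. f y = f x} = k"
  shows "card (f ` S) * k = card S"
proof -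
  have "card S = card (\<Union>y\<in>f ` S. {x \<in> S. f x = y})"
    by (rule arg_cong[where f = card]) auto
  also have "\<dots> = (\<Sum>y\<in>f ` S. card {x \<in> S. f x = y})"
    using assms(1) by (intro card_UN_disjoint) auto
  also have "\<dots> = (\<Sum>y\<in>f ` S. k)" using assms(2) by (intro sum.cong) auto
  finally show ?thesis by simp
qed

text \<open>A modular inverse \<open>a\<close> of \<open>d\<close> gives d a = 1 + k p, and both the
  d-th and the p-th iterate fix \<open>x\<close>. The moduli 0 and 1 are split off because there the
  congruence does not leave the remainder 1.\<close>

lemma funpow_fixed_gcd:
  assumes f1: "(f ^^ d) x = x" and f2: "(f ^^ p) x = x" and co: "coprime d p"
  shows "f x = x"
proof -
  obtain a where a: "[d * a = 1] (mod p)" using cong_solve_coprime_nat[OF co] by auto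
  have m: "(f ^^ (k * e)) x = x" if "(f ^^ e) x = x" for k e
    using that by (induction k) (simp_all add: funpow_add)
  consider "p = 0" | "p = 1" | "p > 1" by linarith
  then show ?thesis
  proof cases
    case 1
    then show ?thesis using co f1 by simp
  next
    case 2
    then show ?thesis using f2 by simp
  next
    case 3
    then have "d * a = 1 + (d * a div p) * p"
      using a unfolding cong_def by (metis add.commute div_mult_mod_eq mod_less)
    then have "(f ^^ (d * a)) x = (f ^^ 1) ((f ^^ ((d * a div p) * p)) x)"
      by (metis funpow_add comp_apply)
    then show ?thesis using m[OF f1, of a] m[OF f2, of "d * a div p"] by (simp add: mult.commute)
  qed
qed

text \<open>Orbits of a map of prime period \<open>p\<close> have size 1 or \<open>p\<close>. A
  plain function takes the place of a group action, so that points, cosets and vectors are all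
  covered.\<close>

lemma card_fixed_points_cong:
  assumes fin: "finite X" and p: "prime p" and im: "\<And>x. x \<in> X \<Longrightarrow> f x \<in> X"
    and per: "\<And>x. x \<in> X \<Longrightarrow> (f ^^ p) x = x"
  shows "[card X = card {x \<in> X. f x = x}] (mod p)"
proof -
  let ?F = "{x \<in> X. f x = x}"
  define orb where "orb x = (\<lambda>i. (f ^^ i) x) ` {..<p}" for x
  have p0: "p > 0" using p by (simp add: prime_gt_0_nat)
  have pw: "(f ^^ i) x \<in> X" if "x \<in> X" for i x
    using that im by (induction i) auto
  have md: "(f ^^ i) x = (f ^^ (i mod p)) x" if "x \<in> X" for i x
  proof -
    have "(f ^^ (k * p)) x = x" for k by (induction k) (simp_all add: funpow_add per that)
    moreover have "i = i mod p + (i div p) * p" by simp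
    ultimately show ?thesis by (metis funpow_add comp_apply)
  qed
  have orb_sub: "(f ^^ i) x \<in> orb x" if "x \<in> X" for i x
    using md[OF that, of i] p0 unfolding orb_def by (auto intro!: image_eqI[of _ _ "i mod p"])
  \<comment> \<open>A fixed point on the orbit of \<open>x\<close> must be \<open>x\<close> itself,
    since the iteration returns to \<open>x\<close>; so nontrivial orbits avoid the fixed
    points.\<close>
  have fixpow: "f ((f ^^ i) x) = (f ^^ i) x \<Longrightarrow> f x = x" if x: "x \<in> X" for i x
  proof -
    assume fx: "f ((f ^^ i) x) = (f ^^ i) x"
    have st: "(f ^^ j) ((f ^^ i) x) = (f ^^ i) x" for j by (induction j) (simp_all add: fx)
    have "(f ^^ (p - i mod p)) ((f ^^ (i mod p)) x) = (f ^^ p) x"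
      using p0 by (simp flip: funpow_add[THEN fun_cong, unfolded comp_apply])
    then have "(f ^^ i) x = x" using st[of "p - i mod p"] md[OF x, of i] per[OF x] by simp
    then show "f x = x" using fx by simp
  qed
  have "card (orb x) = p" if x: "x \<in> X - ?F" for x
  proof -
    have "inj_on (\<lambda>i. (f ^^ i) x) {..<p}"
    proof (rule linorder_inj_onI)
      fix i j assume ij: "i < j" "i \<in> {..<p}" "j \<in> {..<p}"
      show "(f ^^ i) x \<noteq> (f ^^ j) x"
      proof
        assume eq: "(f ^^ i) x = (f ^^ j) x"
        let ?y = "(f ^^ i) x"
        have "(f ^^ (j - i)) ?y = ?y"
          using ij funpow_add[of "j - i" i f] eq by (simp add: fun_eq_iff)
        moreover have "(f ^^ p) ?y = ?y" using pw x per by simp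
        moreover have "coprime (j - i) p"
          using ij p by (metis coprime_commute diff_is_0_eq lessThan_iff less_imp_diff_less
              nat_dvd_not_less not_le prime_imp_coprime zero_less_diff)
        ultimately have "f ?y = ?y" by (rule funpow_fixed_gcd)
        then show False using fixpow x by blast
      qed
    qed auto
    then show ?thesis unfolding orb_def by (simp add: card_image)
  qed
  moreover have "disjoint (orb ` (X - ?F))"
  proof (rule disjointI)
    fix A B assume "A \<in> orb ` (X - ?F)" "B \<in> orb ` (X - ?F)" and ne: "A \<noteq> B"
    then obtain x y where xy: "x \<in> X" "y \<in> X" "A = orb x" "B = orb y" by blast
    have sub: "orb x \<subseteq> orb y" if "x \<in> X" "y \<in> X" "(f ^^ i) x = (f ^^ j) y" "i < p" for x y i j
    proof
      fix z assume "z \<in> orb x"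
      then obtain k where k: "z = (f ^^ k) x" unfolding orb_def by blast
      have "(f ^^ (p - i)) ((f ^^ i) x) = (f ^^ (p - i + i)) x" by (simp only: funpow_add comp_apply)
      then have "x = (f ^^ (p - i)) ((f ^^ i) x)" using that per[OF that(1)] by simp
      then have "z = (f ^^ k) ((f ^^ (p - i)) ((f ^^ j) y))" using k that(3) by simp
      then have "z = (f ^^ (k + (p - i) + j)) y" by (simp only: funpow_add comp_apply)
      then show "z \<in> orb y" using orb_sub that by simp
    qed
    show "A \<inter> B = {}"
    proof (rule ccontr)
      assume "A \<inter> B \<noteq> {}"
      then obtain z where "z \<in> orb x" "z \<in> orb y" using xy by blast
      then obtain i j where "i < p" "j < p" "z = (f ^^ i) x" "z = (f ^^ j) y"
        unfolding orb_def by auto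
      then have "orb x = orb y" using sub[of x y i j] sub[of y x j i] xy by auto
      then show False using ne xy by simp
    qed
  qed
  moreover have "\<Union> (orb ` (X - ?F)) = X - ?F"
  proof
    show "\<Union> (orb ` (X - ?F)) \<subseteq> X - ?F"
      using pw fixpow unfolding orb_def by blast
    have "x \<in> orb x" if "x \<in> X" for x using orb_sub[OF that, of 0] by simp
    then show "X - ?F \<subseteq> \<Union> (orb ` (X - ?F))" by blast
  qed
  ultimately have "p dvd card (X - ?F)"
    using dvd_partition[of "orb ` (X - ?F)" p] fin
    by (auto simp: disjoint_def)
  moreover have "card X = card (X - ?F) + card ?F"
    using fin by (simp add: card_Diff_subset card_mono)
  ultimately show ?thesis by (auto simp: cong_def elim!: dvdE)
qed

section \<open>Conjugation, centralizers and normalizers\<close>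

context group
begin

definition cent :: "'a \<Rightarrow> 'a set" where
  "cent g = {x \<in> carrier G. x \<otimes> g = g \<otimes> x}"

definition conj_set :: "'a \<Rightarrow> 'a set \<Rightarrow> 'a set" where
  "conj_set x S = (\<lambda>s. x \<otimes> s \<otimes> inv x) ` S"

lemma conj_mult:
  "x \<in> carrier G \<Longrightarrow> g \<in> carrier G \<Longrightarrow> h \<in> carrier G \<Longrightarrow>
    x \<otimes> (g \<otimes> h) \<otimes> inv x = (x \<otimes> g \<otimes> inv x) \<otimes> (x \<otimes> h \<otimes> inv x)"
  by (simp add: m_assoc) (metis inv_closed l_inv l_one m_assoc m_closed)

lemma conj_conj:
  "x \<in> carrier G \<Longrightarrow> y \<in> carrier G \<Longrightarrow> g \<in> carrier G \<Longrightarrow>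
    x \<otimes> (y \<otimes> g \<otimes> inv y) \<otimes> inv x = (x \<otimes> y) \<otimes> g \<otimes> inv (x \<otimes> y)"
  by (simp add: m_assoc inv_mult_group)

lemma conj_inv_cancel:
  "x \<in> carrier G \<Longrightarrow> g \<in> carrier G \<Longrightarrow> inv x \<otimes> (x \<otimes> g \<otimes> inv x) \<otimes> inv (inv x) = g"
  using conj_conj[of "inv x" x g] by simp

lemma conj_inj: "x \<in> carrier G \<Longrightarrow> inj_on (\<lambda>s. x \<otimes> s \<otimes> inv x) (carrier G)"
  by (rule inj_on_inverseI[where g = "\<lambda>s. inv x \<otimes> s \<otimes> inv (inv x)"]) (rule conj_inv_cancel)

lemma conj_comm_iff:
  assumes "x \<in> carrier G" "g \<in> carrier G" "h \<in> carrier G"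
  shows "(x \<otimes> g \<otimes> inv x) \<otimes> (x \<otimes> h \<otimes> inv x) = (x \<otimes> h \<otimes> inv x) \<otimes> (x \<otimes> g \<otimes> inv x)
     \<longleftrightarrow> g \<otimes> h = h \<otimes> g"
proof -
  have "(x \<otimes> (g \<otimes> h) \<otimes> inv x = x \<otimes> (h \<otimes> g) \<otimes> inv x) = (g \<otimes> h = h \<otimes> g)"
    using conj_inj[OF assms(1)] assms by (intro inj_on_eq_iff) auto
  then show ?thesis using assms by (simp only: conj_mult)
qed

lemma conj_eq_one_iff: "x \<in> carrier G \<Longrightarrow> g \<in> carrier G \<Longrightarrow> x \<otimes> g \<otimes> inv x = \<one> \<longleftrightarrow> g = \<one>"
  using inj_on_eq_iff[OF conj_inj, of x g \<one>] by simp

lemma cent_subset: "cent g \<subseteq> carrier G"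
  unfolding cent_def by blast

lemma cent_conj:
  assumes "x \<in> carrier G" "g \<in> carrier G"
  shows "cent (x \<otimes> g \<otimes> inv x) = conj_set x (cent g)"
proof
  show "conj_set x (cent g) \<subseteq> cent (x \<otimes> g \<otimes> inv x)"
    using assms conj_comm_iff[OF assms(1)] unfolding conj_set_def cent_def by auto
  show "cent (x \<otimes> g \<otimes> inv x) \<subseteq> conj_set x (cent g)"
  proof
    fix y assume y: "y \<in> cent (x \<otimes> g \<otimes> inv x)"
    define h where "h = inv x \<otimes> y \<otimes> x"
    have hc: "h \<in> carrier G" "y \<in> carrier G" using assms y by (auto simp: h_def cent_def)
    have yx: "y = x \<otimes> h \<otimes> inv x"
      using conj_inv_cancel[of "inv x" y] assms hc by (simp add: h_def)
    have "h \<in> cent g" using y hc assms conj_comm_iff[OF assms(1) hc(1) assms(2)] unfolding cent_def yx by auto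
    then show "y \<in> conj_set x (cent g)" unfolding conj_set_def using yx by blast
  qed
qed

lemma conj_set_conj_set:
  assumes "x \<in> carrier G" "y \<in> carrier G" "S \<subseteq> carrier G"
  shows "conj_set x (conj_set y S) = conj_set (x \<otimes> y) S"
  unfolding conj_set_def image_image
  by (rule image_cong[OF refl]) (use assms conj_conj in auto)

lemma conj_set_one: "S \<subseteq> carrier G \<Longrightarrow> conj_set \<one> S = S"
  unfolding conj_set_def by (auto simp: subset_iff image_iff)

lemma card_conj_set: "x \<in> carrier G \<Longrightarrow> S \<subseteq> carrier G \<Longrightarrow> card (conj_set x S) = card S"
  unfolding conj_set_def using conj_inj inj_on_subset by (metis card_image)

lemma subgroup_cent: "g \<in> carrier G \<Longrightarrow> subgroup (cent g) G"
proof (rule subgroupI)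
  assume g: "g \<in> carrier G"
  show "cent g \<subseteq> carrier G" by (rule cent_subset)
  show "cent g \<noteq> {}" using g unfolding cent_def by auto
  fix a assume a: "a \<in> cent g"
  then have ac: "a \<in> carrier G" "a \<otimes> g = g \<otimes> a" by (auto simp: cent_def)
  then show "inv a \<in> cent g" using g unfolding cent_def
    by (metis (mono_tags, lifting) inv_closed inv_solve_left' inv_solve_right' m_assoc m_closed mem_Collect_eq)
  fix b assume b: "b \<in> cent g"
  then have bc: "b \<in> carrier G" "b \<otimes> g = g \<otimes> b" by (auto simp: cent_def)
  have "a \<otimes> b \<otimes> g = a \<otimes> g \<otimes> b" by (metis ac(1) bc g m_assoc)
  also have "\<dots> = g \<otimes> (a \<otimes> b)" by (metis ac bc(1) g m_assoc)
  finally show "a \<otimes> b \<in> cent g" using ac bc unfolding cent_def by simp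
qed

definition nrm :: "'a set \<Rightarrow> 'a set" where
  "nrm S = {x \<in> carrier G. conj_set x S = S}"

lemma subgroup_nrm: "S \<subseteq> carrier G \<Longrightarrow> subgroup (nrm S) G"
proof (rule subgroupI)
  assume S: "S \<subseteq> carrier G"
  show "nrm S \<subseteq> carrier G" unfolding nrm_def by blast
  show "nrm S \<noteq> {}" using conj_set_one[OF S] unfolding nrm_def by auto
  fix a assume a: "a \<in> nrm S"
  then have ac: "a \<in> carrier G" "conj_set a S = S" unfolding nrm_def by auto
  then have "conj_set (inv a) S = S"
    using conj_set_conj_set[of "inv a" a S] S conj_set_one[OF S] by simp
  then show "inv a \<in> nrm S" using ac unfolding nrm_def by simp
  fix b assume b: "b \<in> nrm S"
  then show "a \<otimes> b \<in> nrm S" using ac conj_set_conj_set[of a b S] S unfolding nrm_def by simp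
qed

text \<open>Elements conjugating \<open>S\<close> to the same set form a left coset of the
  normalizer.\<close>

lemma card_conj_class:
  assumes fin: "finite (carrier G)" and S: "S \<subseteq> carrier G"
  shows "card ((\<lambda>x. conj_set x S) ` carrier G) * card (nrm S) = card (carrier G)"
proof (rule card_image_fibres[OF fin])
  fix x assume x: "x \<in> carrier G"
  have "{y \<in> carrier G. conj_set y S = conj_set x S} = (\<lambda>s. x \<otimes> s) ` nrm S"
  proof
    show "(\<lambda>s. x \<otimes> s) ` nrm S \<subseteq> {y \<in> carrier G. conj_set y S = conj_set x S}"
      using x S conj_set_conj_set[of x _ S, symmetric] unfolding nrm_def by auto
    show "{y \<in> carrier G. conj_set y S = conj_set x S} \<subseteq> (\<lambda>s. x \<otimes> s) ` nrm S"
    proof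
      fix y assume "y \<in> {y \<in> carrier G. conj_set y S = conj_set x S}"
      then have y: "y \<in> carrier G" "conj_set y S = conj_set x S" by auto
      have "conj_set (inv x \<otimes> y) S = conj_set (inv x) (conj_set x S)"
        using x y S conj_set_conj_set[of "inv x" y S] by simp
      also have "\<dots> = S" using x S conj_set_conj_set[of "inv x" x S] conj_set_one[OF S] by simp
      finally have "inv x \<otimes> y \<in> nrm S" using x y unfolding nrm_def by simp
      moreover have "y = x \<otimes> (inv x \<otimes> y)" using x y by (simp add: m_assoc[symmetric])
      ultimately show "y \<in> (\<lambda>s. x \<otimes> s) ` nrm S" by blast
    qed
  qed
  moreover have "inj_on (\<lambda>s. x \<otimes> s) (nrm S)"
    using x unfolding nrm_def by (intro inj_onI) auto
  ultimately show "card {y \<in> carrier G. conj_set y S = conj_set x S} = card (nrm S)"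
    by (simp add: card_image)
qed

section \<open>Divisibility and elements of prime order\<close>

lemma subgroup_card_dvd:
  assumes "subgroup H G" "subgroup K G" "H \<subseteq> K" "finite (carrier G)"
  shows "card H dvd card K"
proof -
  interpret K: group "G\<lparr>carrier := K\<rparr>" using assms(2) by (rule subgroup_imp_group)
  have "subgroup H (G\<lparr>carrier := K\<rparr>)" using assms subgroup_incl by blast
  from K.lagrange[OF this] have "card K = card (rcosets\<^bsub>G\<lparr>carrier := K\<rparr>\<^esub> H) * card H"
    by (simp add: order_def)
  then show ?thesis by simp
qed

lemma cauchy:
  assumes H: "subgroup H G" and fin: "finite (carrier G)" and p: "prime p" "p dvd card H"
  shows "\<exists>z\<in>H. z \<noteq> \<one> \<and> z [^] p = \<one>"
proof -
  interpret H: group "G\<lparr>carrier := H\<rparr>" using H by (rule subgroup_imp_group)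
  have finH: "finite H" using fin H finite_subset subgroup.subset by blast
  obtain m where "card H = p * m" using p by blast
  \<comment> \<open>The exponent is 1 and \<open>m\<close> may still be divisible by
    \<open>p\<close>: what is requested is a subgroup of order exactly \<open>p\<close>, not a full
    Sylow subgroup.\<close>
  then have "order (G\<lparr>carrier := H\<rparr>) = p ^ 1 * m" by (simp add: order_def)
  then obtain P where P: "subgroup P (G\<lparr>carrier := H\<rparr>)" "card P = p ^ 1"
    using sylow_thm[OF p(1) H.is_group, of 1 m] finH by auto
  have PH: "P \<subseteq> H" using subgroup.subset[OF P(1)] by simp
  have PG: "subgroup P G" using P(1) H incl_subgroup by blast
  interpret P: group "G\<lparr>carrier := P\<rparr>" using PG by (rule subgroup_imp_group)
  have "P \<noteq> {\<one>}" using P(2) p(1) by (auto simp: prime_nat_iff)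
  moreover have oneP: "\<one> \<in> P" using PG subgroup.one_closed by blast
  ultimately obtain z where z: "z \<in> P" "z \<noteq> \<one>" by blast
  have "z [^]\<^bsub>G\<lparr>carrier := P\<rparr>\<^esub> p = \<one>"
    using P.pow_order_eq_1[of z] z P(2) by (simp add: order_def)
  then have "z [^] p = \<one>" using nat_pow_consistent by metis
  then show ?thesis using z PH by blast
qed

lemma prime_order_power:
  assumes fin: "finite (carrier G)" and g: "g \<in> carrier G" "g \<noteq> \<one>"
  shows "\<exists>k p. prime p \<and> g [^] (k::nat) \<noteq> \<one> \<and> (g [^] k) [^] (p::nat) = \<one>"
proof -
  have o1: "ord g \<noteq> 1" using g ord_eq_1 by simp
  have o0: "ord g > 0" using ord_ge_1[OF fin g(1)] by simp
  obtain p where p: "prime p" "p dvd ord g" using o1 prime_factor_nat by blast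
  then obtain k where k: "ord g = p * k" by blast
  have "k < ord g" "k > 0" using k o0 prime_gt_1_nat[OF p(1)] by auto
  then have "\<not> ord g dvd k" using nat_dvd_not_less by blast
  then have "g [^] k \<noteq> \<one>" using pow_eq_id[OF g(1)] by blast
  moreover have "(g [^] k) [^] p = \<one>"
    using g pow_ord_eq_1[OF g(1)] k by (simp add: nat_pow_pow mult.commute)
  ultimately show ?thesis using p by blast
qed

end

section \<open>Doubly transitive actions of Suzuki type\<close>

text \<open>What the count has to know about the group, with matrices abstracted away. Stabilizers
  are described only at \<open>x0\<close> and \<open>y0\<close>, since double transitivity carries
  them everywhere. \<open>KU\<close> stays opaque until the Sylow 2-subgroup is computed. The last
  two assumptions, on elements of prime order dividing \<open>q\<^sup>2 + 1\<close>, are where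
  irreducibility of matrices enters.\<close>

locale suzuki_action = group G for G (structure) +
  fixes \<Omega> :: "'w set" and act :: "'a \<Rightarrow> 'w \<Rightarrow> 'w" and x0 y0 :: 'w and q KU :: nat
  assumes fin: "finite (carrier G)"
    and act_in: "g \<in> carrier G \<Longrightarrow> w \<in> \<Omega> \<Longrightarrow> act g w \<in> \<Omega>"
    and act_mult: "g \<in> carrier G \<Longrightarrow> h \<in> carrier G \<Longrightarrow> w \<in> \<Omega> \<Longrightarrow> act (g \<otimes> h) w = act g (act h w)"
    and act_one: "w \<in> \<Omega> \<Longrightarrow> act \<one> w = w"
    and card_Omega: "card \<Omega> = q\<^sup>2 + 1"
    and q8: "q \<ge> 8" and even_q: "even q"
    and base: "x0 \<in> \<Omega>" "y0 \<in> \<Omega>" "x0 \<noteq> y0"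
    and trans2: "x \<in> \<Omega> \<Longrightarrow> y \<in> \<Omega> \<Longrightarrow> x \<noteq> y \<Longrightarrow> \<exists>g\<in>carrier G. act g x0 = x \<and> act g y0 = y"
    and card_H: "card {g \<in> carrier G. act g x0 = x0 \<and> act g y0 = y0} = q - 1"
    and H_fix: "g \<in> carrier G \<Longrightarrow> act g x0 = x0 \<Longrightarrow> act g y0 = y0 \<Longrightarrow> g \<noteq> \<one> \<Longrightarrow>
        w \<in> \<Omega> \<Longrightarrow> act g w = w \<Longrightarrow> w = x0 \<or> w = y0"
    and H_comm: "g \<in> carrier G \<Longrightarrow> act g x0 = x0 \<Longrightarrow> act g y0 = y0 \<Longrightarrow>
        h \<in> carrier G \<Longrightarrow> act h x0 = x0 \<Longrightarrow> act h y0 = y0 \<Longrightarrow> g \<otimes> h = h \<otimes> g"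
    and H_swap: "g \<in> carrier G \<Longrightarrow> act g x0 = x0 \<Longrightarrow> act g y0 = y0 \<Longrightarrow> g \<noteq> \<one> \<Longrightarrow>
        h \<in> carrier G \<Longrightarrow> act h x0 = y0 \<Longrightarrow> act h y0 = x0 \<Longrightarrow> h \<otimes> g \<noteq> g \<otimes> h"
    and card_U: "card {g \<in> carrier G - {\<one>}. {w \<in> \<Omega>. act g w = w} = {x0}} = q\<^sup>2 - 1"
    and forests_U: "card (forests {g \<in> carrier G - {\<one>}. {w \<in> \<Omega>. act g w = w} = {x0}}
        (\<lambda>x y. x \<otimes> y = y \<otimes> x) {\<one>}) = KU"
    and cent_comm: "prime p \<Longrightarrow> p dvd q\<^sup>2 + 1 \<Longrightarrow> z \<in> carrier G \<Longrightarrow> z \<noteq> \<one> \<Longrightarrow> z [^] (p::nat) = \<one> \<Longrightarrow>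
        g \<in> cent z \<Longrightarrow> h \<in> cent z \<Longrightarrow> g \<otimes> h = h \<otimes> g"
    and norm_bound: "prime p \<Longrightarrow> p dvd q\<^sup>2 + 1 \<Longrightarrow> z \<in> carrier G \<Longrightarrow> z \<noteq> \<one> \<Longrightarrow> z [^] (p::nat) = \<one> \<Longrightarrow>
        card {x \<in> carrier G. x \<otimes> z \<otimes> inv x \<in> cent z} \<le> 4 * card (cent z)"
begin

section \<open>Fixed-point sets of commuting elements\<close>

abbreviation comm :: "'a \<Rightarrow> 'a \<Rightarrow> bool" where
  "comm x y \<equiv> x \<otimes> y = y \<otimes> x"

definition fix_set :: "'a \<Rightarrow> 'w set" where
  "fix_set g = {w \<in> \<Omega>. act g w = w}"

definition block :: "'w set \<Rightarrow> 'a set" where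
  "block S = {g \<in> carrier G - {\<one>}. fix_set g = S}"

lemma fin_Omega: "finite \<Omega>"
  using card_Omega by (intro card_ge_0_finite) simp

lemma fix_set_subset: "fix_set g \<subseteq> \<Omega>"
  unfolding fix_set_def by blast

lemma act_inv: "g \<in> carrier G \<Longrightarrow> w \<in> \<Omega> \<Longrightarrow> act (inv g) (act g w) = w"
  using act_mult[of "inv g" g w] act_one by simp

lemma act_inv': "g \<in> carrier G \<Longrightarrow> w \<in> \<Omega> \<Longrightarrow> act g (act (inv g) w) = w"
  using act_mult[of g "inv g" w] act_one by simp

lemma act_eq_iff: "g \<in> carrier G \<Longrightarrow> v \<in> \<Omega> \<Longrightarrow> w \<in> \<Omega> \<Longrightarrow> act g v = act g w \<longleftrightarrow> v = w"
  using act_inv by metis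

lemma act_conj:
  "k \<in> carrier G \<Longrightarrow> g \<in> carrier G \<Longrightarrow> w \<in> \<Omega> \<Longrightarrow> act (k \<otimes> g \<otimes> inv k) (act k w) = act k (act g w)"
  by (simp add: act_mult act_in act_inv)

lemma fix_set_conj:
  assumes k: "k \<in> carrier G" and g: "g \<in> carrier G"
  shows "fix_set (k \<otimes> g \<otimes> inv k) = act k ` fix_set g"
proof
  show "act k ` fix_set g \<subseteq> fix_set (k \<otimes> g \<otimes> inv k)"
    using act_conj[OF k g] act_in[OF k] unfolding fix_set_def by auto
  show "fix_set (k \<otimes> g \<otimes> inv k) \<subseteq> act k ` fix_set g"
  proof
    fix w assume "w \<in> fix_set (k \<otimes> g \<otimes> inv k)"
    then have w: "w \<in> \<Omega>" "act (k \<otimes> g \<otimes> inv k) w = w" unfolding fix_set_def by auto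
    let ?v = "act (inv k) w"
    have v: "?v \<in> \<Omega>" "act k ?v = w" using w k act_in act_inv' by auto
    then have "act k (act g ?v) = act k ?v" using act_conj[OF k g v(1)] w by simp
    then have "act g ?v = ?v" using act_eq_iff[OF k] v act_in[OF g] by blast
    then show "w \<in> act k ` fix_set g" using v unfolding fix_set_def by force
  qed
qed

lemma conj_to_base:
  assumes "x \<in> \<Omega>" "y \<in> \<Omega>" "x \<noteq> y"
  obtains k where "k \<in> carrier G" "act k x = x0" "act k y = y0" "act (inv k) x0 = x" "act (inv k) y0 = y"
proof -
  obtain g where g: "g \<in> carrier G" "act g x0 = x" "act g y0 = y" using trans2 assms by blast
  then have "act (inv g) x = x0" "act (inv g) y = y0" using act_inv base by metis+
  then show thesis using that[of "inv g"] g by simp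
qed

lemma fix_set_pair:
  assumes g: "g \<in> carrier G" "g \<noteq> \<one>" and xy: "x \<in> fix_set g" "y \<in> fix_set g" "x \<noteq> y"
  shows "fix_set g = {x, y}"
proof -
  have xyO: "x \<in> \<Omega>" "y \<in> \<Omega>" using xy fix_set_subset by auto
  then obtain k where k: "k \<in> carrier G" "act k x = x0" "act k y = y0"
    using conj_to_base[OF _ _ xy(3)] by metis
  let ?g = "k \<otimes> g \<otimes> inv k"
  have fs: "fix_set ?g = act k ` fix_set g" using fix_set_conj k g by blast
  have "x0 \<in> fix_set ?g" "y0 \<in> fix_set ?g" unfolding fs using k xy by force+
  then have g': "act ?g x0 = x0" "act ?g y0 = y0" unfolding fix_set_def by auto
  have g1: "?g \<in> carrier G" "?g \<noteq> \<one>" using k g conj_eq_one_iff by auto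
  have "w \<in> {x, y}" if w: "w \<in> fix_set g" for w
  proof -
    have "act k w \<in> fix_set ?g" using fs w by blast
    then have "act k w = x0 \<or> act k w = y0" using H_fix[OF g1(1) g' g1(2)] unfolding fix_set_def by blast
    then show ?thesis using k act_eq_iff[OF k(1)] xyO w fix_set_subset by (metis insert_iff subsetD)
  qed
  then show ?thesis using xy by blast
qed

lemma fix_set_cases:
  assumes g: "g \<in> carrier G" "g \<noteq> \<one>"
  obtains "fix_set g = {}" | x where "x \<in> \<Omega>" "fix_set g = {x}"
    | x y where "x \<in> \<Omega>" "y \<in> \<Omega>" "x \<noteq> y" "fix_set g = {x, y}"
proof -
  consider "fix_set g = {}" | x where "fix_set g = {x}" | x y where "x \<in> fix_set g" "y \<in> fix_set g" "x \<noteq> y"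
    by blast
  then show thesis
  proof cases
    case 1
    then show ?thesis by (rule that(1))
  next
    case 2
    then show ?thesis using that(2) fix_set_subset by blast
  next
    case 3
    then show ?thesis using that(3)[OF _ _ 3(3) fix_set_pair[OF g 3]] fix_set_subset by blast
  qed
qed

lemma comm_act_fix_set:
  assumes "g \<in> carrier G" "h \<in> carrier G" "comm g h" "w \<in> fix_set g"
  shows "act h w \<in> fix_set g"
proof -
  have w: "w \<in> \<Omega>" "act g w = w" using assms(4) unfolding fix_set_def by auto
  have "act g (act h w) = act (g \<otimes> h) w" using act_mult[OF assms(1,2) w(1)] by simp
  also have "\<dots> = act h (act g w)" unfolding assms(3) by (rule act_mult[OF assms(2,1) w(1)])
  finally show ?thesis using w assms act_in unfolding fix_set_def by simp
qed

text \<open>\<open>h\<close> permutes the fixed points of \<open>g\<close>. If there is one,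
  \<open>h\<close> fixes it, and a second fixed point of \<open>h\<close> would be fixed by
  \<open>g\<close> as well. If there are two, they are both fixed or exchanged, and
  \<open>H_swap\<close> excludes the exchange after conjugation to the base pair.\<close>

lemma comm_fix_set_aux:
  assumes g: "g \<in> carrier G" "g \<noteq> \<one>" and h: "h \<in> carrier G" "h \<noteq> \<one>" and c: "comm g h"
    and ne: "fix_set g \<noteq> {}"
  shows "fix_set h = fix_set g"
  using g
proof (cases rule: fix_set_cases)
  case 1
  then show ?thesis using ne by simp
next
  case (2 x)
  have "act h x = x" using comm_act_fix_set[OF g(1) h(1) c, of x] 2 by simp
  then have xh: "x \<in> fix_set h" using 2 unfolding fix_set_def by simp
  show ?thesis
    using h
  proof (cases rule: fix_set_cases)
    case 1
    then show ?thesis using xh by simp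
  next
    case (2 x')
    then show ?thesis using xh \<open>fix_set g = {x}\<close> by simp
  next
    case (3 a b)
    then have "x = a \<or> x = b" using xh by simp
    then obtain y where y: "y \<in> \<Omega>" "y \<noteq> x" "fix_set h = {x, y}"
      using 3 that[of a] that[of b] by (metis insert_commute)
    have gy: "act g y \<in> {x, y}" using comm_act_fix_set[OF h(1) g(1) c[symmetric], of y] y by auto
    have "x \<in> fix_set g" using 2 by simp
    then have gx: "act g x = x" unfolding fix_set_def by simp
    have "act g y \<noteq> x" using gx act_eq_iff[OF g(1), of y x] y 2 by metis
    then have "y \<in> fix_set g" using gy y unfolding fix_set_def by auto
    then show ?thesis using 2 y by simp
  qed
next
  case (3 x y)
  have hx: "act h x \<in> {x, y}" "act h y \<in> {x, y}"
    using comm_act_fix_set[OF g(1) h(1) c] 3 by auto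
  have inj: "act h x \<noteq> act h y" using act_eq_iff[OF h(1)] 3 by blast
  show ?thesis
  proof (cases "act h x = x")
    case True
    then have "act h y = y" using inj hx by auto
    then have "x \<in> fix_set h" "y \<in> fix_set h" using True 3 unfolding fix_set_def by auto
    then show ?thesis using fix_set_pair[OF h _ _ 3(3)] 3 by simp
  next
    case False
    then have sw: "act h x = y" "act h y = x" using inj hx by auto
    obtain k where k: "k \<in> carrier G" "act k x = x0" "act k y = y0" "act (inv k) x0 = x" "act (inv k) y0 = y"
      using conj_to_base 3 by metis
    have "x \<in> fix_set g" "y \<in> fix_set g" using 3 by simp_all
    then have gxy: "act g x = x" "act g y = y" unfolding fix_set_def by simp_all
    have "act (k \<otimes> h \<otimes> inv k) x0 = y0" "act (k \<otimes> h \<otimes> inv k) y0 = x0"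
      "act (k \<otimes> g \<otimes> inv k) x0 = x0" "act (k \<otimes> g \<otimes> inv k) y0 = y0"
      using act_conj[OF k(1) h(1), of x] act_conj[OF k(1) h(1), of y]
        act_conj[OF k(1) g(1), of x] act_conj[OF k(1) g(1), of y] k sw gxy 3 by simp_all
    moreover have "k \<otimes> g \<otimes> inv k \<noteq> \<one>" using conj_eq_one_iff k g by blast
    moreover have "comm (k \<otimes> h \<otimes> inv k) (k \<otimes> g \<otimes> inv k)"
      using conj_comm_iff[OF k(1) h(1) g(1)] c by simp
    ultimately show ?thesis
      using H_swap[of "k \<otimes> g \<otimes> inv k" "k \<otimes> h \<otimes> inv k"] k g h by simp
  qed
qed

lemma comm_fix_set:
  assumes g: "g \<in> carrier G" "g \<noteq> \<one>" and h: "h \<in> carrier G" "h \<noteq> \<one>" and c: "comm g h"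
  shows "fix_set h = fix_set g"
  using comm_fix_set_aux[OF g h c] comm_fix_set_aux[OF h g c[symmetric]] by blast

lemma block_conj:
  assumes k: "k \<in> carrier G" and S: "S \<subseteq> \<Omega>"
  shows "block (act k ` S) = (\<lambda>g. k \<otimes> g \<otimes> inv k) ` block S"
proof -
  have inj: "act k ` S = act k ` S' \<longleftrightarrow> S = S'" if "S' \<subseteq> \<Omega>" for S'
    using S that act_eq_iff[OF k] by (intro inj_on_image_eq_iff[of _ \<Omega>] inj_onI) auto
  show ?thesis
  proof
    show "(\<lambda>g. k \<otimes> g \<otimes> inv k) ` block S \<subseteq> block (act k ` S)"
      using k conj_eq_one_iff fix_set_conj unfolding block_def by auto
    show "block (act k ` S) \<subseteq> (\<lambda>g. k \<otimes> g \<otimes> inv k) ` block S"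
    proof
      fix g assume g: "g \<in> block (act k ` S)"
      let ?h = "inv k \<otimes> g \<otimes> k"
      have gc: "g \<in> carrier G" "g \<noteq> \<one>" "fix_set g = act k ` S" using g unfolding block_def by auto
      have hg: "k \<otimes> ?h \<otimes> inv k = g" using conj_inv_cancel[of "inv k" g] k gc by simp
      have hc: "?h \<in> carrier G" using k gc by simp
      have "?h \<noteq> \<one>" using hg gc conj_eq_one_iff[OF k hc] by simp
      moreover have "act k ` fix_set ?h = act k ` S" using fix_set_conj[OF k hc] hg gc by simp
      then have "fix_set ?h = S" using inj[OF fix_set_subset] by blast
      ultimately have "?h \<in> block S" using hc unfolding block_def by simp
      then show "g \<in> (\<lambda>g. k \<otimes> g \<otimes> inv k) ` block S" using hg by (metis imageI)
    qed
  qed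
qed

lemma block_subset: "block S \<subseteq> carrier G"
  unfolding block_def by blast

lemma finite_block: "finite (block S)"
  using block_subset fin finite_subset by blast

lemma card_block_conj:
  assumes k: "k \<in> carrier G" and S: "S \<subseteq> \<Omega>"
  shows "card (block (act k ` S)) = card (block S)"
  unfolding block_conj[OF assms] using conj_inj[OF k] block_subset inj_on_subset by (metis card_image)

lemma card_forests_block_conj:
  assumes k: "k \<in> carrier G" and S: "S \<subseteq> \<Omega>"
  shows "card (forests (block (act k ` S)) comm {\<one>}) = card (forests (block S) comm {\<one>})"
proof -
  have "(\<lambda>g. k \<otimes> g \<otimes> inv k) ` {\<one>} = {\<one>}" using k by simp
  moreover have "card (forests ((\<lambda>g. k \<otimes> g \<otimes> inv k) ` block S) comm ((\<lambda>g. k \<otimes> g \<otimes> inv k) ` {\<one>}))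
      = card (forests (block S) comm {\<one>})"
  proof (rule card_forests_image)
    show "inj_on (\<lambda>g. k \<otimes> g \<otimes> inv k) (block S \<union> {\<one>})"
      using block_subset by (intro inj_on_subset[OF conj_inj[OF k]]) auto
    show "block S \<inter> {\<one>} = {}" unfolding block_def by blast
    show "finite (block S)" by (rule finite_block)
    show "comm (k \<otimes> u \<otimes> inv k) (k \<otimes> v \<otimes> inv k) = comm u v" if "u \<in> block S" "v \<in> block S" for u v
      using conj_comm_iff[OF k] that block_subset by blast
  qed simp
  ultimately show ?thesis unfolding block_conj[OF assms] by simp
qed

lemma act_singleton: "x \<in> \<Omega> \<Longrightarrow> \<exists>k\<in>carrier G. act k ` {x0} = {x}"
proof -
  assume x: "x \<in> \<Omega>"
  have "\<not> \<Omega> \<subseteq> {x}" using base by blast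
  then obtain y where "y \<in> \<Omega>" "y \<noteq> x" by blast
  then show ?thesis using trans2[OF x] by auto
qed

lemma card_block_singleton: "x \<in> \<Omega> \<Longrightarrow> card (block {x}) = q\<^sup>2 - 1"
  using act_singleton[of x] card_block_conj[of _ "{x0}"] card_U base unfolding block_def fix_set_def by force

lemma card_forests_singleton: "x \<in> \<Omega> \<Longrightarrow> card (forests (block {x}) comm {\<one>}) = KU"
  using act_singleton[of x] card_forests_block_conj[of _ "{x0}"] forests_U base
  unfolding block_def fix_set_def by force

section \<open>Counting elements and forests by fixed-point set\<close>

definition pairs :: "'w set set" where
  "pairs = {P. P \<subseteq> \<Omega> \<and> card P = 2}"

lemma finite_pairs: "finite pairs"
  unfolding pairs_def using fin_Omega by simp

lemma card_pairs: "2 * card pairs = (q\<^sup>2 + 1) * q\<^sup>2"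
proof -
  have "card pairs = (q\<^sup>2 + 1) choose 2"
    unfolding pairs_def using n_subsets[OF fin_Omega, of 2] card_Omega by simp
  then show ?thesis by (simp add: choose_two)
qed

lemma act_pair: "P \<in> pairs \<Longrightarrow> \<exists>k\<in>carrier G. act k ` {x0, y0} = P"
proof -
  assume "P \<in> pairs"
  then obtain x y where P: "P = {x, y}" "x \<noteq> y" "x \<in> \<Omega>" "y \<in> \<Omega>"
    unfolding pairs_def by (auto simp: card_2_iff)
  obtain k where "k \<in> carrier G" "act k x0 = x" "act k y0 = y"
    using trans2[OF P(3,4,2)] by blast
  then show ?thesis using P(1) by auto
qed

lemma block_base: "block {x0, y0} = {g \<in> carrier G. act g x0 = x0 \<and> act g y0 = y0} - {\<one>}"
proof -
  have "fix_set g = {x0, y0} \<longleftrightarrow> act g x0 = x0 \<and> act g y0 = y0" if g: "g \<in> carrier G" "g \<noteq> \<one>" for g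
    using fix_set_pair[OF g, of x0 y0] base unfolding fix_set_def by blast
  then show ?thesis unfolding block_def by blast
qed

lemma card_block_base: "card (block {x0, y0}) = q - 2"
  unfolding block_base using card_H act_one base fin by (subst card_Diff_singleton) auto

lemma card_block_pair: "P \<in> pairs \<Longrightarrow> card (block P) = q - 2"
  using act_pair card_block_conj[of _ "{x0, y0}"] card_block_base base by force

lemma card_forests_pair:
  assumes "P \<in> pairs"
  shows "card (forests (block P) comm {\<one>}) = (q - 1) ^ (q - 3)"
proof -
  obtain k where k: "k \<in> carrier G" "act k ` {x0, y0} = P" using act_pair[OF assms] by blast
  have "card (forests (block {x0, y0}) comm {\<one>})
      = card {\<one>} * (card {\<one>} + card (block {x0, y0})) ^ (card (block {x0, y0}) - 1)"
  proof (rule card_forests_complete)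
    show "block {x0, y0} \<noteq> {}" using card_block_base q8 by force
    show "comm u v" if "u \<in> block {x0, y0}" "v \<in> block {x0, y0}" for u v
      using that H_comm unfolding block_base by blast
  qed (auto simp: finite_block, auto simp: block_def)
  also have "\<dots> = (q - 1) ^ (q - 3)"
  proof -
    have "1 + (q - 2) = q - 1" "q - 2 - 1 = q - 3" using q8 by auto
    then show ?thesis unfolding card_block_base by simp
  qed
  finally show ?thesis using card_forests_block_conj[OF k(1), of "{x0, y0}"] k base by simp
qed

text \<open>Elements with the same images of \<open>x0\<close> and \<open>y0\<close> form a left
  coset of the two-point stabilizer, and every ordered pair of distinct points occurs.\<close>

lemma card_carrier: "card (carrier G) = q\<^sup>2 * (q\<^sup>2 + 1) * (q - 1)"
proof -
  let ?f = "\<lambda>g. (act g x0, act g y0)" and ?H = "{g \<in> carrier G. act g x0 = x0 \<and> act g y0 = y0}"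
  have im: "?f ` carrier G = \<Omega> \<times> \<Omega> - Id"
  proof
    show "?f ` carrier G \<subseteq> \<Omega> \<times> \<Omega> - Id"
      using act_in base act_eq_iff by auto
    show "\<Omega> \<times> \<Omega> - Id \<subseteq> ?f ` carrier G"
    proof
      fix p assume "p \<in> \<Omega> \<times> \<Omega> - Id"
      then obtain x y where "p = (x, y)" "x \<in> \<Omega>" "y \<in> \<Omega>" "x \<noteq> y" by auto
      then show "p \<in> ?f ` carrier G" using trans2[of x y] by auto
    qed
  qed
  have "card (\<Omega> \<times> \<Omega> - Id) = (q\<^sup>2 + 1) * (q\<^sup>2 + 1) - (q\<^sup>2 + 1)"
  proof -
    have "\<Omega> \<times> \<Omega> - Id = \<Omega> \<times> \<Omega> - Id_on \<Omega>" by auto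
    moreover have "Id_on \<Omega> = (\<lambda>x. (x, x)) ` \<Omega>" by auto
    then have "card (Id_on \<Omega>) = q\<^sup>2 + 1" using card_Omega by (simp add: card_image inj_on_def)
    ultimately show ?thesis
      using card_Omega fin_Omega card_Diff_subset[of "Id_on \<Omega>" "\<Omega> \<times> \<Omega>"]
      by (auto simp: card_cartesian_product finite_subset[of "Id_on \<Omega>" "\<Omega> \<times> \<Omega>"])
  qed
  then have c: "card (?f ` carrier G) = (q\<^sup>2 + 1) * q\<^sup>2" unfolding im by simp
  have "card (?f ` carrier G) * (q - 1) = card (carrier G)"
  proof (rule card_image_fibres[OF fin])
    fix x assume x: "x \<in> carrier G"
    have "{y \<in> carrier G. ?f y = ?f x} = (\<lambda>s. x \<otimes> s) ` ?H"
    proof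
      show "(\<lambda>s. x \<otimes> s) ` ?H \<subseteq> {y \<in> carrier G. ?f y = ?f x}"
        using x base act_mult by auto
      show "{y \<in> carrier G. ?f y = ?f x} \<subseteq> (\<lambda>s. x \<otimes> s) ` ?H"
      proof
        fix y assume y: "y \<in> {y \<in> carrier G. ?f y = ?f x}"
        then have "inv x \<otimes> y \<in> ?H" using x base act_mult[of "inv x" y] act_inv[OF x] by auto
        moreover have "y = x \<otimes> (inv x \<otimes> y)" using x y by (simp add: m_assoc[symmetric])
        ultimately show "y \<in> (\<lambda>s. x \<otimes> s) ` ?H" by blast
      qed
    qed
    moreover have "inj_on (\<lambda>s. x \<otimes> s) ?H" using x by (intro inj_onI) auto
    ultimately show "card {y \<in> carrier G. ?f y = ?f x} = q - 1" using card_H by (simp add: card_image)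
  qed
  then show ?thesis using c by (simp add: mult.commute)
qed

definition fix_types :: "'w set set" where
  "fix_types = insert {} ((\<lambda>x. {x}) ` \<Omega> \<union> pairs)"

lemma carrier_blocks: "carrier G - {\<one>} = (\<Union>S\<in>fix_types. block S)"
proof
  show "carrier G - {\<one>} \<subseteq> (\<Union>S\<in>fix_types. block S)"
  proof
    fix g assume g: "g \<in> carrier G - {\<one>}"
    then have g': "g \<in> carrier G" "g \<noteq> \<one>" by auto
    from g' have "fix_set g \<in> fix_types"
      by (cases rule: fix_set_cases) (auto simp: fix_types_def pairs_def)
    then show "g \<in> (\<Union>S\<in>fix_types. block S)" using g unfolding block_def by blast
  qed
qed (auto simp: block_def)

lemma finite_fix_types: "finite fix_types"
  unfolding fix_types_def using fin_Omega finite_pairs by simp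

lemma fix_types_sum:
  fixes f :: "'w set \<Rightarrow> 'm::comm_monoid_add"
  shows "sum f fix_types = f {} + ((\<Sum>x\<in>\<Omega>. f {x}) + (\<Sum>P\<in>pairs. f P))"
proof -
  have "sum f fix_types = f {} + sum f ((\<lambda>x. {x}) ` \<Omega> \<union> pairs)"
    unfolding fix_types_def using fin_Omega finite_pairs
    by (intro sum.insert) (auto simp: pairs_def)
  also have "sum f ((\<lambda>x. {x}) ` \<Omega> \<union> pairs) = sum f ((\<lambda>x. {x}) ` \<Omega>) + sum f pairs"
    using fin_Omega finite_pairs by (intro sum.union_disjoint) (auto simp: pairs_def)
  also have "sum f ((\<lambda>x. {x}) ` \<Omega>) = (\<Sum>x\<in>\<Omega>. f {x})" by (simp add: sum.reindex)
  finally show ?thesis .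
qed

lemma fix_types_prod:
  fixes f :: "'w set \<Rightarrow> 'm::comm_monoid_mult"
  shows "prod f fix_types = f {} * ((\<Prod>x\<in>\<Omega>. f {x}) * (\<Prod>P\<in>pairs. f P))"
proof -
  have "prod f fix_types = f {} * prod f ((\<lambda>x. {x}) ` \<Omega> \<union> pairs)"
    unfolding fix_types_def using fin_Omega finite_pairs
    by (intro prod.insert) (auto simp: pairs_def)
  also have "prod f ((\<lambda>x. {x}) ` \<Omega> \<union> pairs) = prod f ((\<lambda>x. {x}) ` \<Omega>) * prod f pairs"
    using fin_Omega finite_pairs by (intro prod.union_disjoint) (auto simp: pairs_def)
  also have "prod f ((\<lambda>x. {x}) ` \<Omega>) = (\<Prod>x\<in>\<Omega>. f {x})" by (simp add: prod.reindex)
  finally show ?thesis .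
qed

text \<open>This is what remains of the group order after the identity and the elements with one or
  two fixed points are taken away.\<close>

lemma card_block_empty: "2 * card (block {}) = q ^ 3 * (q - 1)\<^sup>2"
proof -
  have "card (carrier G - {\<one>}) = (\<Sum>S\<in>fix_types. card (block S))"
    unfolding carrier_blocks using finite_fix_types finite_block
    by (intro card_UN_disjoint) (auto simp: block_def)
  also have "\<dots> = card (block {}) + ((q\<^sup>2 + 1) * (q\<^sup>2 - 1) + card pairs * (q - 2))"
    unfolding fix_types_sum using card_block_singleton card_block_pair card_Omega by simp
  finally have "card (carrier G) = 1 + (card (block {}) + ((q\<^sup>2 + 1) * (q\<^sup>2 - 1) + card pairs * (q - 2)))"
    using fin by (metis Suc_eq_plus1_left card_Suc_Diff1 one_closed)
  then have "2 * (q\<^sup>2 * (q\<^sup>2 + 1) * (q - 1)) =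
      2 + (2 * card (block {}) + (2 * ((q\<^sup>2 + 1) * (q\<^sup>2 - 1)) + (2 * card pairs) * (q - 2)))"
    unfolding card_carrier by simp
  then have e: "2 * (q\<^sup>2 * (q\<^sup>2 + 1) * (q - 1)) =
      2 + (2 * card (block {}) + (2 * ((q\<^sup>2 + 1) * (q\<^sup>2 - 1)) + ((q\<^sup>2 + 1) * q\<^sup>2) * (q - 2)))"
    unfolding card_pairs .
  \<comment> \<open>The shift by 2 turns all truncated differences into polynomials in
    \<open>t\<close>.\<close>
  obtain t where t: "q = t + 2" using q8 le_Suc_ex[of 2 q] by auto
  have "q\<^sup>2 - 1 = t\<^sup>2 + 4 * t + 3" "q - 1 = t + 1" "q - 2 = t" unfolding t by (simp_all add: power2_eq_square)
  then show ?thesis using e unfolding t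
    by (simp add: power2_eq_square power3_eq_cube algebra_simps)
qed

lemma card_forests_carrier:
  "card (forests (carrier G - {\<one>}) comm {\<one>})
   = card (forests (block {}) comm {\<one>}) * (KU ^ (q\<^sup>2 + 1) * ((q - 1) ^ (q - 3)) ^ card pairs)"
proof -
  have "card (forests (carrier G - {\<one>}) comm {\<one>}) = (\<Prod>S\<in>fix_types. card (forests (block S) comm {\<one>}))"
    unfolding carrier_blocks
  proof (rule card_forests_UN[OF finite_fix_types])
    show "block S \<inter> block S' = {}" if "S \<noteq> S'" for S S' using that unfolding block_def by blast
    show "block S \<inter> {\<one>} = {}" for S unfolding block_def by blast
    show "\<not> comm v w" if "S \<noteq> S'" "v \<in> block S" "w \<in> block S'" for S S' v w
      using that comm_fix_set[of v w] unfolding block_def by auto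
  qed
  then show ?thesis
    unfolding fix_types_prod using card_forests_singleton card_forests_pair card_Omega by simp
qed

end

section \<open>Arithmetic of the torus orders\<close>

text \<open>Here \<open>u1\<close>, \<open>u2\<close> stand for the orders, \<open>m1\<close>,
  \<open>m2\<close> for the normalizer indices and \<open>c1\<close>, \<open>c2\<close> for the
  numbers of conjugates. Up to a controlled error the count reads 2/m1 + 2/m2 = 1, which for indices
  at most 4 forces both to be 4; the exact equation then yields the sum of the orders.\<close>

lemma torus_count_identity:
  fixes q u1 u2 m1 m2 c1 c2 :: nat
  assumes q: "q \<ge> 8" and prod: "u1 * u2 = q\<^sup>2 + 1" and u: "u1 \<ge> 5" "u2 \<ge> 5"
    and m: "1 \<le> m1" "m1 \<le> 4" "1 \<le> m2" "m2 \<le> 4"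
    and c: "c1 * m1 = q\<^sup>2 * (q - 1) * u2" "c2 * m2 = q\<^sup>2 * (q - 1) * u1"
    and tot: "2 * (c1 * (u1 - 1) + c2 * (u2 - 1)) = q ^ 3 * (q - 1)\<^sup>2"
  shows "m1 = 4 \<and> m2 = 4 \<and> u1 + u2 = 2 * q + 2"
proof -
  have "(q\<^sup>2 * (q - 1)) * (2 * (m2 * (u2 * (u1 - 1)) + m1 * (u1 * (u2 - 1))))
      = 2 * (m2 * (c1 * m1) * (u1 - 1) + m1 * (c2 * m2) * (u2 - 1))"
    unfolding c by (simp add: distrib_left mult_ac)
  also have "\<dots> = m1 * m2 * (2 * (c1 * (u1 - 1) + c2 * (u2 - 1)))" by (simp add: distrib_left mult_ac)
  also have "\<dots> = (q\<^sup>2 * (q - 1)) * (m1 * m2 * (q * (q - 1)))"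
    unfolding tot by (simp add: power2_eq_square power3_eq_cube mult_ac)
  finally have "2 * (m2 * (u2 * (u1 - 1)) + m1 * (u1 * (u2 - 1))) = m1 * m2 * (q * (q - 1))"
    using q by (subst (asm) mult_cancel1) auto
  then have "int (2 * (m2 * (u2 * (u1 - 1)) + m1 * (u1 * (u2 - 1)))) = int (m1 * m2 * (q * (q - 1)))"
    by (rule arg_cong)
  then have e: "2 * (int m2 * (int u2 * (int u1 - 1)) + int m1 * (int u1 * (int u2 - 1)))
      = int m1 * int m2 * (int q * (int q - 1))"
    using u q by (simp add: of_nat_diff)
  define s where "s = int q * int q"
  have p: "int u1 * int u2 = s + 1"
    using arg_cong[OF prod, of int] by (simp add: s_def power2_eq_square)
  have e': "2 * (int m2 * (s + 1 - int u2) + int m1 * (s + 1 - int u1)) = int m1 * int m2 * (s - int q)"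
    using e p by (simp add: algebra_simps s_def)
  \<comment> \<open>Orders of at least 5 keep \<open>u1 + u2\<close> near a fifth of
    \<open>s\<close> or below. This bounds the error, so that linear arithmetic can discard all
    other pairs of indices.\<close>
  have "(int u1 - 5) * (int u2 - 5) \<ge> 0" using u by simp
  then have b: "5 * (int u1 + int u2) \<le> s + 26" using p by (simp add: algebra_simps)
  have s: "s \<ge> 8 * int q" unfolding s_def using q by simp
  have "m1 \<in> {1, 2, 3, 4}" "m2 \<in> {1, 2, 3, 4}" using m by auto
  then have "m1 = 4 \<and> m2 = 4" using e' b s u q by auto
  then show ?thesis using e' by auto
qed

text \<open>Product and sum make \<open>u1\<close> and \<open>u2\<close> the roots of a quadratic,
  and (u1 - q - 1)^2 = (q + 1)^2 - (q^2 + 1) = 2q = r^2.\<close>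

lemma torus_orders:
  fixes n q r u1 u2 :: nat
  assumes q: "q = 2 ^ (2 * n + 1)" and r: "r = 2 ^ (n + 1)"
    and prod: "u1 * u2 = q\<^sup>2 + 1" and sum: "u1 + u2 = 2 * q + 2"
  shows "u1 = q - r + 1 \<and> u2 = q + r + 1 \<or> u1 = q + r + 1 \<and> u2 = q - r + 1"
proof -
  have rq: "r\<^sup>2 = 2 * q" unfolding q r 
    by (simp add: power_mult power2_eq_square flip: power_mult_distrib)
  have "r \<le> q" unfolding q r by (rule power_increasing) auto
  have s: "int u2 = 2 * int q + 2 - int u1" using arg_cong[OF sum, of int] by simp
  have p: "int u1 * int u2 = (int q)\<^sup>2 + 1" using arg_cong[OF prod, of int] by simp
  have rq': "(int r)\<^sup>2 = 2 * int q" using arg_cong[OF rq, of int] by simp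
  have "(int u1 - int q - 1)\<^sup>2 = (int r)\<^sup>2"
    unfolding rq' using p unfolding s by (simp add: power2_eq_square algebra_simps)
  then have "int u1 - int q - 1 = int r \<or> int u1 - int q - 1 = - int r"
    by (simp add: power2_eq_iff)
  then show ?thesis using s \<open>r \<le> q\<close> by auto
qed

text \<open>The case of a single class, of order \<open>q\<^sup>2 + 1\<close>: cancelling leaves 2q
  = m(q - 1), which no m up to 4 satisfies for q \<ge> 8.\<close>

lemma torus_single_impossible:
  fixes q c m :: nat
  assumes q: "q \<ge> 8" and m: "1 \<le> m" "m \<le> 4" and c: "c * m = q\<^sup>2 * (q - 1)"
    and tot: "2 * (c * (q\<^sup>2 + 1 - 1)) = q ^ 3 * (q - 1)\<^sup>2"
  shows False
proof -
  have "(q\<^sup>2 * (q - 1)) * (2 * q\<^sup>2) = m * (2 * (c * q\<^sup>2))"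
    unfolding c[symmetric] by (simp add: mult_ac)
  also have "\<dots> = (q\<^sup>2 * (q - 1)) * (m * (q * (q - 1)))"
  proof -
    have "2 * (c * q\<^sup>2) = q ^ 3 * (q - 1)\<^sup>2" using tot by simp
    then show ?thesis by (simp only:) (simp add: power2_eq_square power3_eq_cube mult_ac)
  qed
  finally have "2 * q\<^sup>2 = m * (q * (q - 1))" using q by (subst (asm) mult_cancel1) auto
  then have "q * (2 * q) = q * (m * (q - 1))" by (simp add: power2_eq_square algebra_simps)
  then have "2 * q = m * (q - 1)" using q by (subst (asm) mult_cancel1) auto
  moreover have "m \<in> {1, 2, 3, 4}" using m by auto
  ultimately show False using q by auto
qed

text \<open>Each class fills at least a fifth of the group, so three would fill three fifths,
  whereas fewer than half of the elements are free of fixed points.\<close>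

lemma torus_triple_impossible:
  fixes q :: nat and g :: nat
  assumes q: "q \<ge> 8" and g: "g = q\<^sup>2 * (q\<^sup>2 + 1) * (q - 1)"
    and c: "5 * (c1 + c2 + c3) \<ge> 3 * g" and tot: "2 * (c1 + c2 + c3) \<le> q ^ 3 * (q - 1)\<^sup>2"
  shows False
proof -
  have "6 * g \<le> 5 * (q ^ 3 * (q - 1)\<^sup>2)" using c tot by linarith
  then have "(q\<^sup>2 * (q - 1)) * (6 * (q\<^sup>2 + 1)) \<le> (q\<^sup>2 * (q - 1)) * (5 * (q * (q - 1)))"
    unfolding g by (simp add: algebra_simps power2_eq_square power3_eq_cube)
  then have "6 * (q\<^sup>2 + 1) \<le> 5 * (q * (q - 1))" using q by (subst (asm) mult_le_cancel1) auto
  moreover have "5 * (q * (q - 1)) \<le> 5 * q\<^sup>2" by (simp add: power2_eq_square)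
  ultimately have "6 * (q\<^sup>2 + 1) \<le> 5 * q\<^sup>2" by (rule le_trans)
  then show False by simp
qed

section \<open>Centralizers of fixed-point-free elements\<close>

context suzuki_action
begin

text \<open>q is even, and -1 is not a square modulo 3. The point of the bound 5 is to exceed every
  possible normalizer index.\<close>

lemma prime_dvd_ge5:
  assumes "prime p" "p dvd q\<^sup>2 + 1"
  shows "p \<ge> 5"
proof -
  have "p \<noteq> 2" using assms even_q by auto
  moreover have "p \<noteq> 3"
  proof
    assume "p = 3"
    then have "(q\<^sup>2 + 1) mod 3 = 0" using assms by auto
    moreover have "(q\<^sup>2 + 1) mod 3 = ((q mod 3)\<^sup>2 + 1) mod 3" by (metis mod_add_left_eq power_mod)
    moreover have m3: "(m\<^sup>2 + 1) mod 3 \<noteq> 0" if "m < 3" for m :: nat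
    proof -
      have "m = 0 \<or> m = 1 \<or> m = 2" using that by auto
      moreover have "(0\<^sup>2 + 1) mod 3 = (1::nat)" "(1\<^sup>2 + 1) mod 3 = (2::nat)" "(2\<^sup>2 + 1) mod 3 = (2::nat)"
        by simp_all
      ultimately show ?thesis by (metis zero_neq_numeral zero_neq_one)
    qed
    ultimately show False using m3[of "q mod 3"] by simp
  qed
  moreover have "p \<noteq> 4" using assms(1) primes_dvd_imp_eq[of 2 p] by auto
  ultimately show ?thesis using prime_ge_2_nat[OF assms(1)] by linarith
qed

lemma act_funpow: "g \<in> carrier G \<Longrightarrow> w \<in> \<Omega> \<Longrightarrow> (act g ^^ k) w = act (g [^] k) w"
proof (induction k)
  case 0
  then show ?case by (simp add: act_one)
next
  case (Suc k)
  have "act (g [^] Suc k) w = act g (act (g [^] k) w)"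
    using act_mult[of g "g [^] k" w] Suc.prems nat_pow_Suc2[of g k] by simp
  then show ?case using Suc by simp
qed

lemma card_Omega_cong:
  assumes z: "z \<in> carrier G" "z [^] p = \<one>" and p: "prime p"
  shows "[q\<^sup>2 + 1 = card (fix_set z)] (mod p)"
  using card_fixed_points_cong[OF fin_Omega p, of "act z"] act_in z act_funpow act_one
  unfolding fix_set_def card_Omega by simp

lemma block_emptyD: "g \<in> block {} \<Longrightarrow> g \<in> carrier G \<and> g \<noteq> \<one> \<and> fix_set g = {}"
  unfolding block_def by simp

lemma comm_block_empty:
  "g \<in> block {} \<Longrightarrow> h \<in> carrier G \<Longrightarrow> h \<noteq> \<one> \<Longrightarrow> comm g h \<Longrightarrow> h \<in> block {}"
  using comm_fix_set[of g h] unfolding block_def by simp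

lemma self_cent: "g \<in> carrier G \<Longrightarrow> g \<in> cent g"
  unfolding cent_def by simp

lemma pow_cent: "g \<in> carrier G \<Longrightarrow> g [^] (k::nat) \<in> cent g"
  unfolding cent_def by (simp add: nat_pow_comm[of g k 1, simplified])

text \<open>A nontrivial power of \<open>g\<close> commutes with \<open>g\<close>, hence has no
  fixed points either; counting points modulo its prime order makes that prime divide
  \<open>q\<^sup>2 + 1\<close>.\<close>

lemma fpf_power:
  assumes g: "g \<in> block {}"
  obtains z p where "z \<in> cent g" "z \<noteq> \<one>" "prime p" "p dvd q\<^sup>2 + 1" "z [^] (p::nat) = \<one>"
    "z \<in> block {}" "cent g \<subseteq> cent z"
proof -
  have gc: "g \<in> carrier G" "g \<noteq> \<one>" using block_emptyD[OF g] by auto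
  obtain k p where k: "prime p" "g [^] (k::nat) \<noteq> \<one>" "(g [^] k) [^] (p::nat) = \<one>"
    using prime_order_power[OF fin gc] by blast
  let ?z = "g [^] k"
  have z: "?z \<in> carrier G" "?z \<in> cent g" using gc pow_cent by auto
  then have zb: "?z \<in> block {}" using comm_block_empty[OF g _ k(2)] unfolding cent_def by simp
  have "[q\<^sup>2 + 1 = card (fix_set ?z)] (mod p)" using card_Omega_cong[OF z(1) k(3,1)] .
  then have "p dvd q\<^sup>2 + 1" using block_emptyD[OF zb] by (simp add: cong_0_iff)
  moreover have "cent g \<subseteq> cent ?z"
  proof
    fix x assume "x \<in> cent g"
    then have x: "x \<in> carrier G" "g \<in> cent x" using gc unfolding cent_def by auto
    have "g [^] k \<in> cent x" for k :: nat
      using subgroup_cent[OF x(1)] x(2)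
    proof (induction k)
      case 0
      then show ?case by (simp add: subgroup.one_closed)
    next
      case (Suc k)
      then show ?case by (simp add: subgroup.m_closed)
    qed
    then show "x \<in> cent ?z" using x unfolding cent_def by auto
  qed
  ultimately show thesis using that z k zb by blast
qed

lemma cent_abelian:
  assumes "g \<in> block {}" "a \<in> cent g" "b \<in> cent g"
  shows "comm a b"
proof -
  obtain z p where z: "z \<noteq> \<one>" "prime p" "p dvd q\<^sup>2 + 1" "z [^] (p::nat) = \<one>"
    "z \<in> block {}" "cent g \<subseteq> cent z"
    using fpf_power[OF assms(1)] by metis
  then show ?thesis using cent_comm[of p z a b] assms block_emptyD by blast
qed

text \<open>Both centralizers are abelian and each contains both elements. Hence commuting is an
  equivalence relation on fixed-point-free elements, and distinct centralizers meet in the identity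
  only.\<close>

lemma cent_eq:
  assumes g: "g \<in> block {}" and h: "h \<in> cent g" "h \<noteq> \<one>"
  shows "h \<in> block {} \<and> cent h = cent g"
proof -
  have gh: "g \<in> carrier G" "h \<in> carrier G" "comm g h" "g \<in> cent h"
    using block_emptyD[OF g] h unfolding cent_def by auto
  then have hb: "h \<in> block {}" using comm_block_empty[OF g] h by blast
  have "cent h \<subseteq> cent g"
    using cent_abelian[OF hb] gh(4) cent_subset unfolding cent_def by blast
  moreover have "cent g \<subseteq> cent h"
    using cent_abelian[OF g] h(1) cent_subset unfolding cent_def by blast
  ultimately show ?thesis using hb by blast
qed

text \<open>In the Suzuki group these turn out to be the maximal tori of orders
  \<open>q - r + 1\<close> and \<open>q + r + 1\<close>.\<close>

definition tori :: "'a set set" where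
  "tori = cent ` block {}"

lemma toriE:
  assumes "T \<in> tori"
  obtains g where "g \<in> block {}" "g \<in> T" "T = cent g"
  using assms self_cent block_emptyD unfolding tori_def by blast

lemma torus_cent:
  assumes "T \<in> tori" "h \<in> T" "h \<noteq> \<one>"
  shows "h \<in> block {} \<and> T = cent h"
  using assms cent_eq unfolding tori_def by blast

lemma torus_subgroup: "T \<in> tori \<Longrightarrow> subgroup T G"
  unfolding tori_def using subgroup_cent block_emptyD by blast

lemma torus_subset: "T \<in> tori \<Longrightarrow> T \<subseteq> carrier G"
  using torus_subgroup subgroup.subset by blast

lemma torus_comm: "T \<in> tori \<Longrightarrow> a \<in> T \<Longrightarrow> b \<in> T \<Longrightarrow> comm a b"
  using cent_abelian unfolding tori_def by blast

lemma finite_torus: "T \<in> tori \<Longrightarrow> finite T"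
  using torus_subset fin finite_subset by blast

lemma finite_tori: "finite tori"
  unfolding tori_def using finite_block by simp

lemma torus_disjoint: "T \<in> tori \<Longrightarrow> T' \<in> tori \<Longrightarrow> z \<in> T \<Longrightarrow> z \<in> T' \<Longrightarrow> z \<noteq> \<one> \<Longrightarrow> T = T'"
  using torus_cent by metis

lemma block_empty_tori: "block {} = (\<Union>T\<in>tori. T - {\<one>})"
proof
  show "block {} \<subseteq> (\<Union>T\<in>tori. T - {\<one>})"
    using self_cent block_emptyD unfolding tori_def by blast
  show "(\<Union>T\<in>tori. T - {\<one>}) \<subseteq> block {}" using torus_cent by blast
qed

lemma torus_semiregular:
  assumes T: "T \<in> tori" and s: "s \<in> T" and t: "t \<in> T" and w: "w \<in> \<Omega>" and eq: "act s w = act t w"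
  shows "s = t"
proof (rule ccontr)
  assume ne: "s \<noteq> t"
  have st: "s \<in> carrier G" "t \<in> carrier G" using s t torus_subset[OF T] by auto
  have "inv t \<otimes> s \<in> T" using torus_subgroup[OF T] s t by (simp add: subgroup.m_closed subgroup.m_inv_closed)
  moreover have "inv t \<otimes> s \<noteq> \<one>" using ne st by (metis inv_equality inv_inv inv_closed)
  ultimately have "fix_set (inv t \<otimes> s) = {}" using torus_cent[OF T] block_emptyD by blast
  moreover have "act (inv t \<otimes> s) w = w" using act_mult[of "inv t" s w] st w eq act_inv by simp
  ultimately show False using w unfolding fix_set_def by blast
qed

text \<open>Nonidentity elements of \<open>T\<close> fix no point, so all orbits of \<open>T\<close>
  on the points have size \<open>card T\<close>.\<close>

lemma card_torus_dvd:
  assumes T: "T \<in> tori"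
  shows "card T dvd q\<^sup>2 + 1"
proof -
  let ?o = "\<lambda>w. (\<lambda>t. act t w) ` T"
  have sub: "subgroup T G" by (rule torus_subgroup[OF T])
  have TG: "t \<in> carrier G" if "t \<in> T" for t using torus_subset[OF T] that by blast
  have w_in: "w \<in> ?o w" if "w \<in> \<Omega>" for w
    using imageI[OF subgroup.one_closed[OF sub], of "\<lambda>t. act t w"] act_one[OF that] by simp
  have un: "\<Union> (?o ` \<Omega>) = \<Omega>"
  proof
    show "\<Union> (?o ` \<Omega>) \<subseteq> \<Omega>" using act_in[OF TG] by auto
    show "\<Omega> \<subseteq> \<Union> (?o ` \<Omega>)" using w_in by (meson UN_I subsetI)
  qed
  have "card T dvd card (\<Union> (?o ` \<Omega>))"
  proof (rule dvd_partition)
    show "finite (\<Union> (?o ` \<Omega>))" unfolding un by (rule fin_Omega)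
    show "\<forall>c\<in>?o ` \<Omega>. card T dvd card c"
    proof
      fix c assume "c \<in> ?o ` \<Omega>"
      then obtain w where w: "w \<in> \<Omega>" "c = ?o w" by blast
      have "inj_on (\<lambda>t. act t w) T" using torus_semiregular[OF T _ _ w(1)] by (intro inj_onI) blast
      then show "card T dvd card c" using w by (simp add: card_image)
    qed
    have sub_o: "?o v \<subseteq> ?o w" if vw: "v \<in> \<Omega>" "w \<in> \<Omega>" "s \<in> T" "t \<in> T" "act s v = act t w" for v w s t
    proof
      fix x assume "x \<in> ?o v"
      then obtain a where a: "a \<in> T" "x = act a v" by blast
      have "v = act (inv s) (act t w)" using act_inv[of s v] vw TG by metis
      then have "x = act (a \<otimes> (inv s \<otimes> t)) w" using a vw TG by (simp add: act_mult act_in)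
      moreover have "a \<otimes> (inv s \<otimes> t) \<in> T"
        using sub a vw by (simp add: subgroup.m_closed subgroup.m_inv_closed)
      ultimately show "x \<in> ?o w" by blast
    qed
    show "\<forall>c1\<in>?o ` \<Omega>. \<forall>c2\<in>?o ` \<Omega>. c1 \<noteq> c2 \<longrightarrow> c1 \<inter> c2 = {}"
    proof (intro ballI impI)
      fix c1 c2 assume "c1 \<in> ?o ` \<Omega>" "c2 \<in> ?o ` \<Omega>" and ne: "c1 \<noteq> c2"
      then obtain v w where vw: "v \<in> \<Omega>" "w \<in> \<Omega>" "c1 = ?o v" "c2 = ?o w" by blast
      show "c1 \<inter> c2 = {}"
      proof (rule ccontr)
        assume "c1 \<inter> c2 \<noteq> {}"
        then obtain s t where st: "s \<in> T" "t \<in> T" "act s v = act t w" unfolding vw(3,4) by auto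
        then have "c1 = c2" using sub_o[OF vw(1,2) st] sub_o[OF vw(2,1) st(2,1) st(3)[symmetric]] vw by simp
        then show False using ne by simp
      qed
    qed
  qed
  then show ?thesis unfolding un card_Omega .
qed

lemma torus_prime: "T \<in> tori \<Longrightarrow> prime p \<Longrightarrow> p dvd card T \<Longrightarrow> p \<ge> 5"
  using prime_dvd_ge5 card_torus_dvd dvd_trans by blast

lemma card_torus_gt1: "T \<in> tori \<Longrightarrow> card T > 1"
proof -
  assume T: "T \<in> tori"
  then obtain g where g: "g \<in> block {}" "g \<in> T" by (rule toriE)
  then have "{\<one>, g} \<subseteq> T" "\<one> \<noteq> g" using torus_subgroup[OF T] subgroup.one_closed block_emptyD by auto
  then show ?thesis using card_mono[OF finite_torus[OF T], of "{\<one>, g}"] by simp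
qed

lemma torus_prime_ex: "T \<in> tori \<Longrightarrow> \<exists>p. prime p \<and> p dvd card T"
  using card_torus_gt1[of T] prime_factor_nat[of "card T"] by auto

lemma card_torus_ge5: "T \<in> tori \<Longrightarrow> card T \<ge> 5"
  using torus_prime_ex[of T] torus_prime[of T] card_torus_gt1[of T] dvd_imp_le
  by (metis One_nat_def less_imp_le_nat less_le_trans not_less order_trans zero_less_one)

text \<open>\<open>T\<close> is the centralizer of each of its nonidentity elements, so carrying
  just one of them into \<open>T\<close> already normalizes \<open>T\<close>. This identifies the
  set in \<open>norm_bound\<close>, and the cosets fixed by \<open>z\<close>, with the
  normalizer.\<close>

lemma nrm_eq:
  assumes T: "T \<in> tori" and z: "z \<in> T" "z \<noteq> \<one>"
  shows "{x \<in> carrier G. x \<otimes> z \<otimes> inv x \<in> T} = nrm T"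
proof
  have zT: "z \<in> block {}" "T = cent z" "z \<in> carrier G" using torus_cent[OF T z] z torus_subset[OF T] by auto
  show "{x \<in> carrier G. x \<otimes> z \<otimes> inv x \<in> T} \<subseteq> nrm T"
  proof
    fix x assume "x \<in> {x \<in> carrier G. x \<otimes> z \<otimes> inv x \<in> T}"
    then have x: "x \<in> carrier G" "x \<otimes> z \<otimes> inv x \<in> T" by auto
    then have "T = cent (x \<otimes> z \<otimes> inv x)" using torus_cent[OF T] conj_eq_one_iff z zT by blast
    then have "conj_set x T = T" using cent_conj[OF x(1) zT(3)] zT(2) by simp
    then show "x \<in> nrm T" using x unfolding nrm_def by simp
  qed
  show "nrm T \<subseteq> {x \<in> carrier G. x \<otimes> z \<otimes> inv x \<in> T}"
    using z(1) unfolding nrm_def conj_set_def by blast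
qed

lemma torus_nrm: "T \<in> tori \<Longrightarrow> T \<subseteq> nrm T"
proof
  fix t assume T: "T \<in> tori" and t: "t \<in> T"
  obtain z where z: "z \<in> T" "z \<noteq> \<one>" using toriE[OF T] block_emptyD by metis
  have tz: "t \<in> carrier G" "z \<in> carrier G" using t z torus_subset[OF T] by auto
  have "t \<otimes> z \<otimes> inv t = z" using torus_comm[OF T t z(1)] tz by (simp add: m_assoc)
  then have "t \<in> {x \<in> carrier G. x \<otimes> z \<otimes> inv x \<in> T}" using z tz by simp
  then show "t \<in> nrm T" using nrm_eq[OF T z] by simp
qed

lemma card_nrm:
  assumes T: "T \<in> tori"
  shows "\<exists>m. card (nrm T) = m * card T \<and> 1 \<le> m \<and> m \<le> 4"
proof -
  obtain g where g: "g \<in> block {}" "T = cent g" using toriE[OF T] by metis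
  obtain z p where z: "z \<in> cent g" "z \<noteq> \<one>" "prime p" "p dvd q\<^sup>2 + 1" "z [^] (p::nat) = \<one>"
    using fpf_power[OF g(1)] by metis
  have zT: "z \<in> T" "T = cent z" "z \<in> carrier G" using z torus_cent[OF T] torus_subset[OF T] g by auto
  have "card (nrm T) \<le> 4 * card T"
    using norm_bound[OF z(3,4) zT(3) z(2,5)] nrm_eq[OF T zT(1) z(2)] zT(2) by simp
  moreover obtain m where m: "card (nrm T) = card T * m"
    using subgroup_card_dvd[OF torus_subgroup[OF T] subgroup_nrm[OF torus_subset[OF T]] torus_nrm[OF T] fin] by blast
  moreover have "card (nrm T) > 0"
    using fin subgroup_nrm[OF torus_subset[OF T]] subgroup.one_closed subgroup.subset
    by (metis card_gt_0_iff empty_iff finite_subset)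
  moreover have "card T > 0" using card_torus_gt1[OF T] by simp
  ultimately show ?thesis by (intro exI[of _ m]) (auto simp: mult.commute)
qed

section \<open>The action of a torus element on the cosets of a torus\<close>

lemma rcos_eq_iff:
  assumes "subgroup T G" "x \<in> carrier G" "y \<in> carrier G"
  shows "T #> x = T #> y \<longleftrightarrow> x \<otimes> inv y \<in> T"
proof
  have TG: "T \<subseteq> carrier G" by (rule subgroup.subset[OF assms(1)])
  have xy: "x \<otimes> inv y \<in> carrier G" using assms by simp
  show "x \<otimes> inv y \<in> T" if "T #> x = T #> y"
    using coset_join1[OF _ xy assms(1)] coset_mult_inv2[OF that assms(2,3) TG] by blast
  show "T #> x = T #> y" if "x \<otimes> inv y \<in> T"
    using coset_mult_inv1[OF coset_join2[OF xy assms(1) that] assms(2,3) TG] .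
qed

lemma rcos_fixed:
  assumes T: "subgroup T G" and x: "x \<in> carrier G" "z \<in> carrier G"
  shows "(T #> x) #> z = T #> x \<longleftrightarrow> x \<otimes> z \<otimes> inv x \<in> T"
  using rcos_eq_iff[OF T, of "x \<otimes> z" x] x coset_mult_assoc[of T x z] subgroup.subset[OF T] by simp

lemma card_rcosets_cong:
  assumes T: "subgroup T G" and z: "z \<in> carrier G" "z [^] p = \<one>" and p: "prime p"
  shows "[card (rcosets T) = card {C \<in> rcosets T. C #> z = C}] (mod p)"
proof (rule card_fixed_points_cong[OF _ p])
  have TG: "T \<subseteq> carrier G" using T subgroup.subset by blast
  show "finite (rcosets T)" using fin unfolding RCOSETS_def by simp
  fix C assume "C \<in> rcosets T"
  then obtain x where x: "x \<in> carrier G" "C = T #> x" unfolding RCOSETS_def by blast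
  then show "C #> z \<in> rcosets T" using z TG coset_mult_assoc[OF TG] unfolding RCOSETS_def by auto
  have "((\<lambda>C. C #> z) ^^ k) C = C #> (z [^] k)" for k
  proof (induction k)
    case 0
    show ?case using x TG by (simp add: coset_mult_assoc)
  next
    case (Suc k)
    then show ?case using x TG z by (simp add: coset_mult_assoc m_assoc)
  qed
  then show "((\<lambda>C. C #> z) ^^ p) C = C" using z x TG by (simp add: coset_mult_assoc)
qed

lemma card_fixed_cosets:
  assumes T: "T \<in> tori" and z: "z \<in> T" "z \<noteq> \<one>"
  shows "card {C \<in> rcosets T. C #> z = C} * card T = card (nrm T)"
proof -
  have sub: "subgroup T G" by (rule torus_subgroup[OF T])
  have zc: "z \<in> carrier G" using z torus_subset[OF T] by blast
  have "{C \<in> rcosets T. C #> z = C} = (\<lambda>x. T #> x) ` nrm T"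
    unfolding nrm_eq[OF T z, symmetric] RCOSETS_def using rcos_fixed[OF sub _ zc] by auto
  moreover have "card ((\<lambda>x. T #> x) ` nrm T) * card T = card (nrm T)"
  proof (rule card_image_fibres)
    show "finite (nrm T)" using fin unfolding nrm_def by simp
    fix x assume x: "x \<in> nrm T"
    then have xc: "x \<in> carrier G" unfolding nrm_def by simp
    have "{y \<in> nrm T. T #> y = T #> x} = (\<lambda>t. t \<otimes> x) ` T"
    proof
      show "(\<lambda>t. t \<otimes> x) ` T \<subseteq> {y \<in> nrm T. T #> y = T #> x}"
      proof (rule image_subsetI)
        fix t assume t: "t \<in> T"
        then have tc: "t \<in> carrier G" using torus_subset[OF T] by blast
        have "t \<otimes> x \<in> nrm T"
          using subgroup.m_closed[OF subgroup_nrm[OF torus_subset[OF T]]] x t torus_nrm[OF T] by blast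
        moreover have "T #> (t \<otimes> x) = T #> x"
          using rcos_eq_iff[OF sub, of "t \<otimes> x" x] t tc xc by (simp add: m_assoc)
        ultimately show "t \<otimes> x \<in> {y \<in> nrm T. T #> y = T #> x}" by blast
      qed
      show "{y \<in> nrm T. T #> y = T #> x} \<subseteq> (\<lambda>t. t \<otimes> x) ` T"
      proof
        fix y assume y: "y \<in> {y \<in> nrm T. T #> y = T #> x}"
        then have yc: "y \<in> carrier G" unfolding nrm_def by simp
        have "y \<otimes> inv x \<in> T" using rcos_eq_iff[OF sub yc xc] y by simp
        moreover have "y = (y \<otimes> inv x) \<otimes> x" using xc yc by (simp add: m_assoc)
        ultimately show "y \<in> (\<lambda>t. t \<otimes> x) ` T" by blast
      qed
    qed
    moreover have "inj_on (\<lambda>t. t \<otimes> x) T" using xc torus_subset[OF T] by (intro inj_onI) (metis right_cancel subsetD)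
    ultimately show "card {y \<in> nrm T. T #> y = T #> x} = card T" by (simp add: card_image)
  qed
  ultimately show ?thesis by simp
qed

text \<open>The index is congruent to \<open>m\<close>, which lies between 1 and 4, while the prime
  is at least 5.\<close>

lemma prime_not_dvd_index:
  assumes T: "T \<in> tori" and p: "prime p" "p dvd card T"
  shows "\<not> p dvd card (rcosets T)"
proof
  assume pd: "p dvd card (rcosets T)"
  obtain z where z: "z \<in> T" "z \<noteq> \<one>" "z [^] p = \<one>" using cauchy[OF torus_subgroup[OF T] fin p] by blast
  obtain m where m: "card (nrm T) = m * card T" "1 \<le> m" "m \<le> 4" using card_nrm[OF T] by blast
  have "card {C \<in> rcosets T. C #> z = C} = m"
    using card_fixed_cosets[OF T z(1,2)] m card_torus_gt1[OF T] by simp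
  moreover have "z \<in> carrier G" using z torus_subset[OF T] by blast
  ultimately have "[card (rcosets T) = m] (mod p)"
    using card_rcosets_cong[OF torus_subgroup[OF T] _ z(3) p(1)] by metis
  then have "p dvd m" using pd cong_dvd_iff by blast
  then have "p \<le> m" using m(2) by (intro dvd_imp_le) auto
  then show False using m torus_prime[OF T p] by linarith
qed

lemma card_rcosets: "T \<in> tori \<Longrightarrow> card (rcosets T) * card T = q\<^sup>2 * (q\<^sup>2 + 1) * (q - 1)"
  using lagrange[OF torus_subgroup] card_carrier unfolding order_def by simp

text \<open>\<open>e\<close> divides the index of \<open>T\<close>, because
  \<open>q\<^sup>2 + 1\<close> divides the group order.\<close>

lemma prime_not_dvd_cofactor:
  assumes T: "T \<in> tori" and p: "prime p" "p dvd card T" and e: "q\<^sup>2 + 1 = card T * e"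
  shows "\<not> p dvd e"
proof
  assume "p dvd e"
  moreover have "card T * card (rcosets T) = card T * (e * (q\<^sup>2 * (q - 1)))"
    using card_rcosets[OF T] unfolding e by (simp add: mult_ac)
  then have "card (rcosets T) = e * (q\<^sup>2 * (q - 1))"
    using card_torus_gt1[OF T] by (subst (asm) mult_cancel1) auto
  ultimately show False using prime_not_dvd_index[OF T p] by simp
qed

definition torus_class :: "'a set \<Rightarrow> 'a set set" where
  "torus_class T = (\<lambda>x. conj_set x T) ` carrier G"

text \<open>A Sylow-type argument: an element \<open>z\<close> of order \<open>p\<close> in
  \<open>T'\<close> acts on the cosets of \<open>T\<close>, whose number is prime to
  \<open>p\<close>, and so fixes one. This conjugates \<open>z\<close> into \<open>T\<close>, and
  both tori are recovered as centralizers.\<close>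

lemma torus_conj:
  assumes T: "T \<in> tori" and T': "T' \<in> tori" and p: "prime p" "p dvd card T" "p dvd card T'"
  shows "T' \<in> torus_class T"
proof -
  have sub: "subgroup T G" by (rule torus_subgroup[OF T])
  obtain z where z: "z \<in> T'" "z \<noteq> \<one>" "z [^] p = \<one>" using cauchy[OF torus_subgroup[OF T'] fin p(1,3)] by blast
  have zc: "z \<in> carrier G" using z torus_subset[OF T'] by blast
  have "[card (rcosets T) = card {C \<in> rcosets T. C #> z = C}] (mod p)"
    by (rule card_rcosets_cong[OF sub zc z(3) p(1)])
  then have "\<not> p dvd card {C \<in> rcosets T. C #> z = C}"
    using prime_not_dvd_index[OF T p(1,2)] cong_dvd_iff by blast
  then have "{C \<in> rcosets T. C #> z = C} \<noteq> {}" by (metis card.empty dvd_0_right)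
  then obtain x where x: "x \<in> carrier G" "(T #> x) #> z = T #> x" unfolding RCOSETS_def by blast
  then have "x \<otimes> z \<otimes> inv x \<in> T" using rcos_fixed[OF sub x(1) zc] by blast
  then have "T = cent (x \<otimes> z \<otimes> inv x)" using torus_cent[OF T] conj_eq_one_iff[OF x(1) zc] z by blast
  also have "\<dots> = conj_set x T'" using cent_conj[OF x(1) zc] torus_cent[OF T' z(1,2)] by simp
  finally have "conj_set (inv x) T = T'"
    using conj_set_conj_set[of "inv x" x T'] x torus_subset[OF T'] conj_set_one by simp
  then show ?thesis unfolding torus_class_def using x by blast
qed

lemma torus_class_subset: "T \<in> tori \<Longrightarrow> torus_class T \<subseteq> tori"
proof -
  assume "T \<in> tori"
  then obtain g where g: "g \<in> block {}" "T = cent g" using toriE by metis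
  have "conj_set x T \<in> tori" if x: "x \<in> carrier G" for x
  proof -
    have "x \<otimes> g \<otimes> inv x \<in> block {}" using block_conj[OF x, of "{}"] g by auto
    moreover have "conj_set x T = cent (x \<otimes> g \<otimes> inv x)"
      using cent_conj[OF x] g block_emptyD by simp
    ultimately show ?thesis unfolding tori_def by (metis imageI)
  qed
  then show ?thesis unfolding torus_class_def by blast
qed

lemma torus_class_self: "T \<in> tori \<Longrightarrow> T \<in> torus_class T"
  unfolding torus_class_def using conj_set_one[OF torus_subset] by (metis imageI one_closed)

lemma torus_class_card: "T \<in> tori \<Longrightarrow> T' \<in> torus_class T \<Longrightarrow> card T' = card T"
  unfolding torus_class_def using card_conj_set torus_subset by auto

lemma card_torus_class:
  assumes T: "T \<in> tori"
  shows "\<exists>m. card (torus_class T) * m * card T = q\<^sup>2 * (q\<^sup>2 + 1) * (q - 1) \<and> 1 \<le> m \<and> m \<le> 4"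
proof -
  obtain m where m: "card (nrm T) = m * card T" "1 \<le> m" "m \<le> 4" using card_nrm[OF T] by blast
  then show ?thesis
    using card_conj_class[OF fin torus_subset[OF T]] card_carrier unfolding torus_class_def
    by (intro exI[of _ m]) simp
qed

text \<open>An element of order \<open>p\<close> has at most two fixed points, while their number is
  divisible by \<open>p\<close>, which is at least 5. So there are none, and its centralizer is the
  required torus.\<close>

lemma torus_exists:
  assumes p: "prime p" "p dvd q\<^sup>2 + 1"
  shows "\<exists>T\<in>tori. p dvd card T"
proof -
  have "p dvd card (carrier G)" using p(2) unfolding card_carrier by (intro dvd_mult dvd_mult2)
  then obtain z where z: "z \<in> carrier G" "z \<noteq> \<one>" "z [^] p = \<one>"
    using cauchy[OF subgroup_self fin p(1)] by blast
  have "[q\<^sup>2 + 1 = card (fix_set z)] (mod p)" by (rule card_Omega_cong[OF z(1,3) p(1)])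
  then have "p dvd card (fix_set z)" using p(2) cong_dvd_iff by blast
  moreover have "card (fix_set z) \<le> 2" using z(1,2) by (cases rule: fix_set_cases) auto
  ultimately have "card (fix_set z) = 0"
    using prime_dvd_ge5[OF p] dvd_imp_le[of p "card (fix_set z)"] by linarith
  then have zb: "z \<in> block {}" using z fin_Omega finite_subset[OF fix_set_subset] unfolding block_def by auto
  then have T: "cent z \<in> tori" unfolding tori_def by blast
  interpret T: group "G\<lparr>carrier := cent z\<rparr>" using torus_subgroup[OF T] by (rule subgroup_imp_group)
  have "z [^]\<^bsub>G\<lparr>carrier := cent z\<rparr>\<^esub> card (cent z) = \<one>"
    using T.pow_order_eq_1[of z] self_cent[OF z(1)] by (simp add: order_def)
  then have "z [^] card (cent z) = \<one>" using nat_pow_consistent by metis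
  then have "ord z dvd card (cent z)" using pow_eq_id z by blast
  moreover have "ord z dvd p" using pow_eq_id z by blast
  then have "ord z = p" using p(1) ord_eq_1[OF z(1)] z(2) by (auto simp: prime_nat_iff)
  ultimately show ?thesis using T by blast
qed

lemma card_block_empty_tori: "card (block {}) = (\<Sum>T\<in>tori. card T - 1)"
proof -
  have "card (block {}) = (\<Sum>T\<in>tori. card (T - {\<one>}))"
    unfolding block_empty_tori
  proof (rule card_UN_disjoint[OF finite_tori])
    show "\<forall>T\<in>tori. finite (T - {\<one>})" using finite_torus by blast
    show "\<forall>T\<in>tori. \<forall>T'\<in>tori. T \<noteq> T' \<longrightarrow> (T - {\<one>}) \<inter> (T' - {\<one>}) = {}"
      using torus_disjoint by blast
  qed
  also have "\<dots> = (\<Sum>T\<in>tori. card T - 1)"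
    by (rule sum.cong[OF refl]) (rule card_Diff_singleton[OF subgroup.one_closed[OF torus_subgroup]])
  finally show ?thesis .
qed

lemma card_forests_block_empty:
  "card (forests (block {}) comm {\<one>}) = (\<Prod>T\<in>tori. card T ^ (card T - 2))"
proof -
  have "card (forests (block {}) comm {\<one>}) = (\<Prod>T\<in>tori. card (forests (T - {\<one>}) comm {\<one>}))"
    unfolding block_empty_tori
  proof (rule card_forests_UN[OF finite_tori])
    show "(T - {\<one>}) \<inter> (T' - {\<one>}) = {}" if "T \<in> tori" "T' \<in> tori" "T \<noteq> T'" for T T'
      using that torus_disjoint by blast
    show "(T - {\<one>}) \<inter> {\<one>} = {}" for T by blast
    show "\<not> comm v w" if T: "T \<in> tori" "T' \<in> tori" "T \<noteq> T'" "v \<in> T - {\<one>}" "w \<in> T' - {\<one>}" for T T' v w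
    proof
      assume c: "comm v w"
      have "T = cent v" using torus_cent[of T v] T by blast
      moreover have "w \<in> carrier G" using T torus_subset by blast
      ultimately have "w \<in> T" using c unfolding cent_def by simp
      then show False using torus_disjoint[of T T' w] T by blast
    qed
  qed
  also have "\<dots> = (\<Prod>T\<in>tori. card T ^ (card T - 2))"
  proof (rule prod.cong[OF refl])
    fix T assume T: "T \<in> tori"
    have one: "\<one> \<in> T" using torus_subgroup[OF T] subgroup.one_closed by blast
    have cT: "card (T - {\<one>}) = card T - 1" using one by (simp add: card_Diff_singleton)
    have "card (forests (T - {\<one>}) comm {\<one>})
       = card {\<one>} * (card {\<one>} + card (T - {\<one>})) ^ (card (T - {\<one>}) - 1)"
    proof (rule card_forests_complete)
      show "finite (T - {\<one>})" using finite_torus[OF T] by simp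
      show "T - {\<one>} \<noteq> {}" using cT card_torus_gt1[OF T] by (metis card.empty diff_is_0_eq not_less)
      show "comm u v" if "u \<in> T - {\<one>}" "v \<in> T - {\<one>}" for u v using that torus_comm[OF T] by blast
    qed auto
    then show "card (forests (T - {\<one>}) comm {\<one>}) = card T ^ (card T - 2)"
      using cT card_torus_gt1[OF T] by (simp add: numeral_2_eq_2)
  qed
  finally show ?thesis .
qed

end

section \<open>Exactly two conjugacy classes of tori\<close>

context suzuki_action
begin

lemma torus_class_disjoint:
  assumes "T \<in> tori" "T' \<in> tori" "p dvd card T" "\<not> p dvd card T'"
  shows "torus_class T \<inter> torus_class T' = {}"
  using torus_class_card[OF assms(1)] torus_class_card[OF assms(2)] assms(3,4) by fastforce

lemma finite_torus_class: "T \<in> tori \<Longrightarrow> finite (torus_class T)"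
  using torus_class_subset finite_tori finite_subset by blast

lemma torus_class_sum:
  "T \<in> tori \<Longrightarrow> (\<Sum>S\<in>torus_class T. card S - 1) = card (torus_class T) * (card T - 1)"
  using torus_class_card[of T] by simp

text \<open>An index of at most 4 and an order u of at least 5 give m u \<le> 5(u - 1).\<close>

lemma torus_class_lower:
  assumes T: "T \<in> tori"
  shows "q\<^sup>2 * (q\<^sup>2 + 1) * (q - 1) \<le> 5 * (card (torus_class T) * (card T - 1))"
proof -
  obtain m where m: "card (torus_class T) * m * card T = q\<^sup>2 * (q\<^sup>2 + 1) * (q - 1)" "m \<le> 4"
    using card_torus_class[OF T] by blast
  have "m * card T \<le> 4 * card T" using m by simp
  also have "\<dots> \<le> 5 * (card T - 1)" using card_torus_ge5[OF T] by linarith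
  finally have "card (torus_class T) * (m * card T) \<le> card (torus_class T) * (5 * (card T - 1))" by (rule mult_le_mono2)
  then show ?thesis unfolding m(1)[symmetric] by (simp only: mult_ac)
qed

lemma tori_two_classes:
  assumes qn: "q = 2 ^ (2 * n + 1)" and r: "r = 2 ^ (n + 1)"
  obtains T1 T2 where "T1 \<in> tori" "T2 \<in> tori" "tori = torus_class T1 \<union> torus_class T2"
    "torus_class T1 \<inter> torus_class T2 = {}"
    "card T1 = q - r + 1" "card T2 = q + r + 1"
    "4 * card (torus_class T1) = q\<^sup>2 * (q - 1) * (q + r + 1)"
    "4 * card (torus_class T2) = q\<^sup>2 * (q - 1) * (q - r + 1)"
proof -
  let ?c = "\<lambda>T. card (torus_class T)"
  have "q\<^sup>2 + 1 \<noteq> 1" using q8 by simp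
  then obtain p1 where p1: "prime p1" "p1 dvd q\<^sup>2 + 1" using prime_factor_nat by blast
  then obtain T1 where T1: "T1 \<in> tori" using torus_exists by blast
  obtain e where e: "q\<^sup>2 + 1 = card T1 * e" using card_torus_dvd[OF T1] by blast
  \<comment> \<open>Otherwise \<open>T1\<close> would absorb every prime of
    \<open>q\<^sup>2 + 1\<close>, and there would be a single class.\<close>
  have "e \<noteq> 1"
  proof
    assume "e = 1"
    then have u1: "card T1 = q\<^sup>2 + 1" using e by simp
    have "tori = torus_class T1"
    proof
      show "tori \<subseteq> torus_class T1"
      proof
        fix T assume T: "T \<in> tori"
        then obtain p where p: "prime p" "p dvd card T" using torus_prime_ex by blast
        then have "p dvd card T1" using card_torus_dvd[OF T] u1 dvd_trans by metis
        then show "T \<in> torus_class T1" using torus_conj[OF T1 T p(1) _ p(2)] by blast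
      qed
    qed (rule torus_class_subset[OF T1])
    then have "card (block {}) = ?c T1 * (q\<^sup>2 + 1 - 1)"
      using card_block_empty_tori torus_class_sum[OF T1] u1 by simp
    then have tot: "2 * (?c T1 * (q\<^sup>2 + 1 - 1)) = q ^ 3 * (q - 1)\<^sup>2" using card_block_empty by simp
    obtain m where m: "?c T1 * m * card T1 = q\<^sup>2 * (q\<^sup>2 + 1) * (q - 1)" "1 \<le> m" "m \<le> 4"
      using card_torus_class[OF T1] by blast
    have "(q\<^sup>2 + 1) * (?c T1 * m) = (q\<^sup>2 + 1) * (q\<^sup>2 * (q - 1))"
      using m(1) unfolding u1 by (simp only: mult_ac)
    then have "?c T1 * m = q\<^sup>2 * (q - 1)" by (subst (asm) mult_cancel1) auto
    then show False using torus_single_impossible[OF q8 m(2,3) _ tot] by blast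
  qed
  then obtain p2 where p2: "prime p2" "p2 dvd e" using prime_factor_nat by blast
  have p2q: "p2 dvd q\<^sup>2 + 1" using p2 unfolding e by simp
  obtain T2 where T2: "T2 \<in> tori" "p2 dvd card T2" using torus_exists[OF p2(1) p2q] by blast
  have np2: "\<not> p2 dvd card T1" using prime_not_dvd_cofactor[OF T1 p2(1) _ e] p2 by blast
  have disj: "torus_class T1 \<inter> torus_class T2 = {}"
    using torus_class_disjoint[OF T2(1) T1 T2(2) np2] by blast
  have "coprime (card T1) (card T2)"
  proof (rule ccontr)
    assume "\<not> coprime (card T1) (card T2)"
    then obtain s where s: "prime s" "s dvd card T1" "s dvd card T2"
      using coprime_iff_gcd_eq_1 prime_factor_nat by (metis dvd_gcdD1 dvd_gcdD2)
    then have "T2 \<in> torus_class T1" using torus_conj[OF T1 T2(1)] by blast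
    then show False using torus_class_self[OF T2(1)] disj by blast
  qed
  then obtain h where h: "q\<^sup>2 + 1 = card T1 * card T2 * h"
    using divides_mult[OF card_torus_dvd[OF T1] card_torus_dvd[OF T2(1)]] by blast
  \<comment> \<open>A prime left over would produce a third class, disjoint from the two already
    found.\<close>
  have "h = 1"
  proof (rule ccontr)
    assume "h \<noteq> 1"
    then obtain s where s: "prime s" "s dvd h" using prime_factor_nat by blast
    have "s dvd q\<^sup>2 + 1" using s unfolding h by simp
    then obtain T3 where T3: "T3 \<in> tori" "s dvd card T3" using torus_exists[OF s(1)] by blast
    have ns: "\<not> s dvd card T1" "\<not> s dvd card T2"
      using prime_not_dvd_cofactor[OF T1 s(1), of "card T2 * h"]
        prime_not_dvd_cofactor[OF T2(1) s(1), of "card T1 * h"] h s by (auto simp: mult_ac)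
    have d: "torus_class T3 \<inter> torus_class T1 = {}" "torus_class T3 \<inter> torus_class T2 = {}"
      using torus_class_disjoint[OF T3(1) T1 T3(2) ns(1)] torus_class_disjoint[OF T3(1) T2(1) T3(2) ns(2)] .
    have "(\<Sum>S\<in>torus_class T3 \<union> (torus_class T1 \<union> torus_class T2). card S - 1) \<le> (\<Sum>S\<in>tori. card S - 1)"
      using torus_class_subset[OF T1] torus_class_subset[OF T2(1)] torus_class_subset[OF T3(1)] finite_tori
      by (intro sum_mono2) auto
    moreover have "(\<Sum>S\<in>torus_class T3 \<union> (torus_class T1 \<union> torus_class T2). card S - 1)
       = (\<Sum>S\<in>torus_class T3. card S - 1)
         + ((\<Sum>S\<in>torus_class T1. card S - 1) + (\<Sum>S\<in>torus_class T2. card S - 1))"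
    proof -
      have "torus_class T3 \<inter> (torus_class T1 \<union> torus_class T2) = {}" using d by blast
      then show ?thesis
        using finite_torus_class T1 T2(1) T3(1) disj by (simp add: sum.union_disjoint)
    qed
    ultimately have "2 * (?c T3 * (card T3 - 1) + ?c T1 * (card T1 - 1) + ?c T2 * (card T2 - 1))
        \<le> q ^ 3 * (q - 1)\<^sup>2"
      using card_block_empty card_block_empty_tori torus_class_sum T1 T2(1) T3(1) by simp
    moreover have "3 * (q\<^sup>2 * (q\<^sup>2 + 1) * (q - 1))
        \<le> 5 * (?c T3 * (card T3 - 1) + ?c T1 * (card T1 - 1) + ?c T2 * (card T2 - 1))"
    proof -
      have "3 * g \<le> 5 * (z + x + y)" if "g \<le> 5 * x" "g \<le> 5 * y" "g \<le> 5 * z" for g x y z :: nat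
        using that by simp
      then show ?thesis
        using torus_class_lower[OF T1] torus_class_lower[OF T2(1)] torus_class_lower[OF T3(1)] by blast
    qed
    ultimately show False using torus_triple_impossible[OF q8 refl] by blast
  qed
  then have prod: "card T1 * card T2 = q\<^sup>2 + 1" using h by simp
  have tori_eq: "tori = torus_class T1 \<union> torus_class T2"
  proof
    show "tori \<subseteq> torus_class T1 \<union> torus_class T2"
    proof
      fix T assume T: "T \<in> tori"
      then obtain p where p: "prime p" "p dvd card T" using torus_prime_ex by blast
      then have "p dvd card T1 * card T2" using card_torus_dvd[OF T] prod dvd_trans by metis
      then have "p dvd card T1 \<or> p dvd card T2" using p(1) prime_dvd_mult_nat by blast
      then show "T \<in> torus_class T1 \<union> torus_class T2"
        using torus_conj[OF T1 T p(1) _ p(2)] torus_conj[OF T2(1) T p(1) _ p(2)] by blast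
    qed
  qed (use torus_class_subset T1 T2 in blast)
  have "card (block {}) = ?c T1 * (card T1 - 1) + ?c T2 * (card T2 - 1)"
    unfolding card_block_empty_tori
    by (subst tori_eq)
      (simp only: sum.union_disjoint[OF finite_torus_class[OF T1] finite_torus_class[OF T2(1)] disj]
        torus_class_sum[OF T1] torus_class_sum[OF T2(1)])
  then have tot: "2 * (?c T1 * (card T1 - 1) + ?c T2 * (card T2 - 1)) = q ^ 3 * (q - 1)\<^sup>2"
    using card_block_empty by simp
  obtain m1 where m1: "?c T1 * m1 * card T1 = q\<^sup>2 * (q\<^sup>2 + 1) * (q - 1)" "1 \<le> m1" "m1 \<le> 4"
    using card_torus_class[OF T1] by blast
  obtain m2 where m2: "?c T2 * m2 * card T2 = q\<^sup>2 * (q\<^sup>2 + 1) * (q - 1)" "1 \<le> m2" "m2 \<le> 4"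
    using card_torus_class[OF T2(1)] by blast
  have "card T1 * (?c T1 * m1) = card T1 * (q\<^sup>2 * (q - 1) * card T2)"
    using m1(1) unfolding prod[symmetric] by (simp only: mult_ac)
  then have c1: "?c T1 * m1 = q\<^sup>2 * (q - 1) * card T2"
    using card_torus_gt1[OF T1] by (subst (asm) mult_cancel1) auto
  have "card T2 * (?c T2 * m2) = card T2 * (q\<^sup>2 * (q - 1) * card T1)"
    using m2(1) unfolding prod[symmetric] by (simp only: mult_ac)
  then have c2: "?c T2 * m2 = q\<^sup>2 * (q - 1) * card T1"
    using card_torus_gt1[OF T2(1)] by (subst (asm) mult_cancel1) auto
  have res: "m1 = 4 \<and> m2 = 4 \<and> card T1 + card T2 = 2 * q + 2"
    using torus_count_identity[OF q8 prod card_torus_ge5[OF T1] card_torus_ge5[OF T2(1)] m1(2,3) m2(2,3) c1 c2 tot] .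
  have c1': "4 * ?c T1 = q\<^sup>2 * (q - 1) * card T2" and c2': "4 * ?c T2 = q\<^sup>2 * (q - 1) * card T1"
    using c1 c2 res by (simp_all add: mult.commute)
  have "card T1 + card T2 = 2 * q + 2" using res by blast
  \<comment> \<open>The equations are symmetric and do not tell which torus is the smaller one, so
    the roles may have to be exchanged.\<close>
  from torus_orders[OF qn r prod this] show thesis
  proof
    assume u: "card T1 = q - r + 1 \<and> card T2 = q + r + 1"
    show thesis
      by (rule that[OF T1 T2(1) tori_eq disj]) (use u c1' c2' in simp_all)
  next
    assume u: "card T1 = q + r + 1 \<and> card T2 = q - r + 1"
    show thesis
    proof (rule that[OF T2(1) T1])
      show "tori = torus_class T2 \<union> torus_class T1" using tori_eq by blast
      show "torus_class T2 \<inter> torus_class T1 = {}" using disj by blast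
    qed (use u c1' c2' in simp_all)
  qed
qed

theorem card_forests_suzuki_action:
  assumes qn: "q = 2 ^ (2 * n + 1)" and r: "r = 2 ^ (n + 1)"
  shows "card (forests (carrier G - {\<one>}) comm {\<one>})
    = KU ^ (q\<^sup>2 + 1) * (q - 1) ^ ((q - 3) * (q\<^sup>2 * (q\<^sup>2 + 1) div 2))
      * (q - r + 1) ^ ((q - r + 1 - 2) * (q\<^sup>2 * (q - 1) * (q + r + 1) div 4))
      * (q + r + 1) ^ ((q + r + 1 - 2) * (q\<^sup>2 * (q - 1) * (q - r + 1) div 4))"
proof -
  obtain T1 T2 where T: "T1 \<in> tori" "T2 \<in> tori" "tori = torus_class T1 \<union> torus_class T2"
    "torus_class T1 \<inter> torus_class T2 = {}"
    "card T1 = q - r + 1" "card T2 = q + r + 1"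
    "4 * card (torus_class T1) = q\<^sup>2 * (q - 1) * (q + r + 1)"
    "4 * card (torus_class T2) = q\<^sup>2 * (q - 1) * (q - r + 1)"
    using tori_two_classes[OF qn r] by metis
  have cls: "(\<Prod>S\<in>torus_class T. card S ^ (card S - 2)) = card T ^ ((card T - 2) * card (torus_class T))"
    if "T \<in> tori" for T
    using torus_class_card[OF that] by (simp add: power_mult)
  have "(\<Prod>S\<in>tori. card S ^ (card S - 2))
      = card T1 ^ ((card T1 - 2) * card (torus_class T1)) * card T2 ^ ((card T2 - 2) * card (torus_class T2))"
    by (subst T(3)) (simp only: prod.union_disjoint[OF finite_torus_class[OF T(1)] finite_torus_class[OF T(2)] T(4)] cls T(1,2))
  moreover have "card (torus_class T1) = q\<^sup>2 * (q - 1) * (q + r + 1) div 4"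
    "card (torus_class T2) = q\<^sup>2 * (q - 1) * (q - r + 1) div 4"
    unfolding T(7,8)[symmetric] by simp_all
  moreover have "card pairs = q\<^sup>2 * (q\<^sup>2 + 1) div 2" using card_pairs by (simp add: mult.commute)
  ultimately show ?thesis
    unfolding card_forests_carrier card_forests_block_empty
    by (simp only: T(5,6) power_mult[symmetric] mult_ac)
qed

end

section \<open>Matrices of prime order dividing the square of the field size plus one\<close>

text \<open>Modulo \<open>p\<close> the square of q is -1, so q has order 4. For e = 1, 2, 3 the
  number 2 is an explicit integer combination of \<open>q\<^sup>2 + 1\<close> and
  \<open>q ^ e - 1\<close>.\<close>

lemma prime_dvd_square_plus_one_cong:
  fixes p q :: nat
  assumes p: "prime p" "p \<noteq> 2" "p dvd q\<^sup>2 + 1" and e: "e \<le> 3" "[q ^ e = 1] (mod p)"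
  shows "e = 0"
proof (rule ccontr)
  assume "e \<noteq> 0"
  then consider "e = 1" | "e = 2" | "e = 3" using e by linarith
  moreover have d: "int p dvd (int q)\<^sup>2 + 1" using p(3) by (metis of_nat_1 of_nat_add of_nat_dvd_iff of_nat_power)
  have de: "int p dvd int q ^ e - 1"
    using e(2) by (metis cong_iff_dvd_diff cong_int_iff of_nat_1 of_nat_power)
  ultimately have "int p dvd 2"
  proof cases
    case 1
    have "int p dvd ((int q)\<^sup>2 + 1) - (int q + 1) * (int q ^ e - 1)" 
      by (rule dvd_diff[OF d dvd_mult[OF de]])
    then show ?thesis using 1 by (simp add: power2_eq_square algebra_simps)
  next
    case 2
    have "int p dvd ((int q)\<^sup>2 + 1) - (int q ^ e - 1)" 
      by (rule dvd_diff[OF d de])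
    then show ?thesis using 2 by simp
  next
    case 3
    have "int p dvd ((int q)\<^sup>2 + 1) - (int q - 1) * (int q * ((int q)\<^sup>2 + 1) - (int q ^ e - 1))"
      by (rule dvd_diff[OF d dvd_mult[OF dvd_diff[OF dvd_mult[OF d] de]]])
    then show ?thesis using 3 by (simp add: power2_eq_square power3_eq_cube algebra_simps)
  qed
  then have "p dvd 2" by (metis of_nat_dvd_iff of_nat_numeral)
  then show False using p primes_dvd_imp_eq two_is_prime_nat by blast
qed

text \<open>Each basis vector multiplies the size of the span by the size of the field.\<close>

lemma card_vec_subspace:
  fixes W :: "('F::{field,finite} ^ 'n) set"
  assumes "vec.subspace W"
  shows "\<exists>d. card W = CARD('F) ^ d"
proof -
  have *: "card (vec.span B) = CARD('F) ^ card B" if "finite B" "vec.independent B" for B :: "('F ^ 'n) set"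
    using that
  proof (induction B rule: finite_induct)
    case empty
    then show ?case by simp
  next
    case (insert b B)
    have ind: "vec.independent B" "b \<notin> vec.span B"
      using insert.prems insert.hyps by (simp_all add: vec.independent_insert)
    let ?f = "\<lambda>(c, s). c *s b + s"
    have "vec.span (insert b B) = ?f ` (UNIV \<times> vec.span B)"
    proof
      show "vec.span (insert b B) \<subseteq> ?f ` (UNIV \<times> vec.span B)"
      proof
        fix x assume "x \<in> vec.span (insert b B)"
        then obtain k where k: "x - k *s b \<in> vec.span B" by (auto simp: vec.span_insert)
        show "x \<in> ?f ` (UNIV \<times> vec.span B)"
          by (rule image_eqI[of _ _ "(k, x - k *s b)"]) (use k in auto)
      qed
      show "?f ` (UNIV \<times> vec.span B) \<subseteq> vec.span (insert b B)"
      proof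
        fix x assume "x \<in> ?f ` (UNIV \<times> vec.span B)"
        then obtain c s where "x = c *s b + s" "s \<in> vec.span B" by auto
        then have "x - c *s b \<in> vec.span B" by simp
        then show "x \<in> vec.span (insert b B)" unfolding vec.span_insert by blast
      qed
    qed
    moreover have "inj_on ?f (UNIV \<times> vec.span B)"
    proof (rule inj_onI, clarsimp)
      fix c s c' s' assume s: "s \<in> vec.span B" "s' \<in> vec.span B" "c *s b + s = c' *s b + s'"
      have "c = c'"
      proof (rule ccontr)
        assume ne: "c \<noteq> c'"
        have "(c - c') *s b = s' - s" using s(3) by (simp add: vec.scale_left_diff_distrib algebra_simps)
        then have "(c - c') *s b \<in> vec.span B" using s vec.span_diff by metis
        then have "inverse (c - c') *s ((c - c') *s b) \<in> vec.span B" by (rule vec.span_scale)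
        moreover have "inverse (c - c') * (c - c') = 1" using ne by simp
        ultimately show False using ind(2) by (simp only: vector_smult_assoc vector_smult_lid)
      qed
      then show "c = c' \<and> s = s'" using s(3) by simp
    qed
    ultimately have "card (vec.span (insert b B)) = card (UNIV \<times> vec.span B :: ('F \<times> _) set)"
      by (simp add: card_image)
    then show ?case using insert.IH[OF ind(1)] insert.hyps by (simp add: card_cartesian_product)
  qed
  obtain B where B: "B \<subseteq> W" "vec.independent B" "W \<subseteq> vec.span B"
    using vec.maximal_independent_subset by blast
  then have "vec.span B = W" using assms by (simp add: vec.span_minimal subset_antisym)
  then show ?thesis using *[of B] B finite[of B] by metis
qed

text \<open>The period is expressed by iterating the linear map, the form in which the orbit count
  applies; no group is involved.\<close>

locale prime_order_matrix =
  fixes z :: "'F::{field,finite} ^ 4 ^ 4" and p :: nat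
  assumes prime: "prime p" and p2: "p \<noteq> 2" and pdvd: "p dvd CARD('F)\<^sup>2 + 1"
    and per: "\<And>v. (((*v) z) ^^ p) v = v" and nontriv: "z \<noteq> mat 1"
begin

lemma card_invariant_cong:
  assumes "\<And>w. w \<in> W \<Longrightarrow> z *v w \<in> W"
  shows "[card W = card {w \<in> W. z *v w = w}] (mod p)"
  using assms per by (intro card_fixed_points_cong[OF _ prime]) auto

lemma card_power4_cong: "[CARD('F) ^ 4 = 1] (mod p)"
proof -
  let ?q = "CARD('F)"
  have "int ?q ^ 4 - 1 = ((int ?q)\<^sup>2 + 1) * ((int ?q)\<^sup>2 - 1)"
    by (simp add: algebra_simps power2_eq_square power4_eq_xxxx)
  moreover have "int p dvd (int ?q)\<^sup>2 + 1"
    using pdvd by (metis of_nat_1 of_nat_add of_nat_dvd_iff of_nat_power)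
  ultimately have "int p dvd int ?q ^ 4 - 1" by simp
  then have "[int ?q ^ 4 = 1] (mod int p)" by (simp add: cong_iff_dvd_diff)
  then show ?thesis by (metis cong_int_iff of_nat_1 of_nat_power)
qed

lemma card_le4:
  fixes W :: "('F ^ 4) set"
  assumes "card W = CARD('F) ^ d"
  shows "d \<le> 4"
proof -
  have "CARD('F) ^ d \<le> CARD('F) ^ 4"
    using card_mono[of UNIV W] assms by simp
  moreover have "CARD('F) > 1"
  proof -
    have "card {0, 1 :: 'F} \<le> CARD('F)" by (rule card_mono) auto
    then show ?thesis by simp
  qed
  ultimately show ?thesis by simp
qed

text \<open>The fixed space has q^e elements, congruent to q^4 and hence to 1. This leaves e = 0 or
  e = 4, and the latter would make \<open>z\<close> the identity.\<close>

lemma fixed_zero: "z *v w = w \<longleftrightarrow> w = 0"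
proof -
  let ?E = "{w. z *v w = w}"
  have sub: "vec.subspace ?E"
    by (rule vec.subspaceI) (auto simp: matrix_vector_right_distrib vec.scale)
  then obtain e where e: "card ?E = CARD('F) ^ e" using card_vec_subspace by blast
  have "[card (UNIV :: ('F ^ 4) set) = card {w \<in> UNIV. z *v w = w}] (mod p)"
    by (rule card_invariant_cong) simp
  then have "[CARD('F) ^ 4 = CARD('F) ^ e] (mod p)" using e by simp
  then have c: "[CARD('F) ^ e = 1] (mod p)" using card_power4_cong cong_sym cong_trans by blast
  have "e \<noteq> 4"
  proof
    assume "e = 4"
    then have "card ?E = card (UNIV :: ('F ^ 4) set)" using e by simp
    then have "?E = UNIV" by (intro card_subset_eq) auto
    then have "z = mat 1" by (simp add: matrix_eq set_eq_iff)
    then show False using nontriv by simp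
  qed
  then have "e \<le> 3" using card_le4[OF e] by simp
  then have "e = 0" using prime_dvd_square_plus_one_cong[OF prime p2 pdvd _ c] by blast
  then have "card ?E = 1" using e by simp
  moreover have "0 \<in> ?E" by simp
  ultimately have "?E = {0}" by (metis card_1_singletonE singletonD)
  then show ?thesis by blast
qed

text \<open>Only 0 is fixed in \<open>W\<close>, so its size q^d is 1 modulo \<open>p\<close>,
  leaving d = 0 or d = 4.\<close>

lemma irreducible:
  assumes W: "vec.subspace W" "\<And>w. w \<in> W \<Longrightarrow> z *v w \<in> W" and ne: "v \<in> W" "v \<noteq> 0"
  shows "W = UNIV"
proof -
  obtain d where d: "card W = CARD('F) ^ d" using card_vec_subspace[OF W(1)] by blast
  have "{w \<in> W. z *v w = w} = {0}" using vec.subspace_0[OF W(1)] fixed_zero by blast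
  then have c: "[CARD('F) ^ d = 1] (mod p)" using card_invariant_cong[OF W(2)] d by simp
  have "d \<noteq> 0"
  proof
    assume "d = 0"
    then have "card W = 1" using d by simp
    then show False using vec.subspace_0[OF W(1)] ne by (metis card_1_singletonE singletonD)
  qed
  then have "\<not> d \<le> 3" using prime_dvd_square_plus_one_cong[OF prime p2 pdvd _ c] by blast
  then have "d = 4" using card_le4[OF d] by simp
  then have "card W = card (UNIV :: ('F ^ 4) set)" using d by simp
  then show ?thesis by (intro card_subset_eq) auto
qed

section \<open>The field of matrices commuting with z\<close>

definition K :: "('F ^ 4 ^ 4) set" where
  "K = {A. A ** z = z ** A}"

lemma matrix_diff_distrib:
  fixes A B C :: "'F ^ 4 ^ 4"
  shows "A ** (B - C) = A ** B - A ** C" "(A - B) ** C = A ** C - B ** C"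
    "(A + B) ** C = A ** C + B ** C"
  by (simp_all add: matrix_matrix_mult_def vec_eq_iff sum_subtractf algebra_simps sum.distrib)

lemma matrix_zero_mult [simp]:
  fixes A :: "'F ^ 4 ^ 4"
  shows "0 ** A = 0" "A ** 0 = 0"
  by (simp_all add: matrix_matrix_mult_def vec_eq_iff)

lemma K_diff: "A \<in> K \<Longrightarrow> B \<in> K \<Longrightarrow> A - B \<in> K"
  unfolding K_def by (simp add: matrix_diff_distrib)

lemma K_add: "A \<in> K \<Longrightarrow> B \<in> K \<Longrightarrow> A + B \<in> K"
  unfolding K_def by (simp add: matrix_diff_distrib matrix_add_ldistrib)

lemma K_mult: "A \<in> K \<Longrightarrow> B \<in> K \<Longrightarrow> A ** B \<in> K"
proof -
  assume "A \<in> K" "B \<in> K"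
  then have AB: "A ** z = z ** A" "B ** z = z ** B" unfolding K_def by simp_all
  have "A ** B ** z = A ** z ** B" by (simp only: matrix_mul_assoc[symmetric] AB(2))
  also have "\<dots> = z ** (A ** B)" by (simp only: AB(1) matrix_mul_assoc)
  finally show ?thesis unfolding K_def by simp
qed

lemma K_zero: "0 \<in> K" and K_one: "mat 1 \<in> K" and K_z: "z \<in> K"
  unfolding K_def by simp_all

lemma mat_scalar: "mat c ** A = A ** mat (c :: 'F)" for A :: "'F ^ 4 ^ 4"
  by (simp add: vec_eq_iff matrix_matrix_mult_def mat_def if_distrib if_distribR
      mult.commute cong: if_cong)

lemma mat_vec: "mat c *v v = c *s v" for v :: "'F ^ 4"
  by (simp add: vec_eq_iff matrix_vector_mult_def mat_def if_distrib if_distribR cong: if_cong)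

lemma K_mat: "mat c \<in> K"
  unfolding K_def using mat_scalar by simp

text \<open>Schur's lemma: the kernel of a matrix commuting with \<open>z\<close> is
  \<open>z\<close>-invariant, hence zero or everything.\<close>

lemma K_kernel:
  assumes A: "A \<in> K" and v: "v \<noteq> 0" "A *v v = 0"
  shows "A = 0"
proof -
  have "{w. A *v w = 0} = UNIV"
  proof (rule irreducible[of _ v])
    show "vec.subspace {w. A *v w = 0}"
      by (rule vec.subspaceI) (auto simp: matrix_vector_right_distrib vec.scale)
    fix w assume "w \<in> {w. A *v w = 0}"
    then have "z *v (A *v w) = 0" by simp
    then have "A *v (z *v w) = 0" using A unfolding K_def by (simp add: matrix_vector_mul_assoc)
    then show "z *v w \<in> {w. A *v w = 0}" by simp
  qed (use v in auto)
  then have "\<forall>w. A *v w = 0 *v w" by auto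
  then show ?thesis using matrix_eq[of A 0] by blast
qed

lemma K_no_zero_div:
  assumes "A \<in> K" "B \<in> K" "A ** B = 0"
  shows "A = 0 \<or> B = 0"
proof (rule ccontr)
  assume ne: "\<not> (A = 0 \<or> B = 0)"
  then obtain v where v: "B *v v \<noteq> 0" using matrix_eq[of B 0] by auto
  have "A *v (B *v v) = 0" using assms(3) by (simp add: matrix_vector_mul_assoc)
  then show False using K_kernel[OF assms(1) v] ne by blast
qed

text \<open>By irreducibility the double centralizer \<open>D\<close> satisfies \<open>D v = F\<^sup>4\<close>, so each element of \<open>K\<close>
  agrees at \<open>v\<close>, and hence everywhere, with an element of \<open>D\<close>. This makes Wedderburn's theorem
  unnecessary.\<close>
lemma K_comm:
  assumes A: "A \<in> K" and B: "B \<in> K"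
  shows "A ** B = B ** A"
proof -
  define D where "D = {k. \<forall>C\<in>K. k ** C = C ** k}"
  define v :: "'F ^ 4" where "v = axis 1 1"
  have v: "v \<noteq> 0" unfolding v_def by (simp add: axis_eq_0_iff)
  have D1: "mat 1 \<in> D" "z \<in> D" unfolding D_def K_def by simp_all
  have Dm: "k ** l \<in> D" if "k \<in> D" "l \<in> D" for k l
    unfolding D_def
  proof (rule CollectI, rule ballI)
    fix C assume "C \<in> K"
    then have kC: "k ** C = C ** k" "l ** C = C ** l" using that unfolding D_def by blast+
    have "k ** l ** C = k ** C ** l" by (simp only: matrix_mul_assoc[symmetric] kC(2))
    also have "\<dots> = C ** (k ** l)" by (simp only: kC(1) matrix_mul_assoc)
    finally show "k ** l ** C = C ** (k ** l)" .
  qed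
  have Da: "k + l \<in> D" if "k \<in> D" "l \<in> D" for k l
    using that unfolding D_def by (simp add: matrix_diff_distrib matrix_add_ldistrib)
  have Ds: "mat c \<in> D" for c unfolding D_def using mat_scalar by simp
  have D0: "0 \<in> D" unfolding D_def by simp
  have "(\<lambda>k. k *v v) ` D = UNIV"
  proof (rule irreducible[of _ v])
    show "vec.subspace ((\<lambda>k. k *v v) ` D)"
    proof (rule vec.subspaceI)
      show "0 \<in> (\<lambda>k. k *v v) ` D" using D0 by (intro image_eqI[of _ _ 0]) auto
      fix x y assume "x \<in> (\<lambda>k. k *v v) ` D" "y \<in> (\<lambda>k. k *v v) ` D"
      then obtain k l where kl: "k \<in> D" "l \<in> D" "x = k *v v" "y = l *v v" by blast
      show "x + y \<in> (\<lambda>k. k *v v) ` D"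
        by (rule image_eqI[of _ _ "k + l"]) (use kl Da in \<open>auto simp: matrix_vector_mult_add_rdistrib\<close>)
    next
      fix c x assume "x \<in> (\<lambda>k. k *v v) ` D"
      then obtain k where k: "k \<in> D" "x = k *v v" by blast
      show "c *s x \<in> (\<lambda>k. k *v v) ` D"
        by (rule image_eqI[of _ _ "mat c ** k"])
          (use k Dm[OF Ds k(1)] in \<open>auto simp: mat_vec simp flip: matrix_vector_mul_assoc\<close>)
    qed
    fix w assume "w \<in> (\<lambda>k. k *v v) ` D"
    then obtain k where k: "k \<in> D" "w = k *v v" by blast
    show "z *v w \<in> (\<lambda>k. k *v v) ` D"
      by (rule image_eqI[of _ _ "z ** k"]) (use k Dm[OF D1(2) k(1)] in \<open>auto simp: matrix_vector_mul_assoc\<close>)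
  next
    show "v \<in> (\<lambda>k. k *v v) ` D" using D1 by (intro image_eqI[of _ _ "mat 1"]) auto
  qed (rule v)
  then have "A *v v \<in> (\<lambda>k. k *v v) ` D" by simp
  then obtain k where k: "k \<in> D" "A *v v = k *v v" by blast
  \<comment> \<open>The double centralizer lies in \<open>K\<close> because \<open>z\<close> itself
    does, so that \<open>K_kernel\<close> applies to \<open>A - k\<close>.\<close>
  have "k \<in> K" using k(1) K_z unfolding D_def K_def by blast
  then have "A - k \<in> K" using A K_diff by blast
  moreover have "(A - k) *v v = 0" using k(2) by (simp add: matrix_vector_mult_diff_rdistrib)
  ultimately have "A = k" using K_kernel[OF _ v] by fastforce
  then show ?thesis using k(1) B unfolding D_def by blast
qed

section \<open>Polynomials over the commutant\<close>

text \<open>Coefficients come constant term first. They are matrices and not scalars, since division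
  by y - y0 produces coefficients in \<open>K\<close>.\<close>

primrec horner :: "('F ^ 4 ^ 4) list \<Rightarrow> 'F ^ 4 ^ 4 \<Rightarrow> 'F ^ 4 ^ 4" where
  "horner [] y = 0"
| "horner (c # cs) y = c + y ** horner cs y"

lemma horner_K: "set cs \<subseteq> K \<Longrightarrow> y \<in> K \<Longrightarrow> horner cs y \<in> K"
  by (induction cs) (auto simp: K_zero K_add K_mult)

lemma horner_zero: "\<forall>c\<in>set cs. c = 0 \<Longrightarrow> horner cs y = 0"
  by (induction cs) auto

text \<open>The factor theorem; commutativity of \<open>K\<close> moves \<open>y\<close> past
  \<open>y - y0\<close>. The last conjunct replaces a comparison of degrees: a zero quotient leaves
  no nonzero coefficient except possibly the constant one.\<close>

lemma horner_divide:
  assumes "set cs \<subseteq> K" "y0 \<in> K"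
  shows "\<exists>ds. set ds \<subseteq> K \<and> length ds = length cs - 1 \<and>
    (\<forall>y\<in>K. horner cs y - horner cs y0 = (y - y0) ** horner ds y) \<and>
    ((\<forall>d\<in>set ds. d = 0) \<longrightarrow> (\<forall>c\<in>set (tl cs). c = 0))"
  using assms(1)
proof (induction cs)
  case Nil
  show ?case by (intro exI[of _ "[]"]) simp
next
  case (Cons c cs)
  show ?case
  proof (cases "cs = []")
    case True
    then show ?thesis by (intro exI[of _ "[]"]) simp
  next
    case False
    obtain ds where ds: "set ds \<subseteq> K" "length ds = length cs - 1"
      "\<And>y. y \<in> K \<Longrightarrow> horner cs y - horner cs y0 = (y - y0) ** horner ds y"
      "(\<forall>d\<in>set ds. d = 0) \<Longrightarrow> (\<forall>c\<in>set (tl cs). c = 0)" using Cons by auto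
    \<comment> \<open>Synthetic division: the constant coefficient of the quotient is the value of
      the tail at \<open>y0\<close>.\<close>
    let ?e = "horner cs y0"
    have e: "?e \<in> K" using horner_K Cons.prems assms(2) by simp
    have div: "horner (c # cs) y - horner (c # cs) y0 = (y - y0) ** horner (?e # ds) y" if y: "y \<in> K" for y
    proof -
      have yy: "y ** (y - y0) = (y - y0) ** y" using K_comm[OF y K_diff[OF y assms(2)]] .
      have "horner cs y = (y - y0) ** horner ds y + ?e" using ds(3)[OF y] by (simp add: algebra_simps)
      then have "horner (c # cs) y - horner (c # cs) y0
          = y ** ((y - y0) ** horner ds y + ?e) - y0 ** ?e" by simp
      also have "\<dots> = (y - y0) ** (y ** horner ds y) + (y ** ?e - y0 ** ?e)"
        by (simp only: matrix_add_ldistrib matrix_mul_assoc yy) (simp add: algebra_simps)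
      also have "\<dots> = (y - y0) ** horner (?e # ds) y"
        by (simp add: matrix_add_ldistrib matrix_diff_distrib(2))
      finally show ?thesis .
    qed
    have zeros: "(\<forall>d\<in>set (?e # ds). d = 0) \<longrightarrow> (\<forall>c'\<in>set (tl (c # cs)). c' = 0)"
    proof
      assume z: "\<forall>d\<in>set (?e # ds). d = 0"
      then have tl0: "\<forall>c\<in>set (tl cs). c = 0" using ds(4) by simp
      obtain c2 cs2 where cs: "cs = c2 # cs2" using False by (cases cs) auto
      then have "horner cs2 y0 = 0" using horner_zero[of cs2] tl0 by simp
      then have "c2 = 0" using z cs by simp
      then show "\<forall>c'\<in>set (tl (c # cs)). c' = 0" using tl0 cs by simp
    qed
    show ?thesis
    proof (intro exI conjI ballI)
      show "set (?e # ds) \<subseteq> K" using ds(1) e by simp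
      show "length (?e # ds) = length (c # cs) - 1" using ds(2) False by (cases cs) simp_all
    qed (fact div, fact zeros)
  qed
qed

text \<open>A list of length k has degree below k. Splitting off one root shortens it by one, and
  the other roots pass to the quotient because \<open>K\<close> has no zero divisors.\<close>

lemma horner_roots:
  assumes "set cs \<subseteq> K" "finite Y" "Y \<subseteq> K" "\<forall>y\<in>Y. horner cs y = 0" "length cs \<le> card Y"
  shows "\<forall>c\<in>set cs. c = 0"
  using assms
proof (induction "length cs" arbitrary: cs Y)
  case 0
  then have "cs = []" by simp
  then show ?case by simp
next
  case (Suc n)
  obtain c cs' where cs: "cs = c # cs'" using Suc.hyps(2) by (metis Suc_length_conv)
  have "card Y \<noteq> 0" using Suc.prems(5) Suc.hyps(2) by linarith
  then have "Y \<noteq> {}" by (metis card.empty)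
  then obtain y0 where y0: "y0 \<in> Y" by blast
  then have y0K: "y0 \<in> K" using Suc.prems by blast
  obtain ds where ds: "set ds \<subseteq> K" "length ds = length cs - 1"
    "\<forall>y\<in>K. horner cs y - horner cs y0 = (y - y0) ** horner ds y"
    "(\<forall>d\<in>set ds. d = 0) \<longrightarrow> (\<forall>c\<in>set (tl cs). c = 0)"
    using horner_divide[OF Suc.prems(1) y0K] by (elim exE conjE)
  have "\<forall>d\<in>set ds. d = 0"
  proof (rule Suc.hyps(1)[of ds "Y - {y0}"])
    show "n = length ds" using ds(2) Suc.hyps(2) by simp
    show "length ds \<le> card (Y - {y0})" using ds(2) Suc.prems(2,5) y0 by simp
    show "\<forall>y\<in>Y - {y0}. horner ds y = 0"
    proof
      fix y assume y: "y \<in> Y - {y0}"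
      then have yK: "y \<in> K" using Suc.prems by blast
      have "(y - y0) ** horner ds y = 0" using bspec[OF ds(3) yK] Suc.prems(4) y y0 by simp
      then show "horner ds y = 0"
        using K_no_zero_div[OF K_diff[OF yK y0K] horner_K[OF ds(1) yK]] y by simp
    qed
    show "set ds \<subseteq> K" "finite (Y - {y0})" "Y - {y0} \<subseteq> K"
      using ds(1) Suc.prems(2,3) by auto
  qed
  then have tl: "\<forall>c\<in>set cs'. c = 0" using ds(4) cs by simp
  have "horner cs y0 = 0" using Suc.prems(4) y0 by blast
  then have "c = 0" unfolding cs using horner_zero[OF tl, of y0] by simp
  then show ?case unfolding cs using tl by simp
qed

lemma horner_diff:
  "length cs = length ds \<Longrightarrow> horner (map2 (-) cs ds) y = horner cs y - horner ds y"
  by (induction cs ds rule: list_induct2) (simp_all add: matrix_diff_distrib)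

text \<open>There are q^5 scalar lists of length 5 but only q^4 vectors, so two of the polynomials
  agree at \<open>z\<close> when applied to one vector \<open>v\<close>. By \<open>K_kernel\<close>
  their difference vanishes at \<open>z\<close>.\<close>

lemma exists_annihilator:
  obtains cs where "length cs = 5" "\<exists>c\<in>set cs. c \<noteq> 0" "set cs \<subseteq> range mat" "horner cs z = 0"
proof -
  let ?L = "{xs :: 'F list. set xs \<subseteq> UNIV \<and> length xs = 5}"
  define v :: "'F ^ 4" where "v = axis 1 1"
  have v: "v \<noteq> 0" unfolding v_def by (simp add: axis_eq_0_iff)
  let ?f = "\<lambda>xs. horner (map mat xs) z *v v"
  have q1: "CARD('F) > 1"
  proof -
    have "card {0, 1 :: 'F} \<le> CARD('F)" by (rule card_mono) auto
    then show ?thesis by simp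
  qed
  have cL: "card ?L = CARD('F) ^ 5" by (rule card_lists_length_eq) simp
  have "card (?f ` ?L) \<le> CARD('F) ^ 4" using card_mono[of UNIV "?f ` ?L"] by simp
  also have "\<dots> < card ?L" unfolding cL using q1 by (intro power_strict_increasing) auto
  finally have "\<not> inj_on ?f ?L" by (rule pigeonhole)
  then obtain xs ys where xy: "length xs = 5" "length ys = 5" "xs \<noteq> ys" "?f xs = ?f ys"
    unfolding inj_on_def by auto
  let ?cs = "map2 (-) (map mat xs) (map mat ys) :: ('F ^ 4 ^ 4) list"
  have md: "mat a - mat b = (mat (a - b) :: 'F ^ 4 ^ 4)" for a b :: 'F
    by (simp add: mat_def vec_eq_iff)
  have cs: "?cs = map (\<lambda>(a, b). mat (a - b)) (zip xs ys)"
    by (simp add: zip_map1 zip_map2 md case_prod_beta comp_def)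
  have sub: "set ?cs \<subseteq> range mat" unfolding cs by auto
  have "horner ?cs z *v v = 0"
    using xy by (simp add: horner_diff matrix_vector_mult_diff_rdistrib)
  moreover have "horner ?cs z \<in> K" using sub K_mat by (intro horner_K K_z) blast
  ultimately have "horner ?cs z = 0" using K_kernel[OF _ v] by blast
  moreover have "\<exists>c\<in>set ?cs. c \<noteq> 0"
  proof -
    obtain i where i: "i < 5" "xs ! i \<noteq> ys ! i" using xy by (metis nth_equalityI)
    have "?cs ! i = mat (xs ! i - ys ! i)" unfolding cs using i xy by simp
    moreover have "mat (xs ! i - ys ! i) \<noteq> (0 :: 'F ^ 4 ^ 4)"
      using i by (auto simp: mat_def vec_eq_iff)
    moreover have "?cs ! i \<in> set ?cs" using i xy by (intro nth_mem) simp
    ultimately show ?thesis by metis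
  qed
  ultimately show thesis using that[of ?cs] sub xy by simp
qed

text \<open>Scalar coefficients are unchanged by conjugation, so all conjugates of \<open>z\<close>
  are roots of one annihilator of degree at most 4.\<close>

lemma card_conjugates:
  assumes Y: "Y \<subseteq> K" and conj: "\<And>y. y \<in> Y \<Longrightarrow> \<exists>x x'. x ** x' = mat 1 \<and> x' ** x = mat 1 \<and> y = x ** z ** x'"
  shows "card Y \<le> 4"
proof (rule ccontr)
  assume "\<not> card Y \<le> 4"
  then have c: "5 \<le> card Y" by simp
  obtain cs where cs: "length cs = 5" "\<exists>c\<in>set cs. c \<noteq> 0" "set cs \<subseteq> range mat" "horner cs z = 0"
    by (rule exists_annihilator)
  have csK: "set cs \<subseteq> K" using cs(3) K_mat by blast
  have hc: "horner ds (x ** z ** x') = x ** horner ds z ** x'"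
    if xx: "x ** x' = mat 1" "x' ** x = mat 1" and ds: "set ds \<subseteq> range mat" for x x' ds
    using ds
  proof (induction ds)
    case Nil
    then show ?case by simp
  next
    case (Cons d ds)
    then obtain c where d: "d = mat c" by auto
    have "x ** d ** x' = d" unfolding d mat_scalar[symmetric] by (simp add: matrix_mul_assoc[symmetric] xx)
    moreover have "x ** z ** x' ** (x ** horner ds z ** x') = x ** (z ** horner ds z) ** x'"
      by (metis matrix_mul_assoc matrix_mul_rid xx(2))
    ultimately show ?case using Cons by (simp add: matrix_add_ldistrib matrix_diff_distrib(3))
  qed
  have "\<forall>y\<in>Y. horner cs y = 0"
  proof
    fix y assume "y \<in> Y"
    then obtain x x' where "x ** x' = mat 1" "x' ** x = mat 1" "y = x ** z ** x'" using conj by blast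
    then show "horner cs y = 0" using hc[of x x' cs] cs by simp
  qed
  then have "\<forall>c\<in>set cs. c = 0" using horner_roots[OF csK _ Y] c cs(1) by simp
  then show False using cs(2) by blast
qed

end

section \<open>The field and the Suzuki-Tits ovoid\<close>

lemma vector_4 [simp]:
  "(vector [x, y, z, w] :: 'a::zero ^ 4) $ 1 = x"
  "(vector [x, y, z, w] :: 'a::zero ^ 4) $ 2 = y"
  "(vector [x, y, z, w] :: 'a::zero ^ 4) $ 3 = z"
  "(vector [x, y, z, w] :: 'a::zero ^ 4) $ 4 = w"
  unfolding vector_def by simp_all

lemma vec4_eq_iff: "v = w \<longleftrightarrow> v $ 1 = w $ 1 \<and> v $ 2 = w $ 2 \<and> v $ 3 = w $ 3 \<and> v $ 4 = w $ 4"
  for v w :: "'a ^ 4"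
  by (simp add: vec_eq_iff forall_4)

lemma mat4_nth [simp]:
  "mat4 [r1, r2, r3, r4] $ 1 = (vector r1 :: 'a::zero ^ 4)"
  "mat4 [r1, r2, r3, r4] $ 2 = (vector r2 :: 'a::zero ^ 4)"
  "mat4 [r1, r2, r3, r4] $ 3 = (vector r3 :: 'a::zero ^ 4)"
  "mat4 [r1, r2, r3, r4] $ 4 = (vector r4 :: 'a::zero ^ 4)"
  unfolding mat4_def by simp_all

lemma matrix_vector_mult_4:
  "(A *v v) $ i = A $ i $ 1 * v $ 1 + A $ i $ 2 * v $ 2 + A $ i $ 3 * v $ 3 + A $ i $ 4 * v $ 4"
  for A :: "'a::comm_semiring_1 ^ 4 ^ 4"
  by (simp add: matrix_vector_mult_def sum_4)

lemma matrix_matrix_mult_4: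
  "(A ** B) $ i $ j = A $ i $ 1 * B $ 1 $ j + A $ i $ 2 * B $ 2 $ j + A $ i $ 3 * B $ 3 $ j + A $ i $ 4 * B $ 4 $ j"
  for A B :: "'a::comm_semiring_1 ^ 4 ^ 4"
  by (simp add: matrix_matrix_mult_def sum_4)

lemma mat_1_nth [simp]: "(mat 1 :: 'a::zero_neq_one ^ 4 ^ 4) $ i $ j = (if i = j then 1 else 0)"
  by (simp add: mat_def)

locale suzuki_field =
  fixes n :: nat and F :: "'F::{field,finite} itself"
  assumes n1: "n \<ge> 1" and cardF: "CARD('F) = 2 ^ (2 * n + 1)"
begin

text \<open>Translation by 1 permutes the field, so adding 1 to every element does not change the
  sum of all elements.\<close>

lemma of_nat_card: "of_nat CARD('F) = (0 :: 'F)"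
proof -
  have "(\<Sum>x\<in>UNIV. x) = (\<Sum>x\<in>UNIV. x + (1 :: 'F))"
    by (rule sum.reindex_bij_witness[of _ "\<lambda>x. x + 1" "\<lambda>x. x - 1"]) auto
  then show ?thesis by (simp add: sum.distrib)
qed

lemma two_zero [simp]: "(2 :: 'F) = 0"
proof -
  have "(of_nat 2 :: 'F) ^ (2 * n + 1) = 0" using of_nat_card unfolding cardF by simp
  then have "(of_nat 2 :: 'F) = 0" by (rule power_eq_0_iff[THEN iffD1, THEN conjunct1])
  then show ?thesis by (simp only: of_nat_numeral)
qed

lemma add_self [simp]: "x + x = (0 :: 'F)" "x + (x + y) = (y :: 'F)"
proof -
  have "x + x = 2 * x" by simp
  then show *: "x + x = 0" by (simp only: two_zero mult_zero_left)
  show "x + (x + y) = y" by (simp only: add.assoc[symmetric] * add_0_left)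
qed

lemma minus_self: "- x = (x :: 'F)"
  using add_self(1) by (simp only: neg_eq_iff_add_eq_0)

lemma add_eq_zero_iff: "x + y = 0 \<longleftrightarrow> x = (y :: 'F)"
  by (metis add_eq_0_iff minus_self)

lemma frobenius: "(x :: 'F) ^ CARD('F) = x"
proof (cases "x = 0")
  case False
  have "(\<Prod>y\<in>UNIV - {0}. y) = (\<Prod>y\<in>UNIV - {0}. x * y)"
    by (rule prod.reindex_bij_witness[of _ "\<lambda>y. x * y" "\<lambda>y. y / x"]) (use False in auto)
  also have "\<dots> = x ^ (CARD('F) - 1) * (\<Prod>y\<in>UNIV - {0}. y)" by (simp add: prod.distrib)
  finally have "x ^ (CARD('F) - 1) = 1" by simp
  then have "x * x ^ (CARD('F) - 1) = x" by simp
  then show ?thesis by (simp add: power_eq_if)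
qed simp

lemma square_add: "(x + y)\<^sup>2 = x\<^sup>2 + (y :: 'F)\<^sup>2"
  by (simp add: power2_sum)

lemma pow_two_add: "(x + y) ^ (2 ^ k) = x ^ (2 ^ k) + (y :: 'F) ^ (2 ^ k)"
proof (induction k)
  case (Suc k)
  then show ?case by (simp add: power_mult[of _ "2 ^ k" 2] mult.commute[of 2] square_add)
qed simp

lemma square_inj: "x\<^sup>2 = y\<^sup>2 \<longleftrightarrow> x = (y :: 'F)"
proof
  assume "x\<^sup>2 = y\<^sup>2"
  then have "(x + y)\<^sup>2 = 0" using square_add by simp
  then show "x = y" using add_eq_zero_iff by simp
qed simp

section \<open>The automorphism \<theta>\<close>

abbreviation \<theta> :: "'F \<Rightarrow> 'F" where "\<theta> \<equiv> sz_theta n"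

lemma theta_add: "\<theta> (x + y) = \<theta> x + \<theta> y"
  unfolding sz_theta_def by (rule pow_two_add)

lemma theta_mult: "\<theta> (x * y) = \<theta> x * \<theta> y"
  unfolding sz_theta_def by (rule power_mult_distrib)

lemma theta_power: "\<theta> (x ^ k) = \<theta> x ^ k"
  unfolding sz_theta_def by (simp add: power_mult[symmetric] mult.commute)

lemma theta_simps [simp]: "\<theta> 0 = 0" "\<theta> 1 = 1"
  unfolding sz_theta_def by simp_all

lemma theta_eq_0_iff [simp]: "\<theta> x = 0 \<longleftrightarrow> x = 0"
  unfolding sz_theta_def by simp

lemma theta_divide: "\<theta> (x / y) = \<theta> x / \<theta> y"
  unfolding sz_theta_def by (rule power_divide)

text \<open>The property behind the Suzuki groups: \<theta> is a square root of the squaring map,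
  since 2^(2n+2) is twice the order of the field.\<close>

lemma theta_theta: "\<theta> (\<theta> x) = x\<^sup>2"
proof -
  have "\<theta> (\<theta> x) = x ^ (2 ^ (n + 1) * 2 ^ (n + 1))" unfolding sz_theta_def by (simp only: power_mult)
  also have "2 ^ (n + 1) * 2 ^ (n + 1) = 2 ^ (2 * n + 1) * (2 :: nat)"
    by (simp add: mult_2 power_add distrib_left distrib_right)
  also have "x ^ (2 ^ (2 * n + 1) * 2) = x\<^sup>2"
    using frobenius[of x] unfolding cardF power_mult by simp
  finally show ?thesis .
qed

lemma theta_fixed: "\<theta> x = x \<longleftrightarrow> x = 0 \<or> x = 1"
proof
  assume "\<theta> x = x"
  then have "x = x\<^sup>2" using theta_theta[of x] by simp
  then show "x = 0 \<or> x = 1" by (simp add: power2_eq_square)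
qed auto

text \<open>Applying \<theta> gives \<theta>(l) l^2 = 1, and comparison with the original equation
  leaves l = 1. It shows that a nontrivial \<open>sz_M n l\<close> moves every nonzero second affine
  coordinate.\<close>

lemma mult_theta_eq_1: "l * \<theta> l = 1 \<longleftrightarrow> l = 1"
proof
  assume l: "l * \<theta> l = 1"
  then have "\<theta> l * l\<^sup>2 = 1" using theta_mult[of l "\<theta> l"] theta_theta by simp
  then have "(\<theta> l * l) * l = 1" by (simp add: power2_eq_square mult_ac)
  then show "l = 1" using l by (simp add: mult.commute)
qed simp

text \<open>Both the inverse automorphism of \<theta> and the square root of \<theta>(l); each
  description is used for the diagonal matrices.\<close>

definition half :: "'F \<Rightarrow> 'F" where
  "half l = l ^ (2 ^ n)"

lemma half_square: "(half l)\<^sup>2 = \<theta> l"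
  unfolding half_def sz_theta_def by (simp add: power_mult[symmetric] mult.commute)

lemma theta_half: "\<theta> (half l) = l"
proof -
  have "2 ^ n * 2 ^ (n + 1) = (2 ^ (2 * n + 1) :: nat)" by (simp add: mult_2 power_add distrib_left distrib_right)
  then have "\<theta> (half l) = l ^ (2 ^ (2 * n + 1))"
    unfolding half_def sz_theta_def by (simp only: power_mult[symmetric])
  then show ?thesis using frobenius[of l] unfolding cardF by simp
qed

lemma half_eq_0_iff [simp]: "half l = 0 \<longleftrightarrow> l = 0"
  unfolding half_def by simp

lemma half_simps [simp]: "half 1 = 1"
  unfolding half_def by simp

lemma sz_M_eq: "sz_M n l = mat4 [[l * half l, 0, 0, 0], [0, half l, 0, 0],
    [0, 0, inverse (half l), 0], [0, 0, 0, inverse (l * half l)]]"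
  unfolding sz_M_def half_def by simp

section \<open>The Suzuki-Tits ovoid\<close>

text \<open>Tits' equation for the last coordinate of an affine ovoid point. It is also the lower
  left entry of \<open>sz_S\<close>, whose first column is \<open>pt a b\<close>.\<close>

definition quad :: "'F \<Rightarrow> 'F \<Rightarrow> 'F" where
  "quad x y = x\<^sup>2 * \<theta> x + x * y + \<theta> y"

definition pt :: "'F \<Rightarrow> 'F \<Rightarrow> 'F ^ 4" where
  "pt x y = vector [1, x, y, quad x y]"

definition ptinf :: "'F ^ 4" where
  "ptinf = vector [0, 0, 0, 1]"

text \<open>Projective points are kept as sets of vectors, so that \<open>act\<close> is an image
  and needs no choice of representative.\<close>

definition line :: "'F ^ 4 \<Rightarrow> ('F ^ 4) set" where
  "line v = range (\<lambda>c. c *s v)"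

definition act :: "'F ^ 4 ^ 4 \<Rightarrow> ('F ^ 4) set \<Rightarrow> ('F ^ 4) set" where
  "act g L = (\<lambda>v. g *v v) ` L"

definition ovoid :: "('F ^ 4) set set" where
  "ovoid = insert (line ptinf) (range (\<lambda>(x, y). line (pt x y)))"

lemma pt_nth [simp]: "pt x y $ 1 = 1" "pt x y $ 2 = x" "pt x y $ 3 = y" "pt x y $ 4 = quad x y"
  unfolding pt_def by simp_all

lemma ptinf_nth [simp]: "ptinf $ 1 = 0" "ptinf $ 2 = 0" "ptinf $ 3 = 0" "ptinf $ 4 = 1"
  unfolding ptinf_def by simp_all

lemma quad_0 [simp]: "quad 0 y = \<theta> y" "quad 0 0 = 0"
  unfolding quad_def by simp_all

lemma act_line: "act g (line v) = line (g *v v)"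
  unfolding act_def line_def by (simp add: image_image vec.scale)

lemma act_mult: "act (g ** h) L = act g (act h L)"
  unfolding act_def by (simp add: image_image matrix_vector_mul_assoc)

lemma act_one: "act (mat 1) L = L"
  unfolding act_def by simp

lemma line_scale: "c \<noteq> 0 \<Longrightarrow> line (c *s v) = line v"
proof
  assume c: "c \<noteq> 0"
  show "line (c *s v) \<subseteq> line v" unfolding line_def by auto
  show "line v \<subseteq> line (c *s v)"
  proof
    fix w assume "w \<in> line v"
    then obtain d where "w = d *s v" unfolding line_def by blast
    then have "w = (d / c) *s (c *s v)" using c by simp
    then show "w \<in> line (c *s v)" unfolding line_def by blast
  qed
qed

lemma line_eqD: "line v = line w \<Longrightarrow> \<exists>c. v = c *s w"
proof -
  assume "line v = line w"
  moreover have "v \<in> line v" unfolding line_def by (rule range_eqI[of _ _ 1]) simp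
  ultimately show ?thesis unfolding line_def by blast
qed

lemma line_pt_eq [simp]: "line (pt x y) = line (pt x' y') \<longleftrightarrow> x = x' \<and> y = y'"
proof
  assume "line (pt x y) = line (pt x' y')"
  then obtain c where c: "pt x y = c *s pt x' y'" using line_eqD by blast
  then have "c = 1" by (simp add: vec4_eq_iff)
  then show "x = x' \<and> y = y'" using c by (simp add: vec4_eq_iff)
qed simp

lemma line_pt_neq [simp]: "line (pt x y) \<noteq> line ptinf" "line ptinf \<noteq> line (pt x y)"
proof -
  show "line (pt x y) \<noteq> line ptinf"
  proof
    assume "line (pt x y) = line ptinf"
    then obtain c where "pt x y = c *s ptinf" using line_eqD by blast
    then show False by (simp add: vec4_eq_iff)
  qed
  then show "line ptinf \<noteq> line (pt x y)" by metis
qed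

lemma card_ovoid: "card ovoid = CARD('F)\<^sup>2 + 1"
proof -
  have "inj (\<lambda>(x, y). line (pt x y))" by (auto simp: inj_on_def)
  then have "card (range (\<lambda>(x, y). line (pt x y))) = CARD('F \<times> 'F)" by (simp add: card_image)
  then show ?thesis unfolding ovoid_def
    by (subst card_insert_disjoint) (auto simp: card_prod power2_eq_square)
qed

lemma ovoidE:
  assumes "L \<in> ovoid"
  obtains "L = line ptinf" | x y where "L = line (pt x y)"
  using assms unfolding ovoid_def by auto

lemma ptinf_ovoid: "line ptinf \<in> ovoid" and pt_ovoid: "line (pt x y) \<in> ovoid"
  unfolding ovoid_def by auto

lemma sz_S_nth [simp]:
  "sz_S n a b $ 1 = vector [1, 0, 0, 0]"
  "sz_S n a b $ 2 = vector [a, 1, 0, 0]"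
  "sz_S n a b $ 3 = vector [b, \<theta> a, 1, 0]"
  "sz_S n a b $ 4 = vector [quad a b, a * \<theta> a + b, a, 1]"
  unfolding sz_S_def quad_def by simp_all

lemma sz_T_nth [simp]:
  "(sz_T :: 'F ^ 4 ^ 4) $ 1 = vector [0, 0, 0, 1]"
  "(sz_T :: 'F ^ 4 ^ 4) $ 2 = vector [0, 0, 1, 0]"
  "(sz_T :: 'F ^ 4 ^ 4) $ 3 = vector [0, 1, 0, 0]"
  "(sz_T :: 'F ^ 4 ^ 4) $ 4 = vector [1, 0, 0, 0]"
  unfolding sz_T_def by simp_all

lemma sz_M_nth [simp]:
  "sz_M n l $ 1 = vector [l * half l, 0, 0, 0]"
  "sz_M n l $ 2 = vector [0, half l, 0, 0]"
  "sz_M n l $ 3 = vector [0, 0, inverse (half l), 0]"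
  "sz_M n l $ 4 = vector [0, 0, 0, inverse (l * half l)]"
  unfolding sz_M_eq by simp_all

text \<open>The fourth coordinate of \<open>sz_S n a b *v pt x y\<close>; this is why these matrices
  preserve the ovoid.\<close>

lemma quad_shift: "quad (a + x) (b + \<theta> a * x + y) = quad a b + (a * \<theta> a + b) * x + a * y + quad x y"
  unfolding quad_def
  by (simp add: theta_add theta_mult theta_theta power2_eq_square algebra_simps)

lemma sz_S_pt: "sz_S n a b *v pt x y = pt (a + x) (b + \<theta> a * x + y)"
  by (simp add: vec4_eq_iff matrix_vector_mult_4 quad_shift)

lemma sz_S_ptinf: "sz_S n a b *v ptinf = ptinf"
  by (simp add: vec4_eq_iff matrix_vector_mult_4)

lemma quad_scale:
  assumes "l \<noteq> 0"
  shows "quad (x / l) (y / (l * \<theta> l)) = quad x y / (l\<^sup>2 * \<theta> l)"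
  using assms unfolding quad_def
  by (simp add: theta_divide theta_mult theta_theta power_divide add_divide_distrib power2_eq_square mult_ac)

lemma sz_M_pt: "l \<noteq> 0 \<Longrightarrow> sz_M n l *v pt x y = (l * half l) *s pt (x / l) (y / (l * \<theta> l))"
  by (simp add: vec4_eq_iff matrix_vector_mult_4 quad_scale)
    (simp add: half_square[symmetric] power2_eq_square field_simps)

lemma sz_M_ptinf: "l \<noteq> 0 \<Longrightarrow> sz_M n l *v ptinf = inverse (l * half l) *s ptinf"
  by (simp add: vec4_eq_iff matrix_vector_mult_4)

lemma sz_T_ptinf: "sz_T *v ptinf = pt 0 0"
  by (simp add: vec4_eq_iff matrix_vector_mult_4)

text \<open>The identity that \<open>sz_T\<close> requires. With z the value of \<open>quad\<close>
  and after division by z \<theta>(z), it says that the point with affine coordinates y/z and x/z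
  has last coordinate 1/z. It also shows that z vanishes only at the origin.\<close>

lemma quad_theta: "quad x y * \<theta> (quad x y) = y\<^sup>2 * \<theta> y + x * y * \<theta> (quad x y) + \<theta> x * (quad x y)\<^sup>2"
  unfolding quad_def
  by (simp add: theta_add theta_mult theta_power theta_theta power2_eq_square algebra_simps)

lemma quad_eq_0_iff: "quad x y = 0 \<longleftrightarrow> x = 0 \<and> y = 0"
proof
  assume q: "quad x y = 0"
  then have "y\<^sup>2 * \<theta> y = 0" using quad_theta[of x y] by simp
  then have "y = 0" by simp
  then show "x = 0 \<and> y = 0" using q unfolding quad_def by simp
qed simp

lemma sz_T_pt:
  assumes "quad x y \<noteq> 0"
  shows "sz_T *v pt x y = quad x y *s pt (y / quad x y) (x / quad x y)"
proof -
  let ?z = "quad x y"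
  have tz: "\<theta> ?z \<noteq> 0" using assms by simp
  have "?z * \<theta> ?z * (?z * quad (y / ?z) (x / ?z)) = y\<^sup>2 * \<theta> y + x * y * \<theta> ?z + \<theta> x * ?z\<^sup>2"
    using assms tz unfolding quad_def[of "y / ?z"]
    by (simp add: theta_divide power_divide power2_eq_square distrib_left mult_ac)
  also have "\<dots> = ?z * \<theta> ?z" using quad_theta by simp
  finally have "?z * quad (y / ?z) (x / ?z) = 1" using assms tz by simp
  then show ?thesis using assms by (simp add: vec4_eq_iff matrix_vector_mult_4)
qed

lemma sz_T_pt_0: "sz_T *v pt 0 0 = ptinf"
  by (simp add: vec4_eq_iff matrix_vector_mult_4)

end

section \<open>The matrix group acting on the ovoid\<close>

context suzuki_field
begin

text \<open>Invariance of the bilinear form with Gram matrix \<open>sz_T\<close>. In characteristic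
  2 this form is alternating, so these are the symplectic matrices.\<close>

definition isometry :: "'F ^ 4 ^ 4 \<Rightarrow> bool" where
  "isometry g \<longleftrightarrow> transpose g ** sz_T ** g = sz_T"

text \<open>Stabilizers are computed in this larger group, defined by invariance properties alone; this
  avoids multiplying out \<open>T S T\<close> to obtain the Bruhat decomposition.\<close>
definition good :: "'F ^ 4 ^ 4 \<Rightarrow> bool" where
  "good g \<longleftrightarrow> isometry g \<and> (\<forall>L\<in>ovoid. act g L \<in> ovoid)"

lemma sz_T_square: "sz_T ** sz_T = (mat 1 :: 'F ^ 4 ^ 4)"
  by (simp add: vec4_eq_iff matrix_matrix_mult_4)

lemma isometry_entry:
  "isometry g \<Longrightarrow> g $ 4 $ i * g $ 1 $ j + g $ 3 $ i * g $ 2 $ j + g $ 2 $ i * g $ 3 $ j + g $ 1 $ i * g $ 4 $ j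
    = sz_T $ i $ j"
proof -
  assume "isometry g"
  then have "(transpose g ** sz_T ** g) $ i $ j = sz_T $ i $ j" unfolding isometry_def by simp
  then show ?thesis by (simp add: matrix_matrix_mult_4 transpose_def)
qed

lemma isometry_mult: "isometry g \<Longrightarrow> isometry h \<Longrightarrow> isometry (g ** h)"
proof -
  assume g: "isometry g" and h: "isometry h"
  have "transpose (g ** h) ** sz_T ** (g ** h) = transpose h ** (transpose g ** sz_T ** g) ** h"
    by (simp add: matrix_transpose_mul matrix_mul_assoc)
  then show ?thesis using g h unfolding isometry_def by simp
qed

lemma isometry_left_inverse:
  assumes "isometry g"
  shows "(sz_T ** transpose g ** sz_T) ** g = mat 1" "g ** (sz_T ** transpose g ** sz_T) = mat 1"
proof -
  have "(sz_T ** transpose g ** sz_T) ** g = sz_T ** (transpose g ** sz_T ** g)"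
    by (simp add: matrix_mul_assoc)
  then show *: "(sz_T ** transpose g ** sz_T) ** g = mat 1"
    using assms sz_T_square unfolding isometry_def by simp
  then show "g ** (sz_T ** transpose g ** sz_T) = mat 1" using matrix_left_right_inverse by blast
qed

lemma isometry_inverse:
  assumes g: "isometry g" and h: "h ** g = mat 1"
  shows "isometry h"
proof -
  have gh: "g ** h = mat 1" using h matrix_left_right_inverse by blast
  have "transpose h ** sz_T ** h = transpose h ** (transpose g ** sz_T ** g) ** h"
    using g unfolding isometry_def by simp
  also have "\<dots> = transpose (g ** h) ** sz_T ** (g ** h)"
    by (simp add: matrix_transpose_mul matrix_mul_assoc)
  finally show ?thesis unfolding isometry_def gh by (simp add: transpose_mat)
qed

lemma isometry_one: "isometry (mat 1)"
  unfolding isometry_def by (simp add: transpose_mat)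

lemma isometry_gens:
  "isometry (sz_S n a b)" "l \<noteq> 0 \<Longrightarrow> isometry (sz_M n l)" "isometry sz_T"
  unfolding isometry_def
  by (simp_all add: vec4_eq_iff matrix_matrix_mult_4 transpose_def algebra_simps)

lemma act_S_pt: "act (sz_S n a b) (line (pt x y)) = line (pt (a + x) (b + \<theta> a * x + y))"
  unfolding act_line sz_S_pt ..

lemma act_S_ptinf: "act (sz_S n a b) (line ptinf) = line ptinf"
  unfolding act_line sz_S_ptinf ..

lemma act_M_pt: "l \<noteq> 0 \<Longrightarrow> act (sz_M n l) (line (pt x y)) = line (pt (x / l) (y / (l * \<theta> l)))"
  unfolding act_line by (simp add: sz_M_pt line_scale)

lemma act_M_ptinf: "l \<noteq> 0 \<Longrightarrow> act (sz_M n l) (line ptinf) = line ptinf"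
  unfolding act_line by (simp add: sz_M_ptinf line_scale)

lemma act_T_pt:
  "quad x y \<noteq> 0 \<Longrightarrow> act sz_T (line (pt x y)) = line (pt (y / quad x y) (x / quad x y))"
  unfolding act_line by (simp add: sz_T_pt line_scale)

lemma act_T_base: "act sz_T (line ptinf) = line (pt 0 0)" "act sz_T (line (pt 0 0)) = line ptinf"
  unfolding act_line sz_T_ptinf sz_T_pt_0 by simp_all

lemma good_gens: "good (sz_S n a b)" "l \<noteq> 0 \<Longrightarrow> good (sz_M n l)" "good sz_T"
proof -
  show "good (sz_S n a b)" unfolding good_def
    by (auto simp: isometry_gens act_S_pt act_S_ptinf pt_ovoid ptinf_ovoid elim!: ovoidE)
  show "good (sz_M n l)" if "l \<noteq> 0" unfolding good_def
    using that by (auto simp: isometry_gens act_M_pt act_M_ptinf pt_ovoid ptinf_ovoid elim!: ovoidE)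
  have "act sz_T (line (pt x y)) \<in> ovoid" for x y
    by (cases "quad x y = 0") (auto simp: quad_eq_0_iff act_T_pt act_T_base pt_ovoid ptinf_ovoid)
  then show "good sz_T" unfolding good_def
    by (auto simp: isometry_gens act_T_base pt_ovoid elim!: ovoidE)
qed

lemma finite_ovoid: "finite ovoid"
  using card_ovoid by (intro card_ge_0_finite) simp

text \<open>An injective map of the finite ovoid into itself is onto, so the inverse preserves the
  ovoid too.\<close>

lemma good_inverse:
  assumes g: "good g" and h: "h ** g = mat 1"
  shows "good h"
proof -
  have inj: "inj_on (act g) ovoid"
    by (rule inj_on_inverseI[of _ "act h"]) (simp add: act_mult[symmetric] h act_one)
  have "act g ` ovoid \<subseteq> ovoid" using g unfolding good_def by blast
  then have surj: "act g ` ovoid = ovoid" 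
    using inj by (intro endo_inj_surj[OF finite_ovoid])
  have "act h L \<in> ovoid" if "L \<in> ovoid" for L
  proof -
    have "L \<in> act g ` ovoid" unfolding surj by (rule that)
    then obtain L' where "L' \<in> ovoid" "L = act g L'" by (rule imageE)
    then show ?thesis by (simp add: act_mult[symmetric] h act_one)
  qed
  then show ?thesis using isometry_inverse[OF _ h] g unfolding good_def by blast
qed

abbreviation Sz :: "('F ^ 4 ^ 4) set" where
  "Sz \<equiv> Suzuki n"

lemma Sz_good: "g \<in> Sz \<Longrightarrow> good g"
  unfolding Suzuki_def
proof (induction rule: gen_mat_group.induct)
  case one
  show ?case unfolding good_def by (simp add: isometry_one act_one)
next
  case (gen g)
  then show ?case unfolding sz_gens_def using good_gens by auto
next
  case (mult g h)
  then show ?case unfolding good_def by (simp add: isometry_mult act_mult)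
next
  case (inv g h)
  then show ?case using good_inverse by blast
qed

lemma Sz_gens: "sz_S n a b \<in> Sz" "l \<noteq> 0 \<Longrightarrow> sz_M n l \<in> Sz" "sz_T \<in> Sz"
  unfolding Suzuki_def sz_gens_def by (auto intro!: gen_mat_group.gen)

lemma Sz_closed: "mat 1 \<in> Sz" "g \<in> Sz \<Longrightarrow> h \<in> Sz \<Longrightarrow> g ** h \<in> Sz"
  "g \<in> Sz \<Longrightarrow> h ** g = mat 1 \<Longrightarrow> h \<in> Sz"
  unfolding Suzuki_def by (auto intro: gen_mat_group.intros)

lemma Sz_inverse:
  assumes "g \<in> Sz"
  obtains h where "h \<in> Sz" "h ** g = mat 1" "g ** h = mat 1"
  using isometry_left_inverse[of g] Sz_good[OF assms] Sz_closed(3)[OF assms] unfolding good_def by blast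

lemma act_ovoid: "g \<in> Sz \<Longrightarrow> L \<in> ovoid \<Longrightarrow> act g L \<in> ovoid"
  using Sz_good unfolding good_def by blast

text \<open>Products of \<open>sz_S\<close> and \<open>sz_T\<close> move the point at infinity
  anywhere else. Its stabilizer contains all \<open>sz_S\<close>, which move the origin to any
  affine point.\<close>

lemma Sz_trans2:
  assumes L: "L \<in> ovoid" "L' \<in> ovoid" "L \<noteq> L'"
  shows "\<exists>g\<in>Sz. act g (line ptinf) = L \<and> act g (line (pt 0 0)) = L'"
proof -
  obtain g where g: "g \<in> Sz" "act g (line ptinf) = L"
    using L(1)
  proof (cases rule: ovoidE)
    case 1
    then show ?thesis using that[of "mat 1"] Sz_closed act_one by simp
  next
    case (2 x y)
    have "act (sz_S n x y ** sz_T) (line ptinf) = L"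
      unfolding 2 by (simp add: act_mult act_T_base act_S_pt)
    then show ?thesis using that[of "sz_S n x y ** sz_T"] Sz_closed(2) Sz_gens by blast
  qed
  obtain h where h: "h \<in> Sz" "h ** g = mat 1" "g ** h = mat 1" using Sz_inverse[OF g(1)] by blast
  have hL: "act h L = line ptinf" unfolding g(2)[symmetric] by (simp add: act_mult[symmetric] h act_one)
  have "act h L' \<noteq> line ptinf"
  proof
    assume "act h L' = line ptinf"
    then have "act g (act h L') = L" using g by simp
    then show False using L(3) by (simp add: act_mult[symmetric] h act_one)
  qed
  then obtain x y where xy: "act h L' = line (pt x y)" using ovoidE[OF act_ovoid[OF h(1) L(2)]] by metis
  have "act (g ** sz_S n x y) (line (pt 0 0)) = act g (act h L')"
    unfolding xy by (simp add: act_mult act_S_pt)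
  also have "\<dots> = L'" by (simp add: act_mult[symmetric] h act_one)
  finally have "act (g ** sz_S n x y) (line (pt 0 0)) = L'" .
  moreover have "act (g ** sz_S n x y) (line ptinf) = L" by (simp add: act_mult act_S_ptinf g)
  ultimately show ?thesis using Sz_closed(2)[OF g(1) Sz_gens(1)] by blast
qed

text \<open>Write N = 2^(n+1). For n \<ge> 1 the exponents N + 2, N and 2 are distinct and N + 2 is
  below the field order, which is at least 2N. A polynomial vanishing everywhere then has zero
  coefficients.\<close>

lemma three_term_zero:
  assumes "\<And>y :: 'F. A * (y\<^sup>2 * \<theta> y) + B * y\<^sup>2 + D * \<theta> y = 0"
  shows "A = 0 \<and> D = 0"
proof -
  let ?N = "2 ^ (n + 1) :: nat"
  let ?p = "Polynomial.monom A (?N + 2) + Polynomial.monom B 2 + Polynomial.monom D ?N"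
  have "(2::nat) ^ 2 \<le> ?N" using n1 by (intro power_increasing) auto
  then have N4: "?N \<ge> 4" by simp
  have "poly ?p y = 0" for y
    using assms[of y] by (simp add: poly_monom sz_theta_def power_add power2_eq_square algebra_simps)
  then have all: "{x. poly ?p x = 0} = UNIV" by blast
  have deg: "degree ?p \<le> ?N + 2"
    using N4 by (intro degree_add_le order_trans[OF degree_monom_le]) auto
  have p0: "?p = 0"
  proof (rule ccontr)
    assume "?p \<noteq> 0"
    then have "CARD('F) \<le> ?N + 2" using card_poly_roots_bound[of ?p] deg all by simp
    moreover have "CARD('F) = 2 ^ n * ?N" unfolding cardF by (simp add: mult_2 power_add distrib_left distrib_right)
    moreover have "2 * ?N \<le> 2 ^ n * ?N"
      using n1 power_increasing[of 1 n "2::nat"] by (intro mult_le_mono1) simp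
    ultimately show False using N4 by linarith
  qed
  have "Polynomial.coeff ?p (?N + 2) = 0" "Polynomial.coeff ?p ?N = 0" unfolding p0 by simp_all
  moreover have "Polynomial.coeff ?p (?N + 2) = A" "Polynomial.coeff ?p ?N = D" using N4 n1 by simp_all
  ultimately show ?thesis by simp
qed

text \<open>The form makes \<open>g\<close> block diagonal, with c and 1/c at the ends. Invariance
  of the ovoid becomes an identity for \<open>quad\<close> in two variables, which determines the
  middle block.\<close>

lemma stabilizer_base:
  assumes g: "good g" and inf: "act g (line ptinf) = line ptinf" and zero: "act g (line (pt 0 0)) = line (pt 0 0)"
  shows "\<exists>l. l \<noteq> 0 \<and> g = sz_M n l"
proof -
  have iso: "isometry g" using g unfolding good_def by blast
  note e = isometry_entry[OF iso]
  obtain d where d: "g *v ptinf = d *s ptinf" using inf line_eqD unfolding act_line by blast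
  obtain c where c: "g *v pt 0 0 = c *s pt 0 0" using zero line_eqD unfolding act_line by blast
  have col4: "g $ 1 $ 4 = 0" "g $ 2 $ 4 = 0" "g $ 3 $ 4 = 0" "g $ 4 $ 4 = d"
    using d by (simp_all add: vec4_eq_iff matrix_vector_mult_4)
  have col1: "g $ 1 $ 1 = c" "g $ 2 $ 1 = 0" "g $ 3 $ 1 = 0" "g $ 4 $ 1 = 0"
    using c by (simp_all add: vec4_eq_iff matrix_vector_mult_4)
  have cd: "c * d = 1" using e[of 1 4] col1 col4 by simp
  then have cd0: "c \<noteq> 0" "d \<noteq> 0" by auto
  have d': "d = 1 / c" using cd cd0 by (simp add: field_simps)
  have row: "g $ 4 $ 2 = 0" "g $ 4 $ 3 = 0" "g $ 1 $ 2 = 0" "g $ 1 $ 3 = 0"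
    using e[of 1 2] e[of 1 3] e[of 4 2] e[of 4 3] col1 col4 cd0 by simp_all
  \<comment> \<open>Every affine point has an image with first coordinate c, so dividing by c makes
    the block act on affine coordinates.\<close>
  define p s t u where "p = g $ 2 $ 2 / c" and "s = g $ 2 $ 3 / c" and "t = g $ 3 $ 2 / c" and "u = g $ 3 $ 3 / c"
  have mid: "g $ 2 $ 2 = c * p" "g $ 2 $ 3 = c * s" "g $ 3 $ 2 = c * t" "g $ 3 $ 3 = c * u"
    unfolding p_def s_def t_def u_def using cd0 by simp_all
  have q: "quad (p * x + s * y) (t * x + u * y) = quad x y / c\<^sup>2" for x y
  proof -
    have "act g (line (pt x y)) \<in> ovoid" using g pt_ovoid unfolding good_def by blast
    then show ?thesis
    proof (cases rule: ovoidE)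
      case 1
      then obtain k where "g *v pt x y = k *s ptinf" using line_eqD unfolding act_line by blast
      then show ?thesis using cd0 col1 col4 row by (simp add: vec4_eq_iff matrix_vector_mult_4)
    next
      case (2 x' y')
      then obtain k where k: "g *v pt x y = k *s pt x' y'" using line_eqD unfolding act_line by blast
      have comp: "(g *v pt x y) $ i = (k *s pt x' y') $ i" for i using k by simp
      have ck: "c = k" using comp[of 1] col1 col4 row by (simp add: matrix_vector_mult_4)
      have "c * p * x + c * s * y = c * x'" "c * t * x + c * u * y = c * y'" "d * quad x y = c * quad x' y'"
        using comp[of 2] comp[of 3] comp[of 4] col1 col4 row mid unfolding ck
        by (simp_all add: matrix_vector_mult_4)
      then have "c * (p * x + s * y) = c * x'" "c * (t * x + u * y) = c * y'" "quad x' y' = quad x y / c\<^sup>2"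
        using cd0 unfolding d' by (simp_all add: algebra_simps power2_eq_square field_simps)
      then show ?thesis using cd0 by simp
    qed
  qed
  \<comment> \<open>The identity at x = 0; in characteristic 2 an equality is a vanishing
    sum.\<close>
  have "(s\<^sup>2 * \<theta> s) * (y\<^sup>2 * \<theta> y) + (s * u) * y\<^sup>2 + (\<theta> u + 1 / c\<^sup>2) * \<theta> y = 0" for y
  proof -
    have "(s\<^sup>2 * \<theta> s) * (y\<^sup>2 * \<theta> y) + (s * u) * y\<^sup>2 + (\<theta> u + 1 / c\<^sup>2) * \<theta> y
        = quad (p * 0 + s * y) (t * 0 + u * y) + quad 0 y / c\<^sup>2"
      unfolding quad_def by (simp add: theta_mult power2_eq_square algebra_simps)
    then show ?thesis unfolding q by simp
  qed
  from three_term_zero[OF this] have s0: "s = 0" by simp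
  \<comment> \<open>The identity at y = 0, which yields t = 0 and the relation between p and
    c.\<close>
  have "(p\<^sup>2 * \<theta> p + 1 / c\<^sup>2) * (x\<^sup>2 * \<theta> x) + (p * t) * x\<^sup>2 + \<theta> t * \<theta> x = 0" for x
  proof -
    have "(p\<^sup>2 * \<theta> p + 1 / c\<^sup>2) * (x\<^sup>2 * \<theta> x) + (p * t) * x\<^sup>2 + \<theta> t * \<theta> x
        = quad (p * x + s * 0) (t * x + u * 0) + quad x 0 / c\<^sup>2"
      unfolding quad_def by (simp add: theta_mult power2_eq_square algebra_simps)
    then show ?thesis unfolding q by simp
  qed
  from three_term_zero[OF this] have t0: "t = 0" and pc: "p\<^sup>2 * \<theta> p = 1 / c\<^sup>2"
    by (simp_all add: add_eq_zero_iff)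
  have "p \<noteq> 0" using pc cd0 by auto
  \<comment> \<open>\<open>sz_M n l\<close> divides the first affine coordinate by l, so l has to be
    1/p.\<close>
  define l where "l = 1 / p"
  have l0: "l \<noteq> 0" unfolding l_def using \<open>p \<noteq> 0\<close> by simp
  have "c\<^sup>2 = (l * half l)\<^sup>2"
    using pc cd0 \<open>p \<noteq> 0\<close> unfolding power_mult_distrib half_square l_def
    by (simp add: theta_divide power_divide field_simps)
  then have cl: "c = l * half l" using square_inj by blast
  have g22: "g $ 2 $ 2 = half l" using mid(1) cl \<open>p \<noteq> 0\<close> by (simp add: l_def)
  have "g $ 3 $ 3 * g $ 2 $ 2 = 1" using e[of 3 2] row mid s0 t0 by (simp add: mult.commute)
  then have g33: "g $ 3 $ 3 = inverse (half l)" unfolding g22 by (metis inverse_unique mult.commute)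
  have "g = sz_M n l"
    using col1 col4 row g22 g33 mid s0 t0 cl d' l0 by (simp add: vec4_eq_iff field_simps)
  then show ?thesis using l0 by blast
qed

lemma M_one: "sz_M n 1 = (mat 1 :: 'F ^ 4 ^ 4)"
  by (simp add: vec4_eq_iff)

lemma M_inj: "l \<noteq> 0 \<Longrightarrow> sz_M n l = sz_M n l' \<longleftrightarrow> l = (l' :: 'F)"
proof
  assume l: "l \<noteq> 0" and eq: "sz_M n l = sz_M n l'"
  have "l * half l = l' * half l'" using arg_cong[OF eq, of "\<lambda>A. A $ 1 $ 1"] by simp
  moreover have "half l = half l'" using arg_cong[OF eq, of "\<lambda>A. A $ 2 $ 2"] by simp
  ultimately have "l * half l = l' * half l" by (simp only:)
  moreover have "half l \<noteq> 0" using l by simp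
  ultimately show "l = l'" by (metis mult_right_cancel)
qed simp


lemma M_commute: "sz_M n l ** sz_M n l' = sz_M n l' ** sz_M n (l :: 'F)"
  by (simp add: vec4_eq_iff matrix_matrix_mult_4 mult_ac)

lemma M_fixed_pt:
  assumes l: "l \<noteq> 0" "l \<noteq> 1" and fx: "act (sz_M n l) (line (pt x y)) = line (pt x y)"
  shows "x = 0 \<and> y = 0"
proof -
  have xy: "x / l = x" "y / (l * \<theta> l) = y" using fx l by (simp_all add: act_M_pt)
  then have "x = l * x" "y = (l * \<theta> l) * y" using l by (simp_all add: field_simps)
  then show ?thesis using l mult_theta_eq_1[of l] by simp
qed

text \<open>An element exchanging the base points is \<open>sz_T\<close> times some
  \<open>sz_M n k\<close>, and \<open>sz_T\<close> inverts the diagonal matrices. Commuting would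
  make \<open>half l\<close> its own inverse, hence 1, because squaring is injective.\<close>

lemma M_swap:
  assumes l: "l \<noteq> 0" "l \<noteq> 1" and h: "h \<in> Sz" "act h (line ptinf) = line (pt 0 0)" "act h (line (pt 0 0)) = line ptinf"
  shows "h ** sz_M n l \<noteq> sz_M n l ** h"
proof
  assume comm: "h ** sz_M n l = sz_M n l ** h"
  have "good (sz_T ** h)" using Sz_good Sz_closed(2) Sz_gens(3) h(1) by blast
  moreover have "act (sz_T ** h) (line ptinf) = line ptinf" "act (sz_T ** h) (line (pt 0 0)) = line (pt 0 0)"
    using h by (simp_all add: act_mult act_T_base)
  ultimately obtain k where k: "k \<noteq> 0" "sz_T ** h = sz_M n k" using stabilizer_base by blast
  have hk: "h = sz_T ** sz_M n k"
    using k(2) sz_T_square by (metis matrix_mul_assoc matrix_mul_lid)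
  have m1: "(h ** sz_M n l) $ 3 $ 2 = half k * half l" unfolding hk by (simp add: matrix_matrix_mult_4)
  have m2: "(sz_M n l ** h) $ 3 $ 2 = inverse (half l) * half k" unfolding hk by (simp add: matrix_matrix_mult_4)
  have "half k * half l = half k * inverse (half l)" using m1 m2 comm by (metis mult.commute)
  then have "half l = inverse (half l)" using k(1) by (metis half_eq_0_iff mult_left_cancel)
  then have "(half l)\<^sup>2 = 1" using l by (simp add: power2_eq_square field_simps)
  then have "half l = 1" using square_inj[of "half l" 1] by simp
  then show False using theta_half[of l] l by simp
qed

section \<open>The Sylow 2-subgroup fixing the point at infinity\<close>

lemma S_mult: "sz_S n a b ** sz_S n c d = sz_S n (a + c) (b + d + \<theta> a * c)"
proof -
  have "quad (a + c) (b + d + \<theta> a * c) = quad a b + (a * \<theta> a + b) * c + a * d + quad c d"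
    using quad_shift[of a c b d] by (simp add: add_ac)
  then show ?thesis
    by (simp add: vec4_eq_iff matrix_matrix_mult_4 theta_add algebra_simps)
qed

lemma S_inj: "sz_S n a b = sz_S n c d \<longleftrightarrow> a = c \<and> b = (d :: 'F)"
  by (auto simp: vec4_eq_iff)

lemma S_zero: "sz_S n 0 0 = (mat 1 :: 'F ^ 4 ^ 4)"
  by (simp add: vec4_eq_iff)

text \<open>For nonzero a and c, commuting means that a/c is fixed by \<theta>, and only 0 and 1
  are. Outside the centre, commuting is therefore equality of the first parameters.\<close>

lemma S_comm_iff: "sz_S n a b ** sz_S n c d = sz_S n c d ** sz_S n a b \<longleftrightarrow> a = 0 \<or> c = 0 \<or> a = (c :: 'F)"
proof -
  have "sz_S n a b ** sz_S n c d = sz_S n c d ** sz_S n a b \<longleftrightarrow> \<theta> a * c = \<theta> c * a"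
    unfolding S_mult S_inj by (auto simp: add_ac)
  also have "\<dots> \<longleftrightarrow> a = 0 \<or> c = 0 \<or> a = c"
  proof (cases "a = 0 \<or> c = 0")
    case True
    then show ?thesis by auto
  next
    case False
    then have "\<theta> a * c = \<theta> c * a \<longleftrightarrow> \<theta> (a / c) = a / c"
      by (simp add: theta_divide field_simps)
    then show ?thesis using False theta_fixed[of "a / c"] by simp
  qed
  finally show ?thesis .
qed

text \<open>An element fixing infinity is a product of some \<open>sz_S n a b\<close> and
  \<open>sz_M n l\<close>. For l different from 1 its affine action has a fixed point, so only the
  \<open>sz_S\<close> remain; these translate without fixed points unless trivial.\<close>

lemma fixes_only_ptinf:
  assumes g: "g \<in> Sz"
  shows "{L \<in> ovoid. act g L = L} = {line ptinf} \<and> g \<noteq> mat 1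
    \<longleftrightarrow> (\<exists>a b. g = sz_S n a b \<and> (a, b) \<noteq> (0, 0))"
proof
  assume L: "{L \<in> ovoid. act g L = L} = {line ptinf} \<and> g \<noteq> mat 1"
  then have inf: "act g (line ptinf) = line ptinf" by blast
  have nopt: "act g (line (pt x y)) \<noteq> line (pt x y)" for x y
  proof
    assume "act g (line (pt x y)) = line (pt x y)"
    then have "line (pt x y) \<in> {line ptinf}" using L pt_ovoid by blast
    then show False by simp
  qed
  obtain h where h: "h \<in> Sz" "h ** g = mat 1" "g ** h = mat 1" using Sz_inverse[OF g] by blast
  have "act g (line (pt 0 0)) \<noteq> line ptinf"
  proof
    assume "act g (line (pt 0 0)) = line ptinf"
    then have "act h (act g (line (pt 0 0))) = act h (act g (line ptinf))" using inf by simp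
    then show False by (simp add: act_mult[symmetric] h act_one)
  qed
  then obtain a b where ab: "act g (line (pt 0 0)) = line (pt a b)"
    using ovoidE[OF act_ovoid[OF g pt_ovoid]] by metis
  obtain s where s: "s \<in> Sz" "s ** sz_S n a b = mat 1" "sz_S n a b ** s = mat 1"
    using Sz_inverse[OF Sz_gens(1)] by blast
  have "act s (line ptinf) = act s (act (sz_S n a b) (line ptinf))" unfolding act_S_ptinf ..
  then have "act (s ** g) (line ptinf) = line ptinf"
    using inf by (simp add: act_mult) (simp add: act_mult[symmetric] s act_one)
  moreover have "act (s ** g) (line (pt 0 0)) = line (pt 0 0)"
  proof -
    have "act (s ** g) (line (pt 0 0)) = act s (act (sz_S n a b) (line (pt 0 0)))"
      using ab by (simp add: act_mult act_S_pt)
    then show ?thesis by (simp add: act_mult[symmetric] s act_one)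
  qed
  moreover have "good (s ** g)" using Sz_good Sz_closed(2) s g by blast
  ultimately obtain l where l: "l \<noteq> 0" "s ** g = sz_M n l" using stabilizer_base by blast
  have gl: "g = sz_S n a b ** sz_M n l"
    using l(2) s(3) by (metis matrix_mul_assoc matrix_mul_lid)
  have "l = 1"
  proof (rule ccontr)
    assume l1: "l \<noteq> 1"
    have e1: "1 + 1 / l \<noteq> 0" using l1 l(1) by (simp add: add_eq_zero_iff field_simps)
    have e2: "1 + 1 / (l * \<theta> l) \<noteq> 0"
    proof -
      have "l * \<theta> l \<noteq> 1" using l1 mult_theta_eq_1 by blast
      then show ?thesis using l(1) by (simp add: add_eq_zero_iff field_simps)
    qed
    \<comment> \<open>Solutions of x = a + x/l and y = b + \<theta>(a) x/l + y/(l \<theta>(l)). The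
      denominators are nonzero by \<open>e1\<close> and \<open>e2\<close>.\<close>
    define x where "x = a / (1 + 1 / l)"
    define y where "y = (b + \<theta> a * (x / l)) / (1 + 1 / (l * \<theta> l))"
    have "x * (1 + 1 / l) = a" unfolding x_def using e1 by simp
    then have x: "a + x / l = x" by (auto simp: algebra_simps)
    have "y * (1 + 1 / (l * \<theta> l)) = b + \<theta> a * (x / l)" unfolding y_def using e2 by simp
    then have "b + \<theta> a * (x / l) = y + y / (l * \<theta> l)" by (simp add: distrib_left)
    then have y: "b + \<theta> a * (x / l) + y / (l * \<theta> l) = y" by (simp add: add_ac)
    have "act g (line (pt x y)) = line (pt x y)"
      unfolding gl act_mult using l(1) x y by (simp add: act_M_pt act_S_pt)
    then show False using nopt by blast
  qed
  then have "g = sz_S n a b" using gl M_one by simp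
  moreover have "(a, b) \<noteq> (0, 0)" using L calculation S_zero by auto
  ultimately show "\<exists>a b. g = sz_S n a b \<and> (a, b) \<noteq> (0, 0)" by blast
next
  assume "\<exists>a b. g = sz_S n a b \<and> (a, b) \<noteq> (0, 0)"
  then obtain a b where ab: "g = sz_S n a b" "(a, b) \<noteq> (0, 0)" by blast
  have "act g (line (pt x y)) \<noteq> line (pt x y)" for x y
  proof
    assume "act g (line (pt x y)) = line (pt x y)"
    then have e: "a + x = x \<and> b + \<theta> a * x + y = y" unfolding ab act_S_pt line_pt_eq .
    then have "a = 0" by simp
    moreover have "b = 0" using conjunct2[OF e] unfolding \<open>a = 0\<close> by simp
    ultimately show False using ab(2) by simp
  qed
  then have "{L \<in> ovoid. act g L = L} = {line ptinf}"
  proof (intro equalityI subsetI)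
    fix L assume "L \<in> {line ptinf}"
    then show "L \<in> {L \<in> ovoid. act g L = L}" by (simp add: ptinf_ovoid act_S_ptinf ab(1))
  next
    fix L assume L: "L \<in> {L \<in> ovoid. act g L = L}"
    then have "L \<in> ovoid" by blast
    then show "L \<in> {line ptinf}"
    proof (cases rule: ovoidE)
      case (2 x y)
      then show ?thesis using L \<open>\<And>x y. act g (line (pt x y)) \<noteq> line (pt x y)\<close> by blast
    qed simp
  qed
  moreover have "g \<noteq> mat 1" using ab S_zero S_inj by (metis prod.inject)
  ultimately show "{L \<in> ovoid. act g L = L} = {line ptinf} \<and> g \<noteq> mat 1" by blast
qed

end

section \<open>The Suzuki group as an action of Suzuki type\<close>

text \<open>Elements giving the same conjugate form a left coset of the centralizer. A bound on
  conjugates thereby becomes the bound on conjugating elements in \<open>norm_bound\<close>.\<close>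

lemma (in group) card_conjugates_cent:
  assumes fin: "finite (carrier G)" and z: "z \<in> carrier G"
  defines "X \<equiv> {x \<in> carrier G. x \<otimes> z \<otimes> inv x \<in> cent z}"
  shows "card ((\<lambda>x. x \<otimes> z \<otimes> inv x) ` X) * card (cent z) = card X"
proof (rule card_image_fibres)
  show "finite X" using fin unfolding X_def by simp
  fix x assume x: "x \<in> X"
  then have xc: "x \<in> carrier G" unfolding X_def by simp
  have "{y \<in> X. y \<otimes> z \<otimes> inv y = x \<otimes> z \<otimes> inv x} = (\<lambda>c. x \<otimes> c) ` cent z"
  proof
    show "(\<lambda>c. x \<otimes> c) ` cent z \<subseteq> {y \<in> X. y \<otimes> z \<otimes> inv y = x \<otimes> z \<otimes> inv x}"
    proof (rule image_subsetI)
      fix c assume "c \<in> cent z"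
      then have c: "c \<in> carrier G" "c \<otimes> z = z \<otimes> c" unfolding cent_def by auto
      have "c \<otimes> z \<otimes> inv c = z" using c z by (simp add: m_assoc)
      then have "(x \<otimes> c) \<otimes> z \<otimes> inv (x \<otimes> c) = x \<otimes> z \<otimes> inv x"
        using conj_conj[OF xc c(1) z] by simp
      then show "x \<otimes> c \<in> {y \<in> X. y \<otimes> z \<otimes> inv y = x \<otimes> z \<otimes> inv x}"
        using x xc c(1) unfolding X_def by simp
    qed
    show "{y \<in> X. y \<otimes> z \<otimes> inv y = x \<otimes> z \<otimes> inv x} \<subseteq> (\<lambda>c. x \<otimes> c) ` cent z"
    proof
      fix y assume "y \<in> {y \<in> X. y \<otimes> z \<otimes> inv y = x \<otimes> z \<otimes> inv x}"
      then have y: "y \<in> carrier G" "y \<otimes> z \<otimes> inv y = x \<otimes> z \<otimes> inv x" unfolding X_def by auto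
      let ?c = "inv x \<otimes> y"
      have cc: "?c \<in> carrier G" using xc y by simp
      have "?c \<otimes> z \<otimes> inv ?c = inv x \<otimes> (x \<otimes> z \<otimes> inv x) \<otimes> inv (inv x)"
        using conj_conj[of "inv x" y z] xc y z by simp
      then have "?c \<otimes> z \<otimes> inv ?c = z" using conj_inv_cancel[OF xc z] by simp
      then have "?c \<otimes> z = z \<otimes> ?c" using inv_solve_right'[of z "?c \<otimes> z" ?c] cc z by simp
      then have "?c \<in> cent z" using cc unfolding cent_def by simp
      moreover have "y = x \<otimes> ?c" using xc y by (simp add: m_assoc[symmetric])
      ultimately show "y \<in> (\<lambda>c. x \<otimes> c) ` cent z" by blast
    qed
  qed
  moreover have "inj_on (\<lambda>c. x \<otimes> c) (cent z)" 
    using xc cent_subset[of z] by (intro inj_onI) (simp add: subset_iff)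
  ultimately show "card {y \<in> X. y \<otimes> z \<otimes> inv y = x \<otimes> z \<otimes> inv x} = card (cent z)"
    by (simp add: card_image)
qed

context suzuki_field
begin

definition SG :: "('F ^ 4 ^ 4) monoid" where
  "SG = \<lparr>carrier = Sz, monoid.mult = (**), one = mat 1\<rparr>"

lemma SG_simps [simp]: "carrier SG = Sz" "x \<otimes>\<^bsub>SG\<^esub> y = x ** y" "\<one>\<^bsub>SG\<^esub> = mat 1"
  unfolding SG_def by simp_all

lemma group_SG: "group SG"
proof (rule groupI)
  fix x assume "x \<in> carrier SG"
  then show "\<exists>y\<in>carrier SG. y \<otimes>\<^bsub>SG\<^esub> x = \<one>\<^bsub>SG\<^esub>" using Sz_inverse[of x] by auto
qed (auto simp: Sz_closed(1,2) matrix_mul_assoc)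

lemma funpow_matrix: "(((*v) g) ^^ k) v = (g [^]\<^bsub>SG\<^esub> k) *v v" if "g \<in> Sz" for k :: nat
proof (induction k arbitrary: v)
  case 0
  show ?case by (simp add: group.is_monoid[OF group_SG])
next
  case (Suc k)
  have "(((*v) g) ^^ Suc k) v = (((*v) g) ^^ k) (g *v v)" by (simp add: funpow_swap1)
  then show ?case using Suc[of "g *v v"] by (simp add: matrix_vector_mul_assoc)
qed

lemma q_ge8: "CARD('F) \<ge> 8"
proof -
  have "(2::nat) ^ 3 \<le> 2 ^ (2 * n + 1)" using n1 by (intro power_increasing) auto
  then show ?thesis unfolding cardF by simp
qed

lemma q_even: "even CARD('F)"
  unfolding cardF by simp

text \<open>Despite the name, only the nonidentity elements of the Sylow 2-subgroup; the shape is
  that of the sets in \<open>card_U\<close> and \<open>forests_U\<close>.\<close>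

definition Usub :: "('F ^ 4 ^ 4) set" where
  "Usub = {g \<in> Sz - {mat 1}. {L \<in> ovoid. act g L = L} = {line ptinf}}"

lemma Usub_eq: "Usub = (\<lambda>(a, b). sz_S n a b) ` (UNIV - {(0, 0)})"
proof
  show "Usub \<subseteq> (\<lambda>(a, b). sz_S n a b) ` (UNIV - {(0, 0)})"
  proof
    fix g assume "g \<in> Usub"
    then obtain a b where "g = sz_S n a b" "(a, b) \<noteq> (0, 0)"
      using fixes_only_ptinf[of g] unfolding Usub_def by blast
    then show "g \<in> (\<lambda>(a, b). sz_S n a b) ` (UNIV - {(0, 0)})" by force
  qed
  show "(\<lambda>(a, b). sz_S n a b) ` (UNIV - {(0, 0)}) \<subseteq> Usub"
  proof (rule image_subsetI)
    fix p :: "'F \<times> 'F" assume "p \<in> UNIV - {(0, 0)}"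
    then obtain a b where p: "p = (a, b)" "(a, b) \<noteq> (0, 0)" by (cases p) auto
    have "sz_S n a b \<in> Sz" by (rule Sz_gens(1))
    then show "(case p of (a, b) \<Rightarrow> sz_S n a b) \<in> Usub"
      using fixes_only_ptinf[of "sz_S n a b"] p unfolding Usub_def by auto
  qed
qed

lemma card_Usub: "card Usub = CARD('F)\<^sup>2 - 1"
proof -
  have "inj_on (\<lambda>(a, b). sz_S n a b :: 'F ^ 4 ^ 4) (UNIV - {(0, 0)})"
    by (auto simp: inj_on_def S_inj)
  then have "card Usub = card (UNIV - {(0, 0)} :: ('F \<times> 'F) set)"
    unfolding Usub_eq by (rule card_image)
  also have "\<dots> = card (UNIV :: ('F \<times> 'F) set) - 1" by (rule card_Diff_singleton) simp
  finally show ?thesis by (simp add: card_prod power2_eq_square)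
qed

text \<open>The centre of the Sylow subgroup is joined to everything, and the remaining elements fall
  into \<open>q - 1\<close> cliques of size \<open>q\<close> according to the parameter \<open>a\<close>.\<close>
lemma card_forests_Usub:
  "card (forests Usub (\<lambda>x y. x ** y = y ** x) {mat 1}) = 2 ^ ((CARD('F) - 1)\<^sup>2) * CARD('F) ^ (CARD('F)\<^sup>2 + CARD('F) - 3)"
proof -
  let ?A = "\<lambda>x y :: 'F ^ 4 ^ 4. x ** y = y ** x"
  \<comment> \<open>\<open>?W\<close> is the centre without the identity, and \<open>?B a\<close>
    runs through the cosets of the centre.\<close>
  let ?W = "(\<lambda>b. sz_S n 0 b :: 'F ^ 4 ^ 4) ` (UNIV - {0})"
  let ?B = "\<lambda>a. (\<lambda>b. sz_S n a b :: 'F ^ 4 ^ 4) ` UNIV"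
  let ?V = "\<Union>a\<in>UNIV - {0}. ?B a"
  have U: "Usub = ?W \<union> ?V"
  proof
    show "Usub \<subseteq> ?W \<union> ?V"
      unfolding Usub_eq
    proof (rule image_subsetI)
      fix p :: "'F \<times> 'F" assume "p \<in> UNIV - {(0, 0)}"
      then obtain a b where p: "p = (a, b)" "a = 0 \<Longrightarrow> b \<noteq> 0" by (cases p) auto
      show "(case p of (a, b) \<Rightarrow> sz_S n a b) \<in> ?W \<union> ?V" using p by (cases "a = 0") auto
    qed
    show "?W \<union> ?V \<subseteq> Usub" unfolding Usub_eq by force
  qed
  have inj: "inj_on (\<lambda>b. sz_S n a b :: 'F ^ 4 ^ 4) X" for a X by (auto simp: inj_on_def S_inj)
  have cW: "card ?W = CARD('F) - 1" by (simp add: card_image[OF inj])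
  have cB: "card (?B a) = CARD('F)" for a by (rule card_image[OF inj])
  have cV: "card ?V = (CARD('F) - 1) * CARD('F)"
  proof -
    have "card ?V = (\<Sum>a\<in>UNIV - {0}. card (?B a))"
      by (intro card_UN_disjoint) (auto simp: S_inj)
    then show ?thesis unfolding cB by simp
  qed
  have one: "mat 1 \<notin> ?W" "mat 1 \<notin> ?V" unfolding S_zero[symmetric] by (auto simp: S_inj)
  have disj: "?W \<inter> ?V = {}" by (auto simp: S_inj)
  have "(card {mat 1 :: 'F ^ 4 ^ 4} + card ?W) * card (forests (?W \<union> ?V) ?A {mat 1})
      = card {mat 1 :: 'F ^ 4 ^ 4} * (card {mat 1 :: 'F ^ 4 ^ 4} + card ?V + card ?W) ^ card ?W
        * card (forests ?V ?A (?W \<union> {mat 1}))"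
  proof (rule card_forests_multicone)
    show "?A u w \<and> ?A w u" if "w \<in> ?W" "u \<in> ?W \<union> ?V" for w u
      using that by (auto simp: S_comm_iff)
  qed (use one disj in auto)
  moreover have "card (forests ?V ?A (?W \<union> {mat 1})) = (CARD('F) * (CARD('F) + CARD('F)) ^ (CARD('F) - 1)) ^ (CARD('F) - 1)"
  proof -
    \<comment> \<open>The roots for each clique are the whole centre with the identity: q roots and
      q vertices.\<close>
    have cR: "card (?W \<union> {mat 1}) = CARD('F)" using one cW q_ge8 by simp
    have "card (forests ?V ?A (?W \<union> {mat 1})) = (\<Prod>a\<in>UNIV - {0}. card (forests (?B a) ?A (?W \<union> {mat 1})))"
    proof (rule card_forests_UN)
      show "?B a \<inter> ?B a' = {}" if "a \<noteq> a'" for a a' using that by (auto simp: S_inj)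
      show "?B a \<inter> (?W \<union> {mat 1}) = {}" if "a \<in> UNIV - {0}" for a
        using that unfolding S_zero[symmetric] by (auto simp: S_inj)
      show "\<not> ?A v w" if "a \<in> UNIV - {0}" "a' \<in> UNIV - {0}" "a \<noteq> a'" "v \<in> ?B a" "w \<in> ?B a'" for a a' v w
        using that by (auto simp: S_comm_iff)
    qed simp
    also have "\<dots> = (\<Prod>a\<in>UNIV - {0 :: 'F}. CARD('F) * (CARD('F) + CARD('F)) ^ (CARD('F) - 1))"
    proof (rule prod.cong[OF refl])
      fix a :: 'F assume a: "a \<in> UNIV - {0}"
      have "card (forests (?B a) ?A (?W \<union> {mat 1}))
          = card (?W \<union> {mat 1}) * (card (?W \<union> {mat 1}) + card (?B a)) ^ (card (?B a) - 1)"
      proof (rule card_forests_complete)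
        show "?B a \<inter> (?W \<union> {mat 1}) = {}" using a unfolding S_zero[symmetric] by (auto simp: S_inj)
        show "?A u v" if "u \<in> ?B a" "v \<in> ?B a" for u v using that by (auto simp: S_comm_iff)
      qed auto
      then show "card (forests (?B a) ?A (?W \<union> {mat 1})) = CARD('F) * (CARD('F) + CARD('F)) ^ (CARD('F) - 1)"
        unfolding cR cB .
    qed
    finally show ?thesis by simp
  qed
  ultimately have F: "(1 + (CARD('F) - 1)) * card (forests Usub ?A {mat 1})
      = (1 + (CARD('F) - 1) * CARD('F) + (CARD('F) - 1)) ^ (CARD('F) - 1)
        * (CARD('F) * (CARD('F) + CARD('F)) ^ (CARD('F) - 1)) ^ (CARD('F) - 1)"
    unfolding U cW cV by simp
  \<comment> \<open>With m = q - 1 the total number of vertices, 1 + mq + m, becomes q^2.\<close>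
  obtain m where m: "CARD('F) = m + 1" using q_ge8 le_Suc_ex[of 1 "CARD('F)"] by (auto simp: add.commute)
  have "1 + (CARD('F) - 1) = CARD('F)" "CARD('F) - 1 = m" "CARD('F) + CARD('F) = 2 * CARD('F)"
    "1 + m * CARD('F) + m = CARD('F) * CARD('F)"
    unfolding m by (simp_all add: algebra_simps)
  then have "CARD('F) * card (forests Usub ?A {mat 1})
      = (CARD('F) * CARD('F)) ^ m * (CARD('F) * (2 * CARD('F)) ^ m) ^ m"
    using F by (simp only:)
  \<comment> \<open>One factor q is set aside for cancellation. The remaining exponent m^2 + 3m - 1
    equals q^2 + q - 3.\<close>
  also have "\<dots> = CARD('F) * (2 ^ (m * m) * CARD('F) ^ (m * m + 3 * m - 1))"
  proof -
    have "m \<ge> 1" using m q_ge8 by simp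
    then have "3 * m + m * m = Suc (m * m + 3 * m - 1)" by simp
    then have "CARD('F) ^ (3 * m + m * m) = CARD('F) * CARD('F) ^ (m * m + 3 * m - 1)" by (metis power_Suc)
    moreover have "(CARD('F) * CARD('F)) ^ m * (CARD('F) * (2 * CARD('F)) ^ m) ^ m = 2 ^ (m * m) * CARD('F) ^ (3 * m + m * m)"
      by (simp add: power_mult_distrib power_mult[symmetric] power_add[symmetric] power2_eq_square mult_ac)
        (simp add: power_add mult_ac power_mult power2_eq_square power3_eq_cube)
    ultimately show ?thesis by simp
  qed
  finally have "CARD('F) * card (forests Usub ?A {mat 1}) = CARD('F) * (2 ^ (m * m) * CARD('F) ^ (m * m + 3 * m - 1))" .
  then have "CARD('F) = 0 \<or> card (forests Usub ?A {mat 1}) = 2 ^ (m * m) * CARD('F) ^ (m * m + 3 * m - 1)"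
    by (simp only: mult_cancel1) blast
  then have "card (forests Usub ?A {mat 1}) = 2 ^ (m * m) * CARD('F) ^ (m * m + 3 * m - 1)"
    using q_ge8 by linarith
  moreover have "m * m = (CARD('F) - 1)\<^sup>2" using m by (simp add: power2_eq_square)
  moreover have "m * m + 3 * m - 1 = CARD('F)\<^sup>2 + CARD('F) - 3" unfolding m by (simp add: power2_eq_square)
  ultimately show ?thesis by metis
qed

lemma prime_order_matrix_SG:
  assumes p: "prime p" "p dvd CARD('F)\<^sup>2 + 1" and z: "z \<in> Sz" "z \<noteq> mat 1" "z [^]\<^bsub>SG\<^esub> p = mat 1"
  shows "prime_order_matrix z p"
proof
  show "p \<noteq> 2" using p q_even by auto
  show "(((*v) z) ^^ p) v = v" for v using funpow_matrix[OF z(1)] z(3) by simp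
qed (use p z in auto)

lemma cent_SG: "group.cent SG z = {x \<in> Sz. x ** z = z ** x}"
  unfolding group.cent_def[OF group_SG] by simp

text \<open>Conjugates of \<open>z\<close> in its centralizer lie in the field \<open>K\<close>,
  which contains at most four of them.\<close>

lemma norm_bound_SG:
  assumes p: "prime p" "p dvd CARD('F)\<^sup>2 + 1" and z: "z \<in> Sz" "z \<noteq> mat 1" "z [^]\<^bsub>SG\<^esub> p = mat 1"
  shows "card {x \<in> Sz. x ** z ** inv\<^bsub>SG\<^esub> x \<in> group.cent SG z} \<le> 4 * card (group.cent SG z)"
proof -
  interpret group SG by (rule group_SG)
  interpret prime_order_matrix z p by (rule prime_order_matrix_SG[OF p z])
  let ?X = "{x \<in> Sz. x ** z ** inv\<^bsub>SG\<^esub> x \<in> cent z}"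
  have eq: "card ((\<lambda>x. x ** z ** inv\<^bsub>SG\<^esub> x) ` ?X) * card (cent z) = card ?X"
    using card_conjugates_cent[of z] z by simp
  have "card ((\<lambda>x. x ** z ** inv\<^bsub>SG\<^esub> x) ` ?X) \<le> 4"
  proof (rule card_conjugates)
    show "(\<lambda>x. x ** z ** inv\<^bsub>SG\<^esub> x) ` ?X \<subseteq> K"
    proof (rule image_subsetI)
      fix x assume "x \<in> ?X"
      then have "x ** z ** inv\<^bsub>SG\<^esub> x \<in> cent z" by (simp only: mem_Collect_eq)
      then show "x ** z ** inv\<^bsub>SG\<^esub> x \<in> K" unfolding K_def cent_SG
        by (simp only: mem_Collect_eq)
    qed
    fix y assume "y \<in> (\<lambda>x. x ** z ** inv\<^bsub>SG\<^esub> x) ` ?X"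
    then obtain x where x: "y = x ** z ** inv\<^bsub>SG\<^esub> x" "x \<in> ?X" by (rule imageE)
    have "x \<in> Sz" using x(2) by (simp only: mem_Collect_eq)
    then have "x ** inv\<^bsub>SG\<^esub> x = mat 1" "inv\<^bsub>SG\<^esub> x ** x = mat 1"
      using r_inv[of x] l_inv[of x] by simp_all
    then show "\<exists>x x'. x ** x' = mat 1 \<and> x' ** x = mat 1 \<and> y = x ** z ** x'"
      using x(1) by blast
  qed
  then show ?thesis unfolding eq[symmetric] by (rule mult_le_mono1)
qed

lemma suzuki_action_SG:
  "suzuki_action SG ovoid act (line ptinf) (line (pt 0 0)) CARD('F) (2 ^ ((CARD('F) - 1)\<^sup>2) * CARD('F) ^ (CARD('F)\<^sup>2 + CARD('F) - 3))"
proof -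
  interpret group SG by (rule group_SG)
  have H: "g \<in> Sz \<Longrightarrow> act g (line ptinf) = line ptinf \<Longrightarrow> act g (line (pt 0 0)) = line (pt 0 0) \<Longrightarrow>
      \<exists>l. l \<noteq> 0 \<and> g = sz_M n l" for g
    using stabilizer_base Sz_good by blast
  have Hset: "{g \<in> Sz. act g (line ptinf) = line ptinf \<and> act g (line (pt 0 0)) = line (pt 0 0)}
      = (\<lambda>l. sz_M n l) ` (UNIV - {0})"
  proof
    show "(\<lambda>l. sz_M n l) ` (UNIV - {0})
        \<subseteq> {g \<in> Sz. act g (line ptinf) = line ptinf \<and> act g (line (pt 0 0)) = line (pt 0 0)}"
      by (auto simp: Sz_gens act_M_ptinf act_M_pt)
    show "{g \<in> Sz. act g (line ptinf) = line ptinf \<and> act g (line (pt 0 0)) = line (pt 0 0)}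
        \<subseteq> (\<lambda>l. sz_M n l) ` (UNIV - {0})"
    proof
      fix g assume "g \<in> {g \<in> Sz. act g (line ptinf) = line ptinf \<and> act g (line (pt 0 0)) = line (pt 0 0)}"
      then obtain l where "l \<noteq> 0" "g = sz_M n l" using H[of g] by auto
      then show "g \<in> (\<lambda>l. sz_M n l) ` (UNIV - {0})" by simp
    qed
  qed
  have cH: "card ((\<lambda>l. sz_M n l :: 'F ^ 4 ^ 4) ` (UNIV - {0})) = CARD('F) - 1"
  proof -
    have "inj_on (\<lambda>l. sz_M n l :: 'F ^ 4 ^ 4) (UNIV - {0})" by (auto simp: inj_on_def M_inj)
    then show ?thesis by (simp add: card_image)
  qed
  show ?thesis
  proof unfold_locales
    show "finite (carrier SG)" by simp
    show "act g w \<in> ovoid" if "g \<in> carrier SG" "w \<in> ovoid" for g w using act_ovoid that by simp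
    show "act (g \<otimes>\<^bsub>SG\<^esub> h) w = act g (act h w)" for g h w by (simp add: act_mult)
    show "act \<one>\<^bsub>SG\<^esub> w = w" for w by (simp add: act_one)
    show "card ovoid = CARD('F)\<^sup>2 + 1" by (rule card_ovoid)
    show "\<exists>g\<in>carrier SG. act g (line ptinf) = x \<and> act g (line (pt 0 0)) = y"
      if "x \<in> ovoid" "y \<in> ovoid" "x \<noteq> y" for x y using Sz_trans2[OF that] by simp
    show "card {g \<in> carrier SG. act g (line ptinf) = line ptinf \<and> act g (line (pt 0 0)) = line (pt 0 0)} = CARD('F) - 1"
      using Hset cH by simp
    show "w = line ptinf \<or> w = line (pt 0 0)"
      if "g \<in> carrier SG" "act g (line ptinf) = line ptinf" "act g (line (pt 0 0)) = line (pt 0 0)"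
        "g \<noteq> \<one>\<^bsub>SG\<^esub>" "w \<in> ovoid" "act g w = w" for g w
    proof -
      have "\<exists>l. l \<noteq> 0 \<and> g = sz_M n l" using H[of g] that(1-3) by simp
      then obtain l where l: "l \<noteq> 0" "g = sz_M n l" by blast
      then have "l \<noteq> 1" using that(4) M_one by auto
      then show ?thesis using that(5,6) M_fixed_pt[OF l(1)] unfolding l(2) by (metis ovoidE)
    qed
    show "g \<otimes>\<^bsub>SG\<^esub> h = h \<otimes>\<^bsub>SG\<^esub> g"
      if "g \<in> carrier SG" "act g (line ptinf) = line ptinf" "act g (line (pt 0 0)) = line (pt 0 0)"
        "h \<in> carrier SG" "act h (line ptinf) = line ptinf" "act h (line (pt 0 0)) = line (pt 0 0)" for g h
      using H[of g] H[of h] that M_commute by auto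
    show "h \<otimes>\<^bsub>SG\<^esub> g \<noteq> g \<otimes>\<^bsub>SG\<^esub> h"
      if "g \<in> carrier SG" "act g (line ptinf) = line ptinf" "act g (line (pt 0 0)) = line (pt 0 0)"
        "g \<noteq> \<one>\<^bsub>SG\<^esub>" "h \<in> carrier SG" "act h (line ptinf) = line (pt 0 0)"
        "act h (line (pt 0 0)) = line ptinf" for g h
    proof -
      have "\<exists>l. l \<noteq> 0 \<and> g = sz_M n l" using H[of g] that(1-3) by simp
      then obtain l where l: "l \<noteq> 0" "g = sz_M n l" by blast
      then have "l \<noteq> 1" using that(4) M_one by auto
      then show ?thesis using M_swap[OF l(1)] that l(2) by simp
    qed
    show "card {g \<in> carrier SG - {\<one>\<^bsub>SG\<^esub>}. {w \<in> ovoid. act g w = w} = {line ptinf}} = CARD('F)\<^sup>2 - 1"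
      using card_Usub unfolding Usub_def by simp
    show "card (forests {g \<in> carrier SG - {\<one>\<^bsub>SG\<^esub>}. {w \<in> ovoid. act g w = w} = {line ptinf}}
        (\<lambda>x y. x \<otimes>\<^bsub>SG\<^esub> y = y \<otimes>\<^bsub>SG\<^esub> x) {\<one>\<^bsub>SG\<^esub>}) = 2 ^ ((CARD('F) - 1)\<^sup>2) * CARD('F) ^ (CARD('F)\<^sup>2 + CARD('F) - 3)"
      using card_forests_Usub unfolding Usub_def by simp
    show "g \<otimes>\<^bsub>SG\<^esub> h = h \<otimes>\<^bsub>SG\<^esub> g"
      if "prime p" "p dvd CARD('F)\<^sup>2 + 1" "z \<in> carrier SG" "z \<noteq> \<one>\<^bsub>SG\<^esub>" "z [^]\<^bsub>SG\<^esub> p = \<one>\<^bsub>SG\<^esub>"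
        "g \<in> cent z" "h \<in> cent z" for p z g h
    proof -
      interpret prime_order_matrix z p using prime_order_matrix_SG[OF that(1,2)] that by simp
      have "g \<in> K" "h \<in> K" using that(6,7) unfolding K_def cent_SG by blast+
      then show ?thesis using K_comm by simp
    qed
    show "card {x \<in> carrier SG. x \<otimes>\<^bsub>SG\<^esub> z \<otimes>\<^bsub>SG\<^esub> inv\<^bsub>SG\<^esub> x \<in> cent z} \<le> 4 * card (cent z)"
      if "prime p" "p dvd CARD('F)\<^sup>2 + 1" "z \<in> carrier SG" "z \<noteq> \<one>\<^bsub>SG\<^esub>" "z [^]\<^bsub>SG\<^esub> p = \<one>\<^bsub>SG\<^esub>" for p z
      using norm_bound_SG[OF that(1,2)] that by simp
  qed (use q_ge8 q_even ptinf_ovoid pt_ovoid in auto)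
qed

lemma kappa_C_Sz:
  "kappa_C Sz = card (forests (Sz - {mat 1}) (\<lambda>x y. x ** y = y ** x) {mat 1})"
  unfolding kappa_C_def
proof (rule num_spanning_trees_eq_card_forests)
  show "commuting_edges Sz = {{u, w} | u w. u \<in> Sz \<and> w \<in> Sz \<and> u \<noteq> w \<and> u ** w = w ** u}"
    unfolding commuting_edges_def by simp
qed (auto simp: Sz_closed)

end

theorem theorem3p10:
  fixes n :: nat and q r alpha beta a b c :: nat
  assumes "n \<ge> 1"
    and "CARD('F::{field,finite}) = 2 ^ (2 * n + 1)"
    and "q = 2 ^ (2 * n + 1)" and "r = 2 ^ (n + 1)"
    and "alpha = q - r + 1" and "beta = q + r + 1"
    and "a = q^2 * (q^2 + 1) div 2"
    and "b = q^2 * (q - 1) * beta div 4"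
    and "c = q^2 * (q - 1) * alpha div 4"
  shows "kappa_C (Suzuki n :: ('F ^ 4 ^ 4) set) =
    (2 ^ ((q - 1)^2) * q ^ (q^2 + q - 3)) ^ (q^2 + 1) * (q - 1) ^ ((q - 3) * a)
      * alpha ^ ((alpha - 2) * b) * beta ^ ((beta - 2) * c)"
proof -
  interpret suzuki_field n "TYPE('F)" by unfold_locales (fact assms)+
  interpret S: suzuki_action SG ovoid act "line ptinf" "line (pt 0 0)" "CARD('F)"
    "2 ^ ((CARD('F) - 1)\<^sup>2) * CARD('F) ^ (CARD('F)\<^sup>2 + CARD('F) - 3)"
    by (rule suzuki_action_SG)
  have q: "CARD('F) = q" using assms by simp
  have "card (forests (Sz - {mat 1}) (\<lambda>x y. x ** y = y ** x) {mat 1})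
    = (2 ^ ((q - 1)^2) * q ^ (q^2 + q - 3)) ^ (q^2 + 1) * (q - 1) ^ ((q - 3) * (q\<^sup>2 * (q\<^sup>2 + 1) div 2))
      * (q - r + 1) ^ ((q - r + 1 - 2) * (q\<^sup>2 * (q - 1) * (q + r + 1) div 4))
      * (q + r + 1) ^ ((q + r + 1 - 2) * (q\<^sup>2 * (q - 1) * (q - r + 1) div 4))"
    using S.card_forests_suzuki_action[OF assms(2,4)] unfolding q SG_simps .
  then show ?thesis unfolding kappa_C_Sz assms(5-9) .
qed

end
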